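(* Let $1<p<\infty$, let $\Omega\subseteq\mathbb{R}^n$, $n\ge 2$, be a bounded open set having $C^1$ boundary, and let $\gamma_1,\gamma_2$ be positive continuous functions on $\overline{\Omega}$. If $\Lambda_{\gamma_1}^{\mathbb{R}}=\Lambda_{\gamma_2}^{\mathbb{R}}$, then $\gamma_1|_{\partial\Omega}=\gamma_2|_{\partial\Omega}$.
   Context: For a positive $\gamma\in C(\overline{\Omega})$ and a real valued $f\in W^{1,p}(\Omega;\mathbb{R})$, let $u_f\in W^{1,p}(\Omega;\mathbb{R})$ be the unique weak solution of $\mathrm{div}(\gamma|\nabla u|^{p-2}\nabla u)=0$ in $\Omega$ with $u=f$ on $\partial\Omega$, meaning that $u_f-f\in W^{1,p}_0(\Omega;\mathbb{R})$ and $\int_\Omega\gamma|\nabla u_f|^{p-2}\nabla u_f\cdot\nabla\varphi\,dx=0$ for all $\varphi\in W^{1,p}_0(\Omega;\mathbb{R})$. Let $X=W^{1,p}(\Omega;\mathbb{R})/W^{1,p}_0(\Omega;\mathbb{R})$ be the abstract trace space and $X'$ its dual. The nonlinear Dirichlet-to-Neumann map $\Lambda_\gamma^{\mathbb{R}}:X\to X'$ is defined weakly by $$\langle\Lambda_\gamma^{\mathbb{R}}(f),g\rangle_{\partial\Omega}=\int_\Omega\gamma|\nabla u_f|^{p-2}\nabla u_f\cdot\nabla g\,dx,\qquad f,g\in X,$$ where on the right $g$ stands for any representative in $W^{1,p}(\Omega;\mathbb{R})$. The expression $|\xi|^{p-2}\xi$ is understood as $0$ when $\xi=0$. *)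

theory Defs
  imports "HOL-Analysis.Analysis"
begin

text \<open>
  A function on a set \<open>\<Omega>\<close> is represented by a total function whose values outside
  \<open>\<Omega>\<close> are irrelevant; elements of Lebesgue and Sobolev spaces are represented by
  functions rather than by classes modulo equality almost everywhere on \<open>\<Omega>\<close>.
\<close>

primrec Ck :: "nat \<Rightarrow> ('a::euclidean_space \<Rightarrow> real) \<Rightarrow> bool" where
  "Ck 0 f \<longleftrightarrow> continuous_on UNIV f"
| "Ck (Suc k) f \<longleftrightarrow> (\<exists>D. (\<forall>x. GDERIV f x :> D x) \<and> (\<forall>b\<in>Basis. Ck k (\<lambda>x. D x \<bullet> b)))"

definition test_functions :: "'a::euclidean_space set \<Rightarrow> ('a \<Rightarrow> real) set" where
  "test_functions \<Omega> =
     {\<psi>. (\<forall>k. Ck k \<psi>) \<and> compact (closure {x. \<psi> x \<noteq> 0}) \<and> closure {x. \<psi> x \<noteq> 0} \<subseteq> \<Omega>}"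

text \<open>
  Locally, \<open>\<Omega>\<close> is the strict epigraph of a \<open>C\<^sup>1\<close> function over the hyperplane orthogonal
  to a unit vector \<open>e\<close>, which plays the role of the last coordinate direction after a
  rotation. The vector \<open>y - (y \<bullet> e) *\<^sub>R e\<close> is the orthogonal projection of \<open>y\<close> onto that
  hyperplane, so only the values of \<open>h\<close> on the hyperplane matter.
\<close>

definition C1_boundary :: "'a::euclidean_space set \<Rightarrow> bool" where
  "C1_boundary \<Omega> \<longleftrightarrow>
     (\<forall>x\<in>frontier \<Omega>. \<exists>r>0. \<exists>e h. norm e = 1 \<and> Ck 1 h \<and>
        \<Omega> \<inter> ball x r = {y \<in> ball x r. h (y - (y \<bullet> e) *\<^sub>R e) < y \<bullet> e})"

definition locally_integrable ::
  "'a::euclidean_space set \<Rightarrow> ('a \<Rightarrow> 'b::euclidean_space) \<Rightarrow> bool" where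
  "locally_integrable \<Omega> f \<longleftrightarrow> (\<forall>K. compact K \<and> K \<subseteq> \<Omega> \<longrightarrow> f absolutely_integrable_on K)"

definition has_weak_gradient ::
  "'a::euclidean_space set \<Rightarrow> ('a \<Rightarrow> real) \<Rightarrow> ('a \<Rightarrow> 'a) \<Rightarrow> bool" where
  "has_weak_gradient \<Omega> u G \<longleftrightarrow>
     locally_integrable \<Omega> u \<and> locally_integrable \<Omega> G \<and>
     (\<forall>\<psi>\<in>test_functions \<Omega>. \<forall>D. (\<forall>x. GDERIV \<psi> x :> D x) \<longrightarrow>
        (LINT x|lebesgue_on \<Omega>. u x *\<^sub>R D x) = - (LINT x|lebesgue_on \<Omega>. \<psi> x *\<^sub>R G x))"

text \<open>
  For open \<open>\<Omega>\<close> the weak gradient is determined almost everywhere on \<open>\<Omega>\<close>; one version of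
  it is selected here.
\<close>

definition weak_gradient :: "'a::euclidean_space set \<Rightarrow> ('a \<Rightarrow> real) \<Rightarrow> 'a \<Rightarrow> 'a" where
  "weak_gradient \<Omega> u = (SOME G. has_weak_gradient \<Omega> u G)"

definition Lp :: "real \<Rightarrow> 'a::euclidean_space set \<Rightarrow> ('a \<Rightarrow> 'b::euclidean_space) set" where
  "Lp p \<Omega> = {f \<in> borel_measurable (lebesgue_on \<Omega>).
               integrable (lebesgue_on \<Omega>) (\<lambda>x. norm (f x) powr p)}"

definition W1p :: "real \<Rightarrow> 'a::euclidean_space set \<Rightarrow> ('a \<Rightarrow> real) set" where
  "W1p p \<Omega> = {u \<in> Lp p \<Omega>. \<exists>G\<in>Lp p \<Omega>. has_weak_gradient \<Omega> u G}"

definition W1p_norm :: "real \<Rightarrow> 'a::euclidean_space set \<Rightarrow> ('a \<Rightarrow> real) \<Rightarrow> real" where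
  "W1p_norm p \<Omega> u =
     ((LINT x|lebesgue_on \<Omega>. \<bar>u x\<bar> powr p)
      + (LINT x|lebesgue_on \<Omega>. norm (weak_gradient \<Omega> u x) powr p)) powr (1 / p)"

text \<open>The closure of the test functions in \<open>W\<^sup>1\<^sup>,\<^sup>p(\<Omega>)\<close>.\<close>

definition W1p_0 :: "real \<Rightarrow> 'a::euclidean_space set \<Rightarrow> ('a \<Rightarrow> real) set" where
  "W1p_0 p \<Omega> =
     {u \<in> W1p p \<Omega>. \<forall>\<epsilon>>0. \<exists>\<psi>\<in>test_functions \<Omega>. W1p_norm p \<Omega> (\<lambda>x. u x - \<psi> x) < \<epsilon>}"

text \<open>
  At \<open>\<nabla>u = 0\<close> the factor \<open>norm \<xi> powr (p - 2) *\<^sub>R \<xi>\<close> is \<open>0\<close>, as required.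
\<close>

definition p_energy_form ::
  "real \<Rightarrow> 'a::euclidean_space set \<Rightarrow> ('a \<Rightarrow> real) \<Rightarrow> ('a \<Rightarrow> real) \<Rightarrow> ('a \<Rightarrow> real) \<Rightarrow> real" where
  "p_energy_form p \<Omega> \<gamma> u g =
     (LINT x|lebesgue_on \<Omega>.
        \<gamma> x * ((norm (weak_gradient \<Omega> u x) powr (p - 2) *\<^sub>R weak_gradient \<Omega> u x)
               \<bullet> weak_gradient \<Omega> g x))"

definition weak_solution ::
  "real \<Rightarrow> 'a::euclidean_space set \<Rightarrow> ('a \<Rightarrow> real) \<Rightarrow> ('a \<Rightarrow> real) \<Rightarrow> ('a \<Rightarrow> real) \<Rightarrow> bool" where
  "weak_solution p \<Omega> \<gamma> f u \<longleftrightarrow>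
     u \<in> W1p p \<Omega> \<and> (\<lambda>x. u x - f x) \<in> W1p_0 p \<Omega> \<and>
     (\<forall>\<phi>\<in>W1p_0 p \<Omega>. p_energy_form p \<Omega> \<gamma> u \<phi> = 0)"

text \<open>
  Uniqueness of the solution is only up to equality almost everywhere on \<open>\<Omega>\<close>, hence the
  use of \<open>SOME\<close>.
\<close>

definition dirichlet_solution ::
  "real \<Rightarrow> 'a::euclidean_space set \<Rightarrow> ('a \<Rightarrow> real) \<Rightarrow> ('a \<Rightarrow> real) \<Rightarrow> 'a \<Rightarrow> real" where
  "dirichlet_solution p \<Omega> \<gamma> f = (SOME u. weak_solution p \<Omega> \<gamma> f u)"

definition trace_rel ::
  "real \<Rightarrow> 'a::euclidean_space set \<Rightarrow> (('a \<Rightarrow> real) \<times> ('a \<Rightarrow> real)) set" where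
  "trace_rel p \<Omega> = {(f, g). f \<in> W1p p \<Omega> \<and> g \<in> W1p p \<Omega> \<and> (\<lambda>x. f x - g x) \<in> W1p_0 p \<Omega>}"

definition trace_space :: "real \<Rightarrow> 'a::euclidean_space set \<Rightarrow> ('a \<Rightarrow> real) set set" where
  "trace_space p \<Omega> = W1p p \<Omega> // trace_rel p \<Omega>"

text \<open>
  The map sends a class \<open>F\<close> to a functional on classes \<open>H\<close>; the integral does not depend on
  the representatives chosen. Both functions are restricted to the trace space, so that
  equality of two such maps means equality on the trace space.
\<close>

definition DN_map ::
  "real \<Rightarrow> 'a::euclidean_space set \<Rightarrow> ('a \<Rightarrow> real)
     \<Rightarrow> ('a \<Rightarrow> real) set \<Rightarrow> ('a \<Rightarrow> real) set \<Rightarrow> real" where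
  "DN_map p \<Omega> \<gamma> =
     (\<lambda>F\<in>trace_space p \<Omega>. \<lambda>H\<in>trace_space p \<Omega>.
        p_energy_form p \<Omega> \<gamma> (dirichlet_solution p \<Omega> \<gamma> (SOME f. f \<in> F)) (SOME g. g \<in> H))"

end

theory Submission
  imports Defs
begin

text \<open>
  The value of the Dirichlet-to-Neumann map on a pair \<open>(f, f)\<close> is the minimal \<open>p\<close>-energy
  among the functions with trace \<open>f\<close>, so \<open>\<gamma>1\<close> and \<open>\<gamma>2\<close> have the same minima \<open>m f\<close>. Suppose that
  \<open>\<gamma>1 \<ge> (1 + d) * \<gamma>2\<close> near a boundary point \<open>x0\<close>, and let \<open>f\<close> be supported near \<open>x0\<close> with
  \<open>\<bar>f\<bar> \<le> 1\<close>. Truncating a minimizer for \<open>\<gamma>1\<close> and cutting it off away from \<open>x0\<close> produces a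
  competitor for \<open>\<gamma>2\<close>, whence \<open>(1 + d) * m f \<le> (1 + d/2) * m f + C\<close>. So \<open>m f\<close> is bounded
  independently of \<open>f\<close>, and every such \<open>f\<close> has an extension which is bounded in \<open>W\<^sup>1\<^sup>,\<^sup>p\<close> and
  in \<open>L\<^sup>\<infinity>\<close>.

  This fails for the rapidly oscillating data \<open>f = z * sin (N * (x \<bullet> t) + \<theta>)\<close> with \<open>t\<close> orthogonal
  to the direction \<open>e\<close> of the graph, because bounded sequences in \<open>W\<^sup>1\<^sup>,\<^sup>p\<close> have compact traces,
  whereas \<open>f\<close> tends to \<open>0\<close> weakly but not strongly on the boundary. The argument avoids
  boundary integrals: the integral of the \<open>e\<close>-derivative of \<open>f\<^sup>2\<close> over \<open>\<Omega>\<close> would tend to \<open>0\<close>;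
  adding the phases \<open>\<theta> = 0\<close> and \<open>\<theta> = pi / 2\<close>, the \<open>e\<close>-derivative of \<open>z\<^sup>2\<close> would have
  integral \<open>0\<close>, although \<open>z\<close> can be chosen to be decreasing in the direction \<open>e\<close>.
\<close>

section \<open>Smooth functions\<close>

text \<open>The equation is nonlinear and cannot be exploited by superposition, so only the diagonal
  values on pairs \<open>(f, f)\<close> are used: they are energies, and energies can be compared
  through competitors. Sobolev functions occur only until a solution is known to exist and to be a
  minimizer. Existence is essential: \<open>dirichlet_solution\<close> is chosen by
  \<open>SOME\<close>, and its value would say nothing if there were no solution. After that the
  infimum is expressed through test functions alone, and a near-minimizer \<open>f + \<psi>\<close>
  is smooth, so that truncation, cut-off and product rule are pointwise calculus. This is why the
  truncation is a smooth function; being the identity on \<open>[-1, 1]\<close> it must exceed 1,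
  whence the bound 3. Boundary values are compared through compact support: two extensions agree on
  the boundary if their difference is a test function. The \<open>C^1\<close> graph enters only in
  the construction of the bump \<open>z\<close>, and the dimension only in the choice of a direction
  of oscillation.\<close>

definition smooth :: "('a::euclidean_space \<Rightarrow> real) \<Rightarrow> bool" where
  "smooth f \<longleftrightarrow> (\<forall>k. Ck k f)"

text \<open>Turns the relation \<open>GDERIV\<close> into a function that can be integrated;
  \<open>GDERIV_unique\<close> justifies the description wherever a gradient exists.\<close>

definition grad :: "('a::euclidean_space \<Rightarrow> real) \<Rightarrow> 'a \<Rightarrow> 'a" where
  "grad f x = (THE D. GDERIV f x :> D)"

lemma GDERIV_unique:
  fixes D E :: "'a::euclidean_space"
  assumes "GDERIV f x :> D" "GDERIV f x :> E"
  shows "D = E"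
proof -
  have "(\<lambda>h. h \<bullet> D) = (\<lambda>h. h \<bullet> E)"
    using assms unfolding gderiv_def by (rule has_derivative_unique)
  then show ?thesis by (metis vector_eq_ldot)
qed

lemma grad_eqI: "GDERIV f x :> D \<Longrightarrow> grad f x = D"
  unfolding grad_def using GDERIV_unique by blast

lemma GDERIV_imp_continuous_on:
  assumes "\<And>x. GDERIV f x :> D x"
  shows "continuous_on S f"
  using assms has_derivative_continuous
  by (fastforce simp: gderiv_def intro!: continuous_at_imp_continuous_on)

lemma Ck_SucD: "Ck (Suc k) f \<Longrightarrow> Ck k f"
proof (induction k arbitrary: f)
  case 0
  then show ?case using GDERIV_imp_continuous_on by (metis Ck.simps)
next
  case (Suc k)
  then show ?case by (metis Ck.simps(2))
qed

lemma Ck_const: "Ck k (\<lambda>x. c)"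
proof (induction k arbitrary: c)
  case (Suc k)
  then show ?case
    by (auto intro!: exI[of _ "\<lambda>x. 0"] GDERIV_const)
qed auto

lemma Ck_add: "Ck k f \<Longrightarrow> Ck k g \<Longrightarrow> Ck k (\<lambda>x. f x + g x)"
proof (induction k arbitrary: f g)
  case 0
  then show ?case by (auto intro: continuous_on_add)
next
  case (Suc k)
  then obtain D E where D: "\<And>x. GDERIV f x :> D x" "\<forall>b\<in>Basis. Ck k (\<lambda>x. D x \<bullet> b)"
    and E: "\<And>x. GDERIV g x :> E x" "\<forall>b\<in>Basis. Ck k (\<lambda>x. E x \<bullet> b)"
    by auto
  show ?case
    unfolding Ck.simps using D E Suc.IH
    by (intro exI[of _ "\<lambda>x. D x + E x"]) (auto intro: GDERIV_add simp: inner_add_left)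
qed

lemma Ck_mult: "Ck k f \<Longrightarrow> Ck k g \<Longrightarrow> Ck k (\<lambda>x. f x * g x)"
proof (induction k arbitrary: f g)
  case 0
  then show ?case by (auto intro: continuous_on_mult)
next
  case (Suc k)
  then obtain D E where D: "\<And>x. GDERIV f x :> D x" "\<forall>b\<in>Basis. Ck k (\<lambda>x. D x \<bullet> b)"
    and E: "\<And>x. GDERIV g x :> E x" "\<forall>b\<in>Basis. Ck k (\<lambda>x. E x \<bullet> b)"
    by auto
  \<comment> \<open>The product rule brings back \<open>f\<close> and \<open>g\<close>
    undifferentiated, so both must also lie in the lower class.\<close>
  have fg: "Ck k f" "Ck k g" using Suc.prems Ck_SucD by auto
  show ?case
    unfolding Ck.simps using D E Suc.IH fg
    by (intro exI[of _ "\<lambda>x. f x *\<^sub>R E x + g x *\<^sub>R D x"])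
       (auto intro!: GDERIV_mult Ck_add simp: inner_add_left)
qed

lemma Ck_inner: "Ck k (\<lambda>x. x \<bullet> v)"
proof (cases k)
  case (Suc j)
  have "GDERIV (\<lambda>x. x \<bullet> v) x :> v" for x
    unfolding gderiv_def by (auto intro!: derivative_eq_intros)
  then show ?thesis using Suc by (auto intro!: exI[of _ "\<lambda>x. v"] Ck_const)
qed (auto intro!: continuous_intros)

text \<open>Each \<open>Ck (Suc k)\<close> supplies its own gradient field. Uniqueness of the
  gradient makes all of them the same \<open>D\<close>, whose components then lie in every class;
  this gives a coinductive form of smoothness.\<close>

lemma smooth_iff:
  "smooth f \<longleftrightarrow> (\<exists>D. (\<forall>x. GDERIV f x :> D x) \<and> (\<forall>b\<in>Basis. smooth (\<lambda>x. D x \<bullet> b)))"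
proof
  assume s: "smooth f"
  then obtain D where D: "\<And>x. GDERIV f x :> D x"
    unfolding smooth_def by (metis Ck.simps(2))
  have "Ck k (\<lambda>x. D x \<bullet> b)" if "b \<in> Basis" for k b
  proof -
    have "Ck (Suc k) f" using s unfolding smooth_def by blast
    then obtain E where "\<And>x. GDERIV f x :> E x" "\<forall>b\<in>Basis. Ck k (\<lambda>x. E x \<bullet> b)"
      unfolding Ck.simps by blast
    moreover have "E = D" using calculation(1) D GDERIV_unique by blast
    ultimately show ?thesis using that by auto
  qed
  then show "\<exists>D. (\<forall>x. GDERIV f x :> D x) \<and> (\<forall>b\<in>Basis. smooth (\<lambda>x. D x \<bullet> b))"
    using D unfolding smooth_def by blast
next
  assume "\<exists>D. (\<forall>x. GDERIV f x :> D x) \<and> (\<forall>b\<in>Basis. smooth (\<lambda>x. D x \<bullet> b))"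
  then obtain D where D: "\<And>x. GDERIV f x :> D x" "\<And>b. b\<in>Basis \<Longrightarrow> smooth (\<lambda>x. D x \<bullet> b)"
    by blast
  have "Ck (Suc k) f" for k
    using D unfolding smooth_def by auto
  then show "smooth f" unfolding smooth_def using Ck_SucD by blast
qed

lemma smooth_GDERIV: "smooth f \<Longrightarrow> GDERIV f x :> grad f x"
  using smooth_iff grad_eqI by metis

lemma smooth_continuous_on: "smooth f \<Longrightarrow> continuous_on S f"
  using smooth_GDERIV GDERIV_imp_continuous_on by blast

lemma smooth_const [simp]: "smooth (\<lambda>x. c)"
  by (simp add: smooth_def Ck_const)

lemma smooth_add: "smooth f \<Longrightarrow> smooth g \<Longrightarrow> smooth (\<lambda>x. f x + g x)"
  by (simp add: smooth_def Ck_add)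

lemma smooth_mult: "smooth f \<Longrightarrow> smooth g \<Longrightarrow> smooth (\<lambda>x. f x * g x)"
  by (simp add: smooth_def Ck_mult)

lemma smooth_inner [simp]: "smooth (\<lambda>x. x \<bullet> v)"
  by (simp add: smooth_def Ck_inner)

lemma smooth_id [simp]: "smooth (\<lambda>x::real. x)"
  using smooth_inner[of "1::real"] by simp

lemma smooth_minus: "smooth f \<Longrightarrow> smooth (\<lambda>x. - f x)"
  using smooth_mult[of "\<lambda>x. -1" f] by simp

lemma smooth_diff: "smooth f \<Longrightarrow> smooth g \<Longrightarrow> smooth (\<lambda>x. f x - g x)"
  using smooth_add[of f "\<lambda>x. - g x"] smooth_minus[of g] by simp

lemma smooth_sum: "(\<And>i. i \<in> I \<Longrightarrow> smooth (f i)) \<Longrightarrow> smooth (\<lambda>x. \<Sum>i\<in>I. f i x)"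
  by (induction I rule: infinite_finite_induct) (auto intro: smooth_add)

lemma smooth_prod: "(\<And>i. i \<in> I \<Longrightarrow> smooth (f i)) \<Longrightarrow> smooth (\<lambda>x. \<Prod>i\<in>I. f i x)"
  by (induction I rule: infinite_finite_induct) (auto intro: smooth_mult)

lemma smooth_power: "smooth f \<Longrightarrow> smooth (\<lambda>x. f x ^ n)"
  by (induction n) (auto intro: smooth_mult)

lemma smooth_grad:
  assumes "smooth f"
  shows "smooth (\<lambda>x. grad f x \<bullet> v)"
proof -
  obtain D where D: "\<And>x. GDERIV f x :> D x" "\<And>b. b\<in>Basis \<Longrightarrow> smooth (\<lambda>x. D x \<bullet> b)"
    using assms smooth_iff[of f] by blast
  then have "D = grad f" by (intro ext) (metis grad_eqI)
  then have *: "smooth (\<lambda>x. grad f x \<bullet> b)" if "b \<in> Basis" for b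
    using D(2) that by blast
  have "smooth (\<lambda>x. \<Sum>b\<in>Basis. (grad f x \<bullet> b) * (v \<bullet> b))"
    using * by (intro smooth_sum smooth_mult) auto
  moreover have "grad f x \<bullet> v = (\<Sum>b\<in>Basis. (grad f x \<bullet> b) * (v \<bullet> b))" for x
    by (rule euclidean_inner)
  ultimately show ?thesis by simp
qed

lemma continuous_on_grad: "smooth f \<Longrightarrow> continuous_on S (grad f)"
  by (rule continuous_on_componentwise[THEN iffD2]) (auto intro: smooth_continuous_on smooth_grad)

lemma smooth_realE:
  fixes \<phi> :: "real \<Rightarrow> real"
  assumes "smooth \<phi>"
  obtains \<phi>' where "smooth \<phi>'" "\<And>t. DERIV \<phi> t :> \<phi>' t"
  using assms smooth_iff[of \<phi>] by auto

lemma smooth_realI: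
  fixes \<phi> :: "real \<Rightarrow> real"
  assumes "smooth \<phi>'" "\<And>t. DERIV \<phi> t :> \<phi>' t"
  shows "smooth \<phi>"
  using assms smooth_iff[of \<phi>] by auto

text \<open>Differentiating \<open>\<phi> (f x)\<close> replaces \<open>\<phi>\<close> by its
  derivative and leaves \<open>f\<close> in place, so the induction generalizes the outer function
  only.\<close>

lemma smooth_compose:
  fixes \<phi> :: "real \<Rightarrow> real"
  assumes "smooth \<phi>" "smooth f"
  shows "smooth (\<lambda>x. \<phi> (f x))"
proof -
  have "Ck k (\<lambda>x. \<phi> (f x))" if "smooth \<phi>" for k and \<phi> :: "real \<Rightarrow> real"
    using that
  proof (induction k arbitrary: \<phi>)
    case 0
    have "continuous_on UNIV (\<phi> \<circ> f)"
      by (rule continuous_on_compose; rule smooth_continuous_on) (use assms 0 in auto)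
    then show ?case by (simp add: o_def)
  next
    case (Suc k)
    then obtain \<phi>' where p: "smooth \<phi>'" "\<And>t. DERIV \<phi> t :> \<phi>' t"
      using smooth_realE by blast
    have "GDERIV (\<lambda>x. \<phi> (f x)) x :> \<phi>' (f x) *\<^sub>R grad f x" for x
      using p smooth_GDERIV[OF assms(2)] GDERIV_DERIV_compose by blast
    moreover have "Ck k (\<lambda>x. \<phi>' (f x) *\<^sub>R grad f x \<bullet> b)" for b
      using Ck_mult[OF Suc.IH[OF p(1)]] smooth_grad[OF assms(2)]
      by (simp add: smooth_def)
    ultimately show ?case
      unfolding Ck.simps by (intro exI[of _ "\<lambda>x. \<phi>' (f x) *\<^sub>R grad f x"]) auto
  qed
  then show ?thesis using assms by (simp add: smooth_def)
qed

lemma smooth_exp: "smooth (exp :: real \<Rightarrow> real)"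
proof -
  have "Ck k (exp :: real \<Rightarrow> real)" for k
    by (induction k) (auto intro!: continuous_intros exI[of _ exp])
  then show ?thesis by (simp add: smooth_def)
qed

text \<open>Differentiation shifts the phase by \<open>pi/2\<close>. The family of all
  \<open>sin (t + c)\<close> is closed under it, so one induction serves both functions.\<close>

lemma smooth_sin_cos: "smooth (sin :: real \<Rightarrow> real)" "smooth (cos :: real \<Rightarrow> real)"
proof -
  have "Ck k (\<lambda>t::real. sin (t + c))" for k c
  proof (induction k arbitrary: c)
    case (Suc k)
    have "DERIV (\<lambda>t. sin (t + c)) t :> sin (t + (c + pi/2))" for t
      by (auto intro!: derivative_eq_intros simp: sin_add cos_add)
    then show ?case using Suc[of "c + pi/2"] by (auto intro!: exI[of _ "\<lambda>t. sin (t + (c + pi/2))"])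
  qed (auto intro!: continuous_intros)
  from this[of _ 0] this[of _ "pi/2"] show "smooth (sin :: real \<Rightarrow> real)" "smooth (cos :: real \<Rightarrow> real)"
    by (auto simp: smooth_def sin_add)
qed

section \<open>Rules for gradients of smooth functions\<close>

lemma grad_const: "grad (\<lambda>x. c) x = 0"
  by (rule grad_eqI) (rule GDERIV_const)

lemma grad_inner: "grad (\<lambda>x. x \<bullet> v) x = v"
  by (rule grad_eqI) (auto simp: gderiv_def intro!: derivative_eq_intros)

lemma grad_add: "smooth f \<Longrightarrow> smooth g \<Longrightarrow> grad (\<lambda>x. f x + g x) x = grad f x + grad g x"
  by (intro grad_eqI GDERIV_add smooth_GDERIV)

lemma grad_diff: "smooth f \<Longrightarrow> smooth g \<Longrightarrow> grad (\<lambda>x. f x - g x) x = grad f x - grad g x"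
  by (intro grad_eqI GDERIV_diff smooth_GDERIV)

lemma grad_mult:
  "smooth f \<Longrightarrow> smooth g \<Longrightarrow> grad (\<lambda>x. f x * g x) x = f x *\<^sub>R grad g x + g x *\<^sub>R grad f x"
  by (intro grad_eqI GDERIV_mult smooth_GDERIV)

lemma grad_compose:
  "DERIV \<phi> (f x) :> d \<Longrightarrow> smooth f \<Longrightarrow> grad (\<lambda>x. \<phi> (f x)) x = d *\<^sub>R grad f x"
  by (intro grad_eqI GDERIV_DERIV_compose smooth_GDERIV)

lemma grad_eq_0:
  assumes "x \<notin> closure {x. f x \<noteq> 0}"
  shows "grad f x = 0"
proof -
  have o: "open (- closure {x. f x \<noteq> 0})" by auto
  have z: "0 = f y" if "y \<in> - closure {x. f x \<noteq> 0}" for y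
    using that closure_subset[of "{x. f x \<noteq> 0}"] by (cases "f y = 0") auto
  have "x \<in> - closure {x. f x \<noteq> 0}" using assms by simp
  from has_derivative_transform_within_open[OF has_derivative_const[of 0] o this z]
  have "(f has_derivative (\<lambda>h. 0)) (at x)" .
  then have "GDERIV f x :> 0" unfolding gderiv_def by simp
  then show ?thesis by (rule grad_eqI)
qed

subsection \<open>Bump functions\<close>

text \<open>The powers of \<open>inverse t\<close> make the family closed under differentiation up
  to linear combinations; member 0 is the standard flat function.\<close>

definition flat :: "nat \<Rightarrow> real \<Rightarrow> real" where
  "flat n t = (if t > 0 then exp (- inverse t) * inverse t ^ n else 0)"

lemma flat_tendsto_0: "((\<lambda>t. exp (- inverse t) * inverse t ^ n) \<longlongrightarrow> 0) (at_right (0::real))"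
proof -
  have "((\<lambda>s::real. s ^ n / exp s) \<longlongrightarrow> 0) at_top"
    by (rule tendsto_power_div_exp_0)
  then have "((\<lambda>t::real. inverse t ^ n / exp (inverse t)) \<longlongrightarrow> 0) (at_right 0)"
    using filterlim_compose filterlim_inverse_at_top_right by blast
  then show ?thesis by (simp add: exp_minus field_simps)
qed

lemma DERIV_flat: "DERIV (flat n) t :> flat (n+2) t - real n * flat (n+1) t"
proof (cases t "0::real" rule: linorder_cases)
  case less
  have "DERIV (flat n) t :> 0"
    by (rule has_field_derivative_transform_within_open[of "\<lambda>t. 0" _ t "{..<0}"])
       (use less in \<open>auto simp: flat_def\<close>)
  then show ?thesis using less by (simp add: flat_def)
next
  case greater
  have *: "DERIV (\<lambda>t. exp (- inverse t) * inverse t ^ n) t :>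
      exp (- inverse t) * inverse t ^ (n+2) - real n * (exp (- inverse t) * inverse t ^ (n+1))"
  proof -
    have "DERIV (\<lambda>t. inverse t ^ n) t :> real n * inverse t ^ (n - 1) * (- (inverse t ^ 2))"
      using greater by (auto intro!: derivative_eq_intros simp: power2_eq_square)
    moreover have "real n * inverse t ^ (n - 1) * (- (inverse t ^ 2)) = - (real n * inverse t ^ (n + 1))"
      by (cases n) (auto simp: power2_eq_square)
    ultimately have d: "DERIV (\<lambda>t. inverse t ^ n) t :> - (real n * inverse t ^ (n + 1))" by metis
    have e: "DERIV (\<lambda>t. exp (- inverse t)) t :> exp (- inverse t) * inverse t ^ 2"
      using greater by (auto intro!: derivative_eq_intros simp: power2_eq_square)
    show ?thesis
      by (rule DERIV_cong[OF DERIV_mult[OF e d]]) (simp add: algebra_simps power2_eq_square)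
  qed
  then have "DERIV (flat n) t :>
      exp (- inverse t) * inverse t ^ (n+2) - real n * (exp (- inverse t) * inverse t ^ (n+1))"
    by (rule has_field_derivative_transform_within_open[of _ _ t "{0<..}"])
       (use greater in \<open>auto simp: flat_def\<close>)
  then show ?thesis using greater by (simp add: flat_def)
next
  case equal
  \<comment> \<open>At the origin the right difference quotient of \<open>flat n\<close> is
    \<open>flat (n + 1)\<close>, which tends to 0.\<close>
  have "((\<lambda>h. flat n h / h) \<longlongrightarrow> 0) (at_right 0)"
    using flat_tendsto_0[of "Suc n"]
    by (rule Lim_transform_eventually)
       (auto simp: flat_def eventually_at_right_less field_simps eventually_at_filter)
  moreover have "((\<lambda>h. flat n h / h) \<longlongrightarrow> 0) (at_left 0)"
    by (rule Lim_transform_eventually[OF tendsto_const])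
       (auto simp: flat_def eventually_at_filter)
  ultimately have "((\<lambda>h. flat n h / h) \<longlongrightarrow> 0) (at 0)"
    by (intro filterlim_split_at)
  then show ?thesis
    using equal by (simp add: DERIV_def flat_def)
qed

lemma smooth_flat: "smooth (flat n)"
proof -
  have "Ck k (flat n)" for k
  proof (induction k arbitrary: n)
    case 0
    have "isCont (flat n) t" for t using DERIV_flat DERIV_isCont by blast
    then show ?case by (simp add: continuous_at_imp_continuous_on)
  next
    case (Suc k)
    have "Ck k (\<lambda>x. flat (n+2) x + (- real n) * flat (n+1) x)"
      by (intro Ck_add Ck_mult Suc Ck_const)
    then show ?case
      using DERIV_flat[of n] by (auto intro!: exI[of _ "\<lambda>x. flat (n+2) x - real n * flat (n+1) x"])
  qed
  then show ?thesis by (simp add: smooth_def)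
qed

lemma flat_pos: "t > 0 \<Longrightarrow> flat n t > 0" and flat_nonneg: "flat n t \<ge> 0"
  and flat_eq_0: "t \<le> 0 \<Longrightarrow> flat n t = 0" and flat_0_le_1: "flat 0 t \<le> 1"
  by (auto simp: flat_def)

section \<open>Smooth steps and smooth truncations\<close>

lemma smooth_antiderivative:
  fixes b :: "real \<Rightarrow> real"
  assumes "smooth b"
  obtains B where "smooth B" "\<And>t. DERIV B t :> b t"
proof -
  have "isCont b t" for t
    using smooth_continuous_on[OF assms, of UNIV] by (simp add: continuous_on_eq_continuous_at)
  then obtain B where B: "\<And>t. (B has_vector_derivative b t) (at t)"
    using einterval_antiderivative[of "-\<infinity>" \<infinity> b] by auto
  then have "DERIV B t :> b t" for t
    by (simp add: has_real_derivative_iff_has_vector_derivative)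
  then show thesis using that smooth_realI assms by blast
qed

lemma smooth_step_exists:
  obtains S :: "real \<Rightarrow> real" where "smooth S" "\<And>t. 0 \<le> S t" "\<And>t. S t \<le> 1"
    "\<And>t. t \<le> 1 \<Longrightarrow> S t = 1" "\<And>t. t \<ge> 2 \<Longrightarrow> S t = 0"
proof -
  \<comment> \<open>Positive exactly between 1 and 2. Its antiderivative is constant on either side
    and only has to be reversed and normalized.\<close>
  define b where "b t = flat 0 (t - 1) * flat 0 (2 - t)" for t
  have sb: "smooth b"
    unfolding b_def
    by (intro smooth_mult smooth_compose[OF smooth_flat] smooth_diff smooth_id smooth_const)
  obtain B where B: "smooth B" "\<And>t. DERIV B t :> b t"
    using smooth_antiderivative[OF sb] by blast
  have bn: "b t \<ge> 0" for t by (simp add: b_def flat_nonneg)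
  have mono: "B s \<le> B t" if "s \<le> t" for s t
    using DERIV_nonneg_imp_nondecreasing[OF that, of B] B(2) bn by blast
  have lt: "B 1 < B 2"
  proof (rule DERIV_pos_imp_increasing_open[where f=B and a=1 and b=2])
    fix x :: real assume "1 < x" "x < 2"
    then show "\<exists>y. DERIV B x :> y \<and> y > 0"
      using B(2)[of x] by (intro exI[of _ "b x"]) (auto simp: b_def flat_pos)
  qed (use B in \<open>auto intro: smooth_continuous_on\<close>)
  have lo: "B t = B 1" if "t \<le> 1" for t
  proof (cases "t = 1")
    case False
    have "\<exists>z. t < z \<and> z < 1 \<and> B 1 - B t = (1 - t) * b z"
      using False that B(2) by (intro MVT2) auto
    then show ?thesis by (auto simp: b_def flat_eq_0)
  qed auto
  have hi: "B t = B 2" if "t \<ge> 2" for t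
  proof (cases "t = 2")
    case False
    have "\<exists>z. 2 < z \<and> z < t \<and> B t - B 2 = (t - 2) * b z"
      using False that B(2) by (intro MVT2) auto
    then show ?thesis by (auto simp: b_def flat_eq_0)
  qed auto
  have bds: "B 1 \<le> B t" "B t \<le> B 2" for t
  proof -
    show "B 1 \<le> B t" using mono[of 1 t] lo[of t] by (cases "t \<le> 1") auto
    show "B t \<le> B 2" using mono[of t 2] hi[of t] by (cases "t \<le> 2") auto
  qed
  define S where "S t = (B 2 - B t) * inverse (B 2 - B 1)" for t
  have "smooth S" unfolding S_def by (intro smooth_mult smooth_diff B smooth_const)
  moreover have "0 \<le> S t" "S t \<le> 1" for t
    using bds[of t] lt by (auto simp: S_def divide_simps)
  moreover have "S t = 1" if "t \<le> 1" for t
    unfolding S_def lo[OF that] using lt by simp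
  moreover have "S t = 0" if "t \<ge> 2" for t
    unfolding S_def hi[OF that] by simp
  ultimately show thesis using that[of S] by blast
qed

text \<open>\<open>T\<close> is the antiderivative of a plateau that is 1 on \<open>[-1, 1]\<close>
  and 0 outside \<open>(-2, 2)\<close>. The bound on \<open>T'\<close> keeps the energy from growing
  under composition, and the identity part preserves boundary data of modulus at most 1.\<close>

lemma smooth_truncation_exists:
  obtains T T' :: "real \<Rightarrow> real" where "smooth T" "\<And>t. DERIV T t :> T' t"
    "\<And>t. \<bar>T' t\<bar> \<le> 1" "\<And>t. \<bar>t\<bar> \<le> 1 \<Longrightarrow> T t = t" "\<And>t. \<bar>T t\<bar> \<le> 3"
proof -
  obtain S :: "real \<Rightarrow> real" where S: "smooth S" "\<And>t. 0 \<le> S t" "\<And>t. S t \<le> 1"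
    "\<And>t. t \<le> 1 \<Longrightarrow> S t = 1" "\<And>t. t \<ge> 2 \<Longrightarrow> S t = 0"
    using smooth_step_exists by blast
  define T' where "T' t = S t * S (- t)" for t
  have "smooth T'" unfolding T'_def
    using S(1) by (intro smooth_mult smooth_compose[OF S(1)] smooth_minus) auto
  then obtain B where B: "smooth B" "\<And>t. DERIV B t :> T' t"
    using smooth_antiderivative by blast
  define T where "T t = B t - B 0" for t
  have T: "smooth T" "\<And>t. DERIV T t :> T' t"
    unfolding T_def using B by (auto intro!: smooth_diff derivative_eq_intros)
  have T'1: "\<bar>T' t\<bar> \<le> 1" for t
    unfolding T'_def using S(2,3) by (simp add: abs_mult mult_le_one)
  have mvt: "\<exists>z. s < z \<and> z < t \<and> T t - T s = (t - s) * T' z" if "s < t" for s t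
    using that T(2) by (intro MVT2) auto
  have T'_eq: "T' t = 1" if "\<bar>t\<bar> \<le> 1" for t
    using that S(4)[of t] S(4)[of "-t"] by (auto simp: T'_def)
  have T'_eq0: "T' t = 0" if "\<bar>t\<bar> \<ge> 2" for t
    using that S(5)[of t] S(5)[of "-t"] by (auto simp: T'_def abs_if split: if_splits)
  have T0: "T 0 = 0" by (simp add: T_def)
  have id: "T u = u" if "\<bar>u\<bar> \<le> 1" for u
  proof (cases u "0::real" rule: linorder_cases)
    case less
    obtain z where "u < z" "z < 0" "T 0 - T u = (0 - u) * T' z" using mvt[OF less] by blast
    then show ?thesis using T0 T'_eq[of z] that by auto
  next
    case greater
    obtain z where "0 < z" "z < u" "T u - T 0 = (u - 0) * T' z" using mvt[OF greater] by blast
    then show ?thesis using T0 T'_eq[of z] that by auto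
  qed (auto simp: T0)
  have lip: "\<bar>T t - T s\<bar> \<le> \<bar>t - s\<bar>" if "s < t" for s t
  proof -
    obtain z where "T t - T s = (t - s) * T' z" using mvt[OF \<open>s < t\<close>] by blast
    then show ?thesis using T'1[of z] by (simp add: abs_mult mult_left_le)
  qed
  have bd2: "\<bar>T t\<bar> \<le> 2" if "\<bar>t\<bar> \<le> 2" for t
    using lip[of 0 t] lip[of t 0] that T0 by (cases t "0::real" rule: linorder_cases) auto
  have "\<bar>T t\<bar> \<le> 3" for t
  proof -
    consider "\<bar>t\<bar> \<le> 2" | "t > 2" | "t < -2" by linarith
    then show ?thesis
    proof cases
      case 2
      then obtain z where "2 < z" "T t - T 2 = (t - 2) * T' z" using mvt[of 2 t] by blast
      then show ?thesis using T'_eq0[of z] bd2[of 2] by auto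
    next
      case 3
      then obtain z where "z < -2" "T (-2) - T t = (-2 - t) * T' z" using mvt[of t "-2"] by blast
      then show ?thesis using T'_eq0[of z] bd2[of "-2"] by auto
    qed (use bd2[of t] in auto)
  qed
  then show thesis using that[OF T T'1 id] by blast
qed

section \<open>Weak gradients\<close>

lemma GDERIV_line:
  assumes "\<And>x. GDERIV g x :> D x"
  shows "DERIV (\<lambda>s. g (x + s *\<^sub>R v)) s :> v \<bullet> D (x + s *\<^sub>R v)"
proof -
  have "((\<lambda>s. x + s *\<^sub>R v) has_derivative (\<lambda>h. h *\<^sub>R v)) (at s)"
    by (auto intro!: derivative_eq_intros)
  from has_derivative_compose[OF this assms[unfolded gderiv_def]]
  have "((\<lambda>s. g (x + s *\<^sub>R v)) has_derivative (\<lambda>h. h * (v \<bullet> D (x + s *\<^sub>R v)))) (at s)" by simp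
  then show ?thesis by (simp add: has_field_derivative_def mult_commute_abs)
qed

lemma integral_lborel_translate:
  fixes g :: "'a::euclidean_space \<Rightarrow> real"
  assumes "continuous_on UNIV g"
  shows "(LINT x|lborel. g (x + c)) = (LINT x|lborel. g x)"
    and "integrable lborel g \<Longrightarrow> integrable lborel (\<lambda>x. g (x + c))"
proof -
  have m: "g \<in> borel_measurable borel" using assms by (rule borel_measurable_continuous_onI)
  have t: "(\<lambda>x. c + x) \<in> measurable lborel borel" by simp
  have "(LINT x|lborel. g x) = (LINT x|distr lborel borel ((+) c). g x)"
    by (simp add: lborel_distr_plus)
  also have "\<dots> = (LINT x|lborel. g (c + x))"
    using m t by (intro integral_distr) auto
  finally show "(LINT x|lborel. g (x + c)) = (LINT x|lborel. g x)" by (simp add: add.commute)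
  assume "integrable lborel g"
  then have "integrable (distr lborel borel ((+) c)) g" by (simp add: lborel_distr_plus)
  then have "integrable lborel (\<lambda>x. g (c + x))"
    using integrable_distr[OF t] by auto
  then show "integrable lborel (\<lambda>x. g (x + c))" by (simp add: add.commute)
qed

lemma integrable_lborel_compact_support:
  fixes g :: "'a::euclidean_space \<Rightarrow> 'b::euclidean_space"
  assumes "continuous_on UNIV g" "compact K" "\<And>x. x \<notin> K \<Longrightarrow> g x = 0"
  shows "integrable lborel g"
proof -
  have "integrable lborel (\<lambda>x. indicator K x *\<^sub>R g x)"
    using borel_integrable_compact[OF assms(2), of g] continuous_on_subset[OF assms(1)] by auto
  moreover have "(\<lambda>x. indicator K x *\<^sub>R g x) = g" using assms(3) by (auto simp: indicator_def)
  ultimately show ?thesis by simp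
qed

lemma bounded_compact_support:
  fixes g :: "'a::euclidean_space \<Rightarrow> 'b::real_normed_vector"
  assumes "continuous_on UNIV g" "compact K" "\<And>x. x \<notin> K \<Longrightarrow> g x = 0"
  obtains B where "B \<ge> 0" "\<And>x. norm (g x) \<le> B"
proof -
  have "bounded (g ` K)"
    by (intro compact_imp_bounded compact_continuous_image assms continuous_on_subset[OF assms(1)]) auto
  then obtain B where "\<And>x. x \<in> K \<Longrightarrow> norm (g x) \<le> B" "B > 0"
    unfolding bounded_pos by auto
  then have "norm (g x) \<le> B" for x using assms(3)[of x] by (cases "x \<in> K") auto
  then show thesis using that \<open>B > 0\<close> by (metis less_imp_le)
qed

text \<open>Difference quotients of a compactly supported function integrate to \<open>0\<close> by
  translation invariance.\<close>

lemma integral_derivative_compact_support: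
  fixes g :: "'a::euclidean_space \<Rightarrow> real"
  assumes g: "\<And>x. GDERIV g x :> D x" and D: "continuous_on UNIV D"
    and K: "compact K" "\<And>x. x \<notin> K \<Longrightarrow> g x = 0" "\<And>x. x \<notin> K \<Longrightarrow> D x = 0"
  shows "(LINT x|lborel. v \<bullet> D x) = 0"
proof -
  define h where "h n = inverse (real (Suc n))" for n
  have h: "h n > 0" "h n \<le> 1" for n by (auto simp: h_def divide_simps)
  have h0: "h \<longlonglongrightarrow> 0" unfolding h_def by (rule LIMSEQ_inverse_real_of_nat)
  have gc: "continuous_on UNIV g" using g GDERIV_imp_continuous_on by blast
  have Dc: "continuous_on UNIV (\<lambda>x. v \<bullet> D x)" by (intro continuous_intros D)
  obtain B where B: "B \<ge> 0" "\<And>x. norm (v \<bullet> D x) \<le> B"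
    using bounded_compact_support[OF Dc K(1)] K(3) by (metis inner_zero_right)
  obtain R where R: "\<And>x. x \<in> K \<Longrightarrow> norm x \<le> R" using K(1) compact_imp_bounded bounded_iff by metis
  define F where "F n x = (g (x + h n *\<^sub>R v) - g x) / h n" for n x
  have lim: "(\<lambda>n. F n x) \<longlonglongrightarrow> v \<bullet> D x" for x
  proof -
    have "((\<lambda>s. (g (x + s *\<^sub>R v) - g x) / s) \<longlongrightarrow> v \<bullet> D x) (at 0)"
      using GDERIV_line[OF g, of x v 0] by (simp add: DERIV_def)
    moreover have "filterlim h (at 0) sequentially"
      using h0 h(1) by (auto simp: filterlim_at less_imp_neq[symmetric])
    ultimately show ?thesis unfolding F_def by (rule filterlim_compose)
  qed
  \<comment> \<open>The mean value theorem bounds the quotient by \<open>B\<close>. The steps are at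
    most 1, so nothing happens outside the ball of radius \<open>R + norm v\<close>, and the
    majorant is integrable.\<close>
  have bd: "norm (F n x) \<le> B * indicator (cball 0 (R + norm v)) x" for n x
  proof (cases "x \<in> cball 0 (R + norm v)")
    case True
    obtain z where z: "g (x + h n *\<^sub>R v) - g (x + 0 *\<^sub>R v) = (h n - 0) * (v \<bullet> D (x + z *\<^sub>R v))"
      using MVT2[of 0 "h n" "\<lambda>s. g (x + s *\<^sub>R v)" "\<lambda>s. v \<bullet> D (x + s *\<^sub>R v)"] GDERIV_line[OF g] h by blast
    then have "F n x = v \<bullet> D (x + z *\<^sub>R v)" using h(1)[of n] by (simp add: F_def)
    then show ?thesis using B True by simp
  next
    case False
    then have "norm x > R + norm v" by (simp add: dist_norm)
    moreover have "norm x \<le> norm (x + h n *\<^sub>R v) + norm (h n *\<^sub>R v)"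
      by (metis add_diff_cancel_right' norm_triangle_ineq4)
    moreover have "norm (h n *\<^sub>R v) \<le> norm v" using h[of n] by (simp add: mult_left_le_one_le)
    ultimately have "norm (x + h n *\<^sub>R v) > R" "norm x > R" using norm_ge_zero[of v] by linarith+
    then have "x \<notin> K" "x + h n *\<^sub>R v \<notin> K" using R by force+
    then show ?thesis using K(2) False by (simp add: F_def)
  qed
  have gi: "integrable lborel g" using integrable_lborel_compact_support gc K by blast
  have Fi: "integrable lborel (F n)" "integral\<^sup>L lborel (F n) = 0" for n
    unfolding F_def using integral_lborel_translate[OF gc] gi by auto
  have "(\<lambda>n. integral\<^sup>L lborel (F n)) \<longlonglongrightarrow> (LINT x|lborel. v \<bullet> D x)"
  proof (rule integral_dominated_convergence)
    show "integrable lborel (\<lambda>x. B * indicator (cball 0 (R + norm v)) x)"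
      by (intro integrable_mult_right integrable_real_indicator) (use emeasure_bounded_finite[of "cball 0 (R + norm v)"] in auto)
    show "(\<lambda>x. v \<bullet> D x) \<in> borel_measurable lborel"
      using Dc by (simp add: borel_measurable_continuous_onI)
  qed (use Fi lim bd in auto)
  then have "(\<lambda>n::nat. 0) \<longlonglongrightarrow> (LINT x|lborel. v \<bullet> D x)" by (simp only: Fi(2))
  then show ?thesis by (simp add: LIMSEQ_const_iff)
qed

section \<open>Smooth approximation of indicators and exhaustion of open sets\<close>

definition box_bump :: "'a::euclidean_space \<Rightarrow> 'a \<Rightarrow> 'a \<Rightarrow> real" where
  "box_bump a b x = (\<Prod>i\<in>Basis. flat 0 (x \<bullet> i - a \<bullet> i) * flat 0 (b \<bullet> i - x \<bullet> i))"

lemma smooth_box_bump: "smooth (box_bump a b)"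
proof -
  have "smooth (\<lambda>x. flat 0 (x \<bullet> i - a \<bullet> i) * flat 0 (b \<bullet> i - x \<bullet> i))" for i
    by (intro smooth_mult smooth_compose[OF smooth_flat] smooth_diff smooth_inner smooth_const)
  then show ?thesis unfolding box_bump_def[abs_def] by (intro smooth_prod) auto
qed

lemma box_bump_nonneg: "box_bump a b x \<ge> 0"
  unfolding box_bump_def by (intro prod_nonneg mult_nonneg_nonneg flat_nonneg)

lemma box_bump_pos: "x \<in> box a b \<Longrightarrow> box_bump a b x > 0"
  unfolding box_bump_def by (intro prod_pos) (auto simp: box_def flat_pos)

lemma box_bump_eq_0: "x \<notin> box a b \<Longrightarrow> box_bump a b x = 0"
  unfolding box_bump_def by (force simp: box_def flat_eq_0 not_less)

text \<open>With \<open>c\<close> the value of a nonnegative bump, this makes smooth functions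
  converge to the indicator of the set where the bump is positive.\<close>

lemma one_minus_exp_tendsto:
  assumes "c > (0::real)"
  shows "(\<lambda>k. 1 - exp (- (real k * c))) \<longlonglongrightarrow> 1"
proof -
  have "(\<lambda>k. exp (- c) ^ k) \<longlonglongrightarrow> 0"
    using assms by (intro LIMSEQ_power_zero) auto
  then have "(\<lambda>k. exp (- (real k * c))) \<longlonglongrightarrow> 0"
    by (simp add: exp_of_nat_mult[symmetric])
  from tendsto_diff[OF tendsto_const this, of 1] show ?thesis by simp
qed

lemma smooth_one_minus_exp: "smooth f \<Longrightarrow> smooth (\<lambda>x. 1 - exp (- (c * f x)))"
  by (intro smooth_diff smooth_const smooth_compose[OF smooth_exp] smooth_minus smooth_mult)

lemma test_functionsI:
  assumes "smooth f" "compact K" "K \<subseteq> \<Omega>" "\<And>x. x \<notin> K \<Longrightarrow> f x = 0"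
  shows "f \<in> test_functions \<Omega>"
proof -
  have "closure {x. f x \<noteq> 0} \<subseteq> K"
    using assms by (intro closure_minimal compact_imp_closed) auto
  then have "compact (closure {x. f x \<noteq> 0})" "closure {x. f x \<noteq> 0} \<subseteq> \<Omega>"
    using assms compact_Int_closed[of K "closure {x. f x \<noteq> 0}"] by (auto simp: Int_absorb1)
  then show ?thesis using assms(1) by (auto simp: test_functions_def smooth_def)
qed

lemma test_functionsE:
  assumes "f \<in> test_functions \<Omega>"
  obtains K where "smooth f" "compact K" "K \<subseteq> \<Omega>" "\<And>x. x \<notin> K \<Longrightarrow> f x = 0" "\<And>x. x \<notin> K \<Longrightarrow> grad f x = 0"
proof (rule that)
  show "smooth f" "compact (closure {x. f x \<noteq> 0})" "closure {x. f x \<noteq> 0} \<subseteq> \<Omega>"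
    using assms by (auto simp: test_functions_def smooth_def)
  show "f x = 0" if "x \<notin> closure {x. f x \<noteq> 0}" for x
    using that closure_subset[of "{x. f x \<noteq> 0}"] by (cases "f x = 0") auto
qed (rule grad_eq_0)

lemma test_functions_smooth: "f \<in> test_functions \<Omega> \<Longrightarrow> smooth f"
  using test_functionsE by metis

lemma test_functions_mult:
  assumes "f \<in> test_functions \<Omega>" "smooth g"
  shows "(\<lambda>x. f x * g x) \<in> test_functions \<Omega>" "(\<lambda>x. g x * f x) \<in> test_functions \<Omega>"
proof -
  obtain K where "smooth f" "compact K" "K \<subseteq> \<Omega>" "\<And>x. x \<notin> K \<Longrightarrow> f x = 0"
    using test_functionsE[OF assms(1)] by metis
  then show "(\<lambda>x. f x * g x) \<in> test_functions \<Omega>" "(\<lambda>x. g x * f x) \<in> test_functions \<Omega>"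
    using assms by (auto intro!: test_functionsI[of _ K] smooth_mult)
qed

lemma test_functions_add:
  assumes "f \<in> test_functions \<Omega>" "g \<in> test_functions \<Omega>"
  shows "(\<lambda>x. f x + g x) \<in> test_functions \<Omega>"
proof -
  obtain K where K: "smooth f" "compact K" "K \<subseteq> \<Omega>" "\<And>x. x \<notin> K \<Longrightarrow> f x = 0"
    using test_functionsE[OF assms(1)] by metis
  obtain L where L: "smooth g" "compact L" "L \<subseteq> \<Omega>" "\<And>x. x \<notin> L \<Longrightarrow> g x = 0"
    using test_functionsE[OF assms(2)] by metis
  show ?thesis
    using K L by (intro test_functionsI[of _ "K \<union> L"] smooth_add compact_Un) auto
qed

lemma test_functions_0 [simp]: "(\<lambda>x. 0) \<in> test_functions \<Omega>"
  by (intro test_functionsI[of _ "{}"]) auto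

lemma test_functions_cmult: "f \<in> test_functions \<Omega> \<Longrightarrow> (\<lambda>x. c * f x) \<in> test_functions \<Omega>"
  by (rule test_functions_mult) auto

lemma test_functions_diff:
  "f \<in> test_functions \<Omega> \<Longrightarrow> g \<in> test_functions \<Omega> \<Longrightarrow> (\<lambda>x. f x - g x) \<in> test_functions \<Omega>"
  using test_functions_add[OF _ test_functions_cmult[of g _ "-1"], of f] by simp

text \<open>By the Lindelof property countably many open boxes with closure in
  \<open>\<Omega>\<close> cover it. The sum of the first \<open>k\<close> bumps, multiplied by
  \<open>k\<close> and pushed below 1 by \<open>1 - exp (- s)\<close>, has compact support and tends
  to 1 wherever some bump is positive.\<close>

lemma test_functions_exhaust:
  fixes \<Omega> :: "'a::euclidean_space set"
  assumes "open \<Omega>"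
  obtains \<kappa> :: "nat \<Rightarrow> 'a \<Rightarrow> real" where "\<And>k. \<kappa> k \<in> test_functions \<Omega>"
    "\<And>k x. 0 \<le> \<kappa> k x" "\<And>k x. \<kappa> k x \<le> 1" "\<And>x. x \<in> \<Omega> \<Longrightarrow> (\<lambda>k. \<kappa> k x) \<longlonglongrightarrow> 1"
proof -
  define F where "F = {box a b | a b :: 'a. cbox a b \<subseteq> \<Omega>}"
  have "\<exists>S\<in>F. x \<in> S" if x: "x \<in> \<Omega>" for x
  proof -
    obtain a b where "x \<in> box a b" "cbox a b \<subseteq> \<Omega>"
      using open_contains_cbox[OF assms x] by metis
    then show ?thesis by (auto simp: F_def)
  qed
  then have UF: "\<Union>F = \<Omega>" using box_subset_cbox by (fastforce simp: F_def)
  have "\<And>S. S \<in> F \<Longrightarrow> open S" by (auto simp: F_def open_box)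
  then obtain F' where F': "F' \<subseteq> F" "countable F'" "\<Union>F' = \<Union>F" using Lindelof by metis
  \<comment> \<open>An empty box is added so that the family can be enumerated even if
    \<open>\<Omega>\<close> is empty.\<close>
  have e: "cbox (One::'a) 0 = {}" using SOME_Basis by (force simp: box_eq_empty)
  then have "{} \<in> F" unfolding F_def using box_subset_cbox[of "One::'a" 0] by auto
  define F'' where "F'' = insert {} F'"
  have F'': "F'' \<subseteq> F" "countable F''" "F'' \<noteq> {}" "\<Union>F'' = \<Omega>"
    using F' \<open>{} \<in> F\<close> UF by (auto simp: F''_def)
  have "\<exists>a b. from_nat_into F'' n = box a b \<and> cbox a b \<subseteq> \<Omega>" for n
    using from_nat_into[OF F''(3), of n] F''(1) by (auto simp: F_def)
  then obtain a b where ab: "\<And>n. from_nat_into F'' n = box (a n) (b n)" "\<And>n. cbox (a n) (b n) \<subseteq> \<Omega>"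
    by metis
  define f where "f k x = (\<Sum>i<k. box_bump (a i) (b i) x)" for k x
  define \<kappa> where "\<kappa> k x = 1 - exp (- (real k * f k x))" for k x
  have fnn: "f k x \<ge> 0" for k x unfolding f_def by (intro sum_nonneg box_bump_nonneg)
  have "\<kappa> k \<in> test_functions \<Omega>" for k
  proof (rule test_functionsI)
    show "smooth (\<kappa> k)" unfolding \<kappa>_def f_def
      by (intro smooth_one_minus_exp smooth_sum smooth_box_bump)
    show "compact (\<Union>i<k. cbox (a i) (b i))" by auto
    show "(\<Union>i<k. cbox (a i) (b i)) \<subseteq> \<Omega>" using ab by auto
    fix x assume "x \<notin> (\<Union>i<k. cbox (a i) (b i))"
    then have "f k x = 0" unfolding f_def
      using box_subset_cbox by (fastforce intro!: sum.neutral box_bump_eq_0)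
    then show "\<kappa> k x = 0" by (simp add: \<kappa>_def)
  qed
  moreover have "0 \<le> \<kappa> k x" "\<kappa> k x \<le> 1" for k x using fnn[of k x] by (auto simp: \<kappa>_def)
  moreover have "(\<lambda>k. \<kappa> k x) \<longlonglongrightarrow> 1" if x: "x \<in> \<Omega>" for x
  proof -
    obtain j where j: "x \<in> box (a j) (b j)"
      using x F'' ab(1) by (metis UnionE from_nat_into_surj)
    define c where "c = box_bump (a j) (b j) x"
    have c: "c > 0" using j box_bump_pos by (auto simp: c_def)
    have "c \<le> f k x" if "k > j" for k
      unfolding c_def f_def using that by (intro member_le_sum) (auto simp: box_bump_nonneg)
    then have "1 - exp (- (real k * c)) \<le> \<kappa> k x" if "k > j" for k
      using that by (simp add: \<kappa>_def mult_left_mono)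
    then have "\<forall>\<^sub>F k in sequentially. 1 - exp (- (real k * c)) \<le> \<kappa> k x"
      using eventually_gt_at_top[of j] by (rule eventually_mono[rotated])
    moreover have "\<forall>\<^sub>F k in sequentially. \<kappa> k x \<le> 1" using fnn[of _ x] by (auto simp: \<kappa>_def)
    ultimately show ?thesis
      by (rule tendsto_sandwich[OF _ _ one_minus_exp_tendsto[OF c] tendsto_const])
  qed
  ultimately show thesis using that by blast
qed

text \<open>Links the measure on \<open>\<Omega>\<close> used by the definitions with the
  translation-invariant measure on the whole space used for integration by parts.\<close>

lemma lebesgue_on_compact_support:
  fixes F :: "'a::euclidean_space \<Rightarrow> 'b::euclidean_space"
  assumes "open \<Omega>" "continuous_on UNIV F" "compact K" "K \<subseteq> \<Omega>" "\<And>x. x \<notin> K \<Longrightarrow> F x = 0"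
  shows "integrable (lebesgue_on \<Omega>) F" "(LINT x|lebesgue_on \<Omega>. F x) = (LINT x|lborel. F x)"
proof -
  have O: "\<Omega> \<inter> space lebesgue \<in> sets lebesgue" using assms(1) by simp
  have m: "F \<in> borel_measurable lborel" using assms(2) by (simp add: borel_measurable_continuous_onI)
  have i: "integrable lborel F" using integrable_lborel_compact_support assms(2,3,5) by blast
  have e: "(\<lambda>x. indicator \<Omega> x *\<^sub>R F x) = F" using assms(4,5) by (auto simp: indicator_def fun_eq_iff)
  show "integrable (lebesgue_on \<Omega>) F"
    unfolding integrable_restrict_space[OF O] e using i integrable_completion[OF m] by simp
  show "(LINT x|lebesgue_on \<Omega>. F x) = (LINT x|lborel. F x)"
    unfolding integral_restrict_space[OF O] e using integral_completion[OF m] by simp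
qed

lemma integral_derivative_eq_0:
  fixes g :: "'a::euclidean_space \<Rightarrow> real"
  assumes "open \<Omega>" "\<And>x. GDERIV g x :> D x" "continuous_on UNIV D"
    and K: "compact K" "K \<subseteq> \<Omega>" "\<And>x. x \<notin> K \<Longrightarrow> g x = 0" "\<And>x. x \<notin> K \<Longrightarrow> D x = 0"
  shows "(LINT x|lebesgue_on \<Omega>. D x \<bullet> v) = 0"
proof -
  have "(LINT x|lebesgue_on \<Omega>. D x \<bullet> v) = (LINT x|lborel. D x \<bullet> v)"
    using assms by (intro lebesgue_on_compact_support(2)[of \<Omega> _ K]) (auto intro!: continuous_intros)
  also have "\<dots> = 0"
    using integral_derivative_compact_support[OF assms(2,3) K(1,3,4), of v] by (simp add: inner_commute)
  finally show ?thesis .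
qed

lemma integral_grad_test_function:
  assumes "open \<Omega>" "\<psi> \<in> test_functions \<Omega>"
  shows "(LINT x|lebesgue_on \<Omega>. grad \<psi> x \<bullet> v) = 0"
proof -
  obtain K where K: "smooth \<psi>" "compact K" "K \<subseteq> \<Omega>" "\<And>x. x \<notin> K \<Longrightarrow> \<psi> x = 0" "\<And>x. x \<notin> K \<Longrightarrow> grad \<psi> x = 0"
    using test_functionsE[OF assms(2)] by metis
  show ?thesis
    by (rule integral_derivative_eq_0[OF assms(1) smooth_GDERIV[OF K(1)] continuous_on_grad[OF K(1)] K(2-5)])
qed

lemma locally_integrable_continuous:
  fixes f :: "'a::euclidean_space \<Rightarrow> 'b::euclidean_space"
  assumes "continuous_on UNIV f"
  shows "locally_integrable \<Omega> f"
  unfolding locally_integrable_def set_integrable_def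
proof clarify
  fix K :: "'a set" assume "compact K"
  then have "integrable lborel (\<lambda>x. indicator K x *\<^sub>R f x)"
    using borel_integrable_compact continuous_on_subset[OF assms] by blast
  then show "integrable lebesgue (\<lambda>x. indicator K x *\<^sub>R f x)"
    using integrable_completion borel_measurable_integrable by blast
qed

lemma continuous_imp_borel_measurable_lebesgue:
  "continuous_on UNIV f \<Longrightarrow> f \<in> borel_measurable lebesgue"
  using continuous_imp_measurable_on_sets_lebesgue[of UNIV f] by (simp add: lebesgue_on_UNIV_eq)

text \<open>Product rule for \<open>f * \<psi>\<close>, whose gradient integrates to 0 in every
  direction because the product is a test function.\<close>

lemma has_weak_gradient_smooth:
  assumes "open \<Omega>" "smooth f"
  shows "has_weak_gradient \<Omega> f (grad f)"
  unfolding has_weak_gradient_def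
proof (intro conjI ballI allI impI)
  show "locally_integrable \<Omega> f" "locally_integrable \<Omega> (grad f)"
    using locally_integrable_continuous smooth_continuous_on[OF assms(2)] continuous_on_grad[OF assms(2)] by blast+
  fix \<psi> D assume t: "\<psi> \<in> test_functions \<Omega>" and "\<forall>x. GDERIV \<psi> x :> D x"
  then have D: "D = grad \<psi>" by (intro ext) (metis grad_eqI)
  obtain K where K: "smooth \<psi>" "compact K" "K \<subseteq> \<Omega>" "\<And>x. x \<notin> K \<Longrightarrow> \<psi> x = 0" "\<And>x. x \<notin> K \<Longrightarrow> grad \<psi> x = 0"
    using test_functionsE[OF t] by metis
  have i1: "integrable (lebesgue_on \<Omega>) (\<lambda>x. f x *\<^sub>R grad \<psi> x)"
    using K by (intro lebesgue_on_compact_support(1)[OF assms(1) _ K(2,3)] continuous_intros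
      smooth_continuous_on[OF assms(2)] continuous_on_grad) auto
  have i2: "integrable (lebesgue_on \<Omega>) (\<lambda>x. \<psi> x *\<^sub>R grad f x)"
    using K by (intro lebesgue_on_compact_support(1)[OF assms(1) _ K(2,3)] continuous_intros
      smooth_continuous_on continuous_on_grad assms(2)) auto
  have "(LINT x|lebesgue_on \<Omega>. f x *\<^sub>R grad \<psi> x + \<psi> x *\<^sub>R grad f x) \<bullet> b = 0" for b
  proof -
    have "(LINT x|lebesgue_on \<Omega>. f x *\<^sub>R grad \<psi> x + \<psi> x *\<^sub>R grad f x) \<bullet> b
        = (LINT x|lebesgue_on \<Omega>. (f x *\<^sub>R grad \<psi> x + \<psi> x *\<^sub>R grad f x) \<bullet> b)"
      using i1 i2 by (subst integral_inner_left) auto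
    also have "\<dots> = (LINT x|lebesgue_on \<Omega>. grad (\<lambda>x. f x * \<psi> x) x \<bullet> b)"
      using assms(2) K(1) by (simp add: grad_mult)
    also have "\<dots> = 0"
      using integral_grad_test_function[OF assms(1) test_functions_mult(2)[OF t assms(2)]] .
    finally show ?thesis .
  qed
  then have "(LINT x|lebesgue_on \<Omega>. f x *\<^sub>R grad \<psi> x + \<psi> x *\<^sub>R grad f x) = 0"
    by (metis inner_eq_zero_iff)
  then show "(LINT x|lebesgue_on \<Omega>. f x *\<^sub>R D x) = - (LINT x|lebesgue_on \<Omega>. \<psi> x *\<^sub>R grad f x)"
    using i1 i2 D by (simp add: eq_neg_iff_add_eq_0)
qed

section \<open>The fundamental lemma and uniqueness of weak gradients\<close>

lemma integrable_test_function_mult: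
  fixes g :: "'a::euclidean_space \<Rightarrow> 'b::euclidean_space"
  assumes "open \<Omega>" "locally_integrable \<Omega> g" "\<kappa> \<in> test_functions \<Omega>"
  shows "integrable lebesgue (\<lambda>x. indicator \<Omega> x *\<^sub>R (\<kappa> x *\<^sub>R g x))"
    and "integrable (lebesgue_on \<Omega>) (\<lambda>x. \<kappa> x *\<^sub>R g x)"
proof -
  obtain K where K: "smooth \<kappa>" "compact K" "K \<subseteq> \<Omega>" "\<And>x. x \<notin> K \<Longrightarrow> \<kappa> x = 0"
    using test_functionsE[OF assms(3)] by metis
  have ck: "continuous_on UNIV \<kappa>" using smooth_continuous_on[OF K(1)] .
  obtain B where B: "B \<ge> 0" "\<And>x. norm (\<kappa> x) \<le> B" using bounded_compact_support[OF ck K(2,4)] by blast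
  have gi: "integrable lebesgue (\<lambda>x. indicator K x *\<^sub>R g x)"
    using assms(2) K unfolding locally_integrable_def set_integrable_def by blast
  have km: "\<kappa> \<in> borel_measurable lebesgue"
    using ck by (rule continuous_imp_borel_measurable_lebesgue)
  have "integrable lebesgue (\<lambda>x. \<kappa> x *\<^sub>R (indicator K x *\<^sub>R g x))"
  proof (rule Bochner_Integration.integrable_bound)
    show "integrable lebesgue (\<lambda>x. B *\<^sub>R (indicator K x *\<^sub>R g x))"
      using gi by (rule integrable_scaleR_right)
    show "(\<lambda>x. \<kappa> x *\<^sub>R (indicator K x *\<^sub>R g x)) \<in> borel_measurable lebesgue"
      by (rule borel_measurable_scaleR[OF km borel_measurable_integrable[OF gi]])
    show "AE x in lebesgue. norm (\<kappa> x *\<^sub>R (indicator K x *\<^sub>R g x)) \<le> norm (B *\<^sub>R (indicator K x *\<^sub>R g x))"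
      using B by (auto intro!: mult_right_mono AE_I2 simp: abs_mult)
  qed
  moreover have "(\<lambda>x. \<kappa> x *\<^sub>R (indicator K x *\<^sub>R g x)) = (\<lambda>x. indicator \<Omega> x *\<^sub>R (\<kappa> x *\<^sub>R g x))"
    using K(3,4) by (auto simp: fun_eq_iff indicator_def)
  ultimately show *: "integrable lebesgue (\<lambda>x. indicator \<Omega> x *\<^sub>R (\<kappa> x *\<^sub>R g x))" by simp
  have O: "\<Omega> \<inter> space lebesgue \<in> sets lebesgue" using assms(1) by simp
  show "integrable (lebesgue_on \<Omega>) (\<lambda>x. \<kappa> x *\<^sub>R g x)"
    unfolding integrable_restrict_space[OF O] using * .
qed

text \<open>Lebesgue differentiation: almost everywhere \<open>F x\<close> is the limit of the
  averages over cubes with corner \<open>x\<close>, and these are 0. Open and closed boxes give the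
  same integrals.\<close>

lemma AE_zero_if_box_integrals_zero:
  fixes F :: "'a::euclidean_space \<Rightarrow> real"
  assumes F: "integrable lebesgue F" and z: "\<And>a b. (LINT x|lebesgue. indicator (box a b) x * F x) = 0"
  shows "AE x in lebesgue. F x = 0"
proof -
  have "F absolutely_integrable_on UNIV" using F by (simp add: set_integrable_def)
  then have io: "F integrable_on cbox a b" for a b
    using absolutely_integrable_on_def integrable_on_subcbox by (metis subset_UNIV)
  have sb: "set_integrable lebesgue (box a b) F" for a b
    using F integrable_mult_indicator[of "box a b" lebesgue F] by (simp add: set_integrable_def)
  have z': "integral (cbox a b) F = 0" for a b
    using set_lebesgue_integral_eq_integral(2)[OF sb[of a b]] z[of a b]
    by (simp add: set_lebesgue_integral_def integral_open_interval)
  obtain N where N: "negligible N" "\<And>x e. \<lbrakk>x \<notin> N; 0 < e\<rbrakk> \<Longrightarrow>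
               \<exists>d>0. \<forall>h. 0 < h \<and> h < d \<longrightarrow>
                         norm(integral (cbox x (x + h *\<^sub>R One)) F /\<^sub>R h ^ DIM('a) - F x) < e"
    using integrable_ccontinuous_explicit[OF io] by metis
  have "F x = 0" if x: "x \<notin> N" for x
  proof (rule ccontr)
    assume "F x \<noteq> 0"
    then have "0 < \<bar>F x\<bar>" by simp
    from N(2)[OF x this] obtain d where "d > 0"
      and d: "\<And>h. 0 < h \<Longrightarrow> h < d \<Longrightarrow> norm(integral (cbox x (x + h *\<^sub>R One)) F /\<^sub>R h ^ DIM('a) - F x) < \<bar>F x\<bar>"
      by blast
    from d[of "d/2"] \<open>d > 0\<close> show False by (simp add: z')
  qed
  then have "{x. F x \<noteq> 0} \<subseteq> N" by auto
  then show ?thesis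
    using N(1) by (intro AE_I'[of N]) (auto simp: negligible_iff_null_sets)
qed

text \<open>The cut-off \<open>\<kappa> k\<close> makes \<open>g\<close> globally integrable.
  Testing with \<open>\<kappa> k * s n\<close>, where \<open>s n\<close> tends to the indicator of a
  box, shows that \<open>\<kappa> k * g\<close> has integral 0 over every box; and at each point of
  \<open>\<Omega>\<close> some \<open>\<kappa> k\<close> is nonzero.\<close>

lemma fundamental_lemma_real:
  fixes g :: "'a::euclidean_space \<Rightarrow> real"
  assumes "open \<Omega>" "locally_integrable \<Omega> g"
    and z: "\<And>\<psi>. \<psi> \<in> test_functions \<Omega> \<Longrightarrow> (LINT x|lebesgue_on \<Omega>. \<psi> x * g x) = 0"
  shows "AE x in lebesgue_on \<Omega>. g x = 0"
proof -
  have O: "\<Omega> \<inter> space lebesgue \<in> sets lebesgue" using assms(1) by simp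
  obtain \<kappa> :: "nat \<Rightarrow> 'a \<Rightarrow> real" where \<kappa>: "\<And>k. \<kappa> k \<in> test_functions \<Omega>"
    "\<And>x. x \<in> \<Omega> \<Longrightarrow> (\<lambda>k. \<kappa> k x) \<longlonglongrightarrow> 1"
    using test_functions_exhaust[OF assms(1)] by metis
  define F where "F k x = indicator \<Omega> x * (\<kappa> k x * g x)" for k x
  have Fi: "integrable lebesgue (F k)" for k
    using integrable_test_function_mult(1)[OF assms(1,2) \<kappa>(1)[of k]] by (simp add: F_def[abs_def])
  have "(LINT x|lebesgue. indicator (box a b) x * F k x) = 0" for a b k
  proof -
    define s where "s n x = (1 - exp (- (real n * box_bump a b x)))" for n x
    have sm: "smooth (s n)" for n unfolding s_def by (intro smooth_one_minus_exp smooth_box_bump)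
    have s01: "0 \<le> s n x" "s n x \<le> 1" for n x using box_bump_nonneg[of a b x] by (auto simp: s_def)
    have i0: "(LINT x|lebesgue. s n x * F k x) = 0" for n
    proof -
      have "(LINT x|lebesgue. s n x * F k x) = (LINT x|lebesgue_on \<Omega>. (\<kappa> k x * s n x) * g x)"
        unfolding integral_restrict_space[OF O] by (simp add: F_def algebra_simps)
      then show ?thesis using z[OF test_functions_mult(1)[OF \<kappa>(1) sm]] by simp
    qed
    have sM: "s n \<in> borel_measurable lebesgue" for n
      by (rule continuous_imp_borel_measurable_lebesgue[OF smooth_continuous_on[OF sm]])
    have "(\<lambda>n. LINT x|lebesgue. s n x * F k x) \<longlonglongrightarrow> (LINT x|lebesgue. indicator (box a b) x * F k x)"
    proof (rule integral_dominated_convergence)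
      show "integrable lebesgue (\<lambda>x. norm (F k x))" using Fi by (rule integrable_norm)
      show "AE x in lebesgue. (\<lambda>n. s n x * F k x) \<longlonglongrightarrow> indicator (box a b) x * F k x"
      proof (rule AE_I2, rule tendsto_mult_right)
        fix x show "(\<lambda>n. s n x) \<longlonglongrightarrow> indicator (box a b) x"
        proof (cases "x \<in> box a b")
          case True
          then show ?thesis unfolding s_def using one_minus_exp_tendsto[OF box_bump_pos[OF True]] by simp
        qed (simp add: s_def box_bump_eq_0)
      qed
      show "AE x in lebesgue. norm (s n x * F k x) \<le> norm (F k x)" for n
        using s01 by (auto intro!: AE_I2 mult_left_le_one_le simp: abs_mult)
    qed (use sM Fi in \<open>auto intro!: borel_measurable_times borel_measurable_indicator\<close>)
    then have "(\<lambda>n::nat. 0) \<longlonglongrightarrow> (LINT x|lebesgue. indicator (box a b) x * F k x)" by (simp only: i0)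
    then show ?thesis by (simp add: LIMSEQ_const_iff)
  qed
  then have "AE x in lebesgue. F k x = 0" for k
    using AE_zero_if_box_integrals_zero Fi by blast
  then have "AE x in lebesgue. \<forall>k. F k x = 0" by (simp add: AE_all_countable)
  then have "AE x in lebesgue. x \<in> \<Omega> \<longrightarrow> g x = 0"
  proof (rule AE_mp, intro AE_I2 impI)
    fix x assume F0: "\<forall>k. F k x = 0" and x: "x \<in> \<Omega>"
    have "\<exists>k. \<kappa> k x \<noteq> 0"
    proof (rule ccontr)
      assume "\<not> ?thesis"
      then show False using \<kappa>(2)[OF x] by (simp add: LIMSEQ_const_iff)
    qed
    then show "g x = 0" using F0 x by (auto simp: F_def)
  qed
  then show ?thesis using AE_restrict_space_iff[OF O] by simp
qed

lemma fundamental_lemma: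
  fixes G :: "'a::euclidean_space \<Rightarrow> 'b::euclidean_space"
  assumes "open \<Omega>" "locally_integrable \<Omega> G"
    and z: "\<And>\<psi>. \<psi> \<in> test_functions \<Omega> \<Longrightarrow> (LINT x|lebesgue_on \<Omega>. \<psi> x *\<^sub>R G x) = 0"
  shows "AE x in lebesgue_on \<Omega>. G x = 0"
proof -
  have "AE x in lebesgue_on \<Omega>. G x \<bullet> b = 0" for b
  proof (rule fundamental_lemma_real[OF assms(1)])
    show "locally_integrable \<Omega> (\<lambda>x. G x \<bullet> b)"
      unfolding locally_integrable_def set_integrable_def
    proof clarify
      fix K assume "compact K" "K \<subseteq> \<Omega>"
      then have "integrable lebesgue (\<lambda>x. (indicator K x *\<^sub>R G x) \<bullet> b)"
        using assms(2) unfolding locally_integrable_def set_integrable_def by (intro integrable_inner_left) auto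
      then show "integrable lebesgue (\<lambda>x. indicator K x *\<^sub>R (G x \<bullet> b))" by simp
    qed
    fix \<psi> assume t: "\<psi> \<in> test_functions \<Omega>"
    have "(LINT x|lebesgue_on \<Omega>. (\<psi> x *\<^sub>R G x) \<bullet> b) = (LINT x|lebesgue_on \<Omega>. \<psi> x *\<^sub>R G x) \<bullet> b"
      by (intro integral_inner_left integrable_test_function_mult(2) assms t)
    then show "(LINT x|lebesgue_on \<Omega>. \<psi> x * (G x \<bullet> b)) = 0" using z[OF t] by simp
  qed
  then have "AE x in lebesgue_on \<Omega>. \<forall>b\<in>Basis. G x \<bullet> b = 0"
    by (simp add: AE_ball_countable countable_finite)
  then show ?thesis
    by eventually_elim (auto intro!: euclidean_eqI[of _ 0])
qed

lemma locally_integrable_add: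
  fixes f g :: "'a::euclidean_space \<Rightarrow> 'b::euclidean_space"
  assumes "locally_integrable \<Omega> f" "locally_integrable \<Omega> g"
  shows "locally_integrable \<Omega> (\<lambda>x. f x + c *\<^sub>R g x)"
  unfolding locally_integrable_def set_integrable_def
proof clarify
  fix K assume "compact K" "K \<subseteq> \<Omega>"
  then have "integrable lebesgue (\<lambda>x. (indicator K x *\<^sub>R f x) + c *\<^sub>R (indicator K x *\<^sub>R g x))"
    using assms unfolding locally_integrable_def set_integrable_def
    by (intro Bochner_Integration.integrable_add integrable_scaleR_right) auto
  then show "integrable lebesgue (\<lambda>x. indicator K x *\<^sub>R (f x + c *\<^sub>R g x))"
    by (simp add: algebra_simps)
qed

lemma has_weak_gradient_lin:
  assumes "open \<Omega>" "has_weak_gradient \<Omega> u G" "has_weak_gradient \<Omega> v H"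
  shows "has_weak_gradient \<Omega> (\<lambda>x. u x + c * v x) (\<lambda>x. G x + c *\<^sub>R H x)"
  unfolding has_weak_gradient_def
proof (intro conjI ballI allI impI)
  have l: "locally_integrable \<Omega> u" "locally_integrable \<Omega> G" "locally_integrable \<Omega> v" "locally_integrable \<Omega> H"
    using assms unfolding has_weak_gradient_def by auto
  show "locally_integrable \<Omega> (\<lambda>x. u x + c * v x)" "locally_integrable \<Omega> (\<lambda>x. G x + c *\<^sub>R H x)"
    using locally_integrable_add[OF l(1,3), of c] locally_integrable_add[OF l(2,4)] by auto
  fix \<psi> D assume t: "\<psi> \<in> test_functions \<Omega>" and "\<forall>x. GDERIV \<psi> x :> D x"
  then have D: "D = grad \<psi>" by (intro ext) (metis grad_eqI)
  obtain K where K: "smooth \<psi>" "compact K" "K \<subseteq> \<Omega>" "\<And>x. x \<notin> K \<Longrightarrow> \<psi> x = 0" "\<And>x. x \<notin> K \<Longrightarrow> grad \<psi> x = 0"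
    using test_functionsE[OF t] by metis
  have i: "integrable (lebesgue_on \<Omega>) (\<lambda>x. w x *\<^sub>R grad \<psi> x)" if w: "locally_integrable \<Omega> w" for w :: "'a \<Rightarrow> real"
  proof -
    \<comment> \<open>Coordinates reduce the vector-valued integrand to scalar test functions, the
      partial derivatives of \<open>\<psi>\<close>.\<close>
    have "integrable (lebesgue_on \<Omega>) (\<lambda>x. \<Sum>b\<in>Basis. ((grad \<psi> x \<bullet> b) *\<^sub>R w x) *\<^sub>R b)"
    proof (intro Bochner_Integration.integrable_sum integrable_scaleR_left integrable_test_function_mult(2) assms(1) w)
      show "(\<lambda>x. grad \<psi> x \<bullet> b) \<in> test_functions \<Omega>" for b
        by (rule test_functionsI[OF smooth_grad[OF K(1)] K(2,3)]) (simp add: K(5))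
    qed
    moreover have "w x *\<^sub>R grad \<psi> x = (\<Sum>b\<in>Basis. ((grad \<psi> x \<bullet> b) *\<^sub>R w x) *\<^sub>R b)" for x
      by (subst (1) euclidean_representation[of "grad \<psi> x", symmetric]) (simp add: scaleR_sum_right mult.commute)
    ultimately show ?thesis by simp
  qed
  have "(LINT x|lebesgue_on \<Omega>. (u x + c * v x) *\<^sub>R D x)
      = (LINT x|lebesgue_on \<Omega>. u x *\<^sub>R D x) + c *\<^sub>R (LINT x|lebesgue_on \<Omega>. v x *\<^sub>R D x)"
    using i[OF l(1)] i[OF l(3)] D by (simp add: scaleR_add_left integral_scaleR_right flip: scaleR_scaleR)
  moreover have "(LINT x|lebesgue_on \<Omega>. \<psi> x *\<^sub>R (G x + c *\<^sub>R H x))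
      = (LINT x|lebesgue_on \<Omega>. \<psi> x *\<^sub>R G x) + c *\<^sub>R (LINT x|lebesgue_on \<Omega>. \<psi> x *\<^sub>R H x)"
    using integrable_test_function_mult(2)[OF assms(1) l(2) t] integrable_test_function_mult(2)[OF assms(1) l(4) t]
    by (simp add: scaleR_add_right scaleR_left_commute[of _ c] del: scaleR_scaleR)
  ultimately show "(LINT x|lebesgue_on \<Omega>. (u x + c * v x) *\<^sub>R D x) = - (LINT x|lebesgue_on \<Omega>. \<psi> x *\<^sub>R (G x + c *\<^sub>R H x))"
    using assms(2,3) t \<open>\<forall>x. GDERIV \<psi> x :> D x\<close> unfolding has_weak_gradient_def by simp
qed

text \<open>The difference of the two fields is a weak gradient of the zero function. This is what
  makes the choice in \<open>weak_gradient\<close> harmless.\<close>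

lemma weak_gradient_unique:
  assumes "open \<Omega>" "has_weak_gradient \<Omega> u G" "has_weak_gradient \<Omega> u H"
  shows "AE x in lebesgue_on \<Omega>. G x = H x"
proof -
  have w: "has_weak_gradient \<Omega> (\<lambda>x. 0) (\<lambda>x. G x + (-1) *\<^sub>R H x)"
    using has_weak_gradient_lin[OF assms, of "-1"] by simp
  have "AE x in lebesgue_on \<Omega>. G x + (-1) *\<^sub>R H x = 0"
  proof (rule fundamental_lemma[OF assms(1)])
    show "locally_integrable \<Omega> (\<lambda>x. G x + (-1) *\<^sub>R H x)" using w has_weak_gradient_def by blast
    fix \<psi> assume t: "\<psi> \<in> test_functions \<Omega>"
    then have "\<forall>x. GDERIV \<psi> x :> grad \<psi> x" using test_functions_smooth smooth_GDERIV by blast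
    then show "(LINT x|lebesgue_on \<Omega>. \<psi> x *\<^sub>R (G x + (-1) *\<^sub>R H x)) = 0"
      using w t unfolding has_weak_gradient_def by fastforce
  qed
  then show ?thesis by (rule AE_mp) auto
qed

lemma weak_gradient_AE:
  assumes "open \<Omega>" "has_weak_gradient \<Omega> u G"
  shows "has_weak_gradient \<Omega> u (weak_gradient \<Omega> u)"
    and "AE x in lebesgue_on \<Omega>. weak_gradient \<Omega> u x = G x"
proof -
  show "has_weak_gradient \<Omega> u (weak_gradient \<Omega> u)"
    unfolding weak_gradient_def by (rule someI[of "has_weak_gradient \<Omega> u", OF assms(2)])
  then show "AE x in lebesgue_on \<Omega>. weak_gradient \<Omega> u x = G x"
    using weak_gradient_unique[OF assms(1)] assms(2) by blast
qed

section \<open>Inequalities for powers of norms\<close>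

text \<open>Strict convexity by the mean value theorem. The tangent at 1 suffices, since other
  positive points are reached by homogeneity.\<close>

lemma powr_tangent_one:
  fixes t p :: real
  assumes "1 < p" "0 \<le> t" "t \<noteq> 1"
  shows "1 + p * (t - 1) < t powr p"
proof -
  have d: "DERIV (\<lambda>t. t powr p) z :> p * z powr (p - 1)" if "z > 0" for z
    using that by (auto intro!: derivative_eq_intros)
  consider "t = 0" | "0 < t" "t < 1" | "1 < t" using assms by linarith
  then show ?thesis
  proof cases
    case 1
    then show ?thesis using assms by simp
  next
    case 2
    then obtain z where z: "t < z" "z < 1" "1 powr p - t powr p = (1 - t) * (p * z powr (p - 1))"
      using MVT2[of t 1 "\<lambda>t. t powr p" "\<lambda>z. p * z powr (p - 1)"] d by auto
    have "z powr (p - 1) < 1" using z 2 assms powr_less_mono2[of "p - 1" z 1] by simp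
    then have "(1 - t) * (p * z powr (p - 1)) < (1 - t) * p" using 2 assms by simp
    then show ?thesis using z by (simp add: algebra_simps)
  next
    case 3
    then obtain z where z: "1 < z" "z < t" "t powr p - 1 powr p = (t - 1) * (p * z powr (p - 1))"
      using MVT2[of 1 t "\<lambda>t. t powr p" "\<lambda>z. p * z powr (p - 1)"] d by auto
    have "1 < z powr (p - 1)" using z assms powr_less_mono2[of "p - 1" 1 z] by simp
    then have "(t - 1) * p < (t - 1) * (p * z powr (p - 1))" using 3 assms by simp
    then show ?thesis using z by (simp add: algebra_simps)
  qed
qed

lemma powr_tangent_less:
  fixes t m p :: real
  assumes "1 < p" "0 \<le> t" "0 < m" "t \<noteq> m"
  shows "m powr p + p * m powr (p - 1) * (t - m) < t powr p"
proof -
  have "1 + p * (t / m - 1) < (t / m) powr p"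
    using assms by (intro powr_tangent_one) auto
  then have "m powr p * (1 + p * (t / m - 1)) < m powr p * (t / m) powr p"
    using assms by simp
  also have "\<dots> = t powr p" using assms by (simp add: powr_divide)
  finally show ?thesis using assms by (simp add: powr_diff field_simps)
qed

lemma powr_tangent:
  fixes t m p :: real
  assumes "1 < p" "0 \<le> t" "0 \<le> m"
  shows "m powr p + p * m powr (p - 1) * (t - m) \<le> t powr p"
  using powr_tangent_less[of p t m] assms by (cases "t = m"; cases "m = 0") auto

lemma powr_convex_combination:
  fixes x y p l :: real
  assumes "1 < p" "0 \<le> x" "0 \<le> y" "0 \<le> l" "l \<le> 1"
  shows "((1 - l) * x + l * y) powr p \<le> (1 - l) * x powr p + l * y powr p"
proof -
  define m where "m = (1 - l) * x + l * y"
  have m: "0 \<le> m" using assms by (simp add: m_def)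
  define A where "A = p * m powr (p - 1)"
  have "m powr p = (1 - l) * (m powr p + A * (x - m)) + l * (m powr p + A * (y - m))"
    by (simp add: m_def algebra_simps)
  also have "\<dots> \<le> (1 - l) * x powr p + l * y powr p"
    unfolding A_def using assms m by (intro add_mono mult_left_mono powr_tangent) auto
  finally show ?thesis by (simp add: m_def)
qed

text \<open>Convexity at \<open>a / (1 - l)\<close> and \<open>c / l\<close> with weights
  \<open>1 - l\<close> and \<open>l\<close>. For small \<open>l\<close> the factor of
  \<open>a\<close> is close to 1 and only \<open>c\<close> carries a large one; this asymmetry later
  lets a ratio \<open>1 + d\<close> of coefficients win.\<close>

lemma norm_add_powr_le:
  fixes a c :: "'b::real_normed_vector"
  assumes "1 < p" "0 < l" "l < 1"
  shows "norm (a + c) powr p \<le> (1 - l) powr (1 - p) * norm a powr p + l powr (1 - p) * norm c powr p"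
proof -
  have s: "s * (x / s) powr p = s powr (1 - p) * x powr p" if "s > 0" "x \<ge> 0" for s x :: real
    using that by (simp add: powr_divide powr_diff)
  have "norm (a + c) powr p \<le> ((1 - l) * (norm a / (1 - l)) + l * (norm c / l)) powr p"
    using assms by (intro powr_mono2) (auto simp: norm_triangle_ineq)
  also have "\<dots> \<le> (1 - l) * (norm a / (1 - l)) powr p + l * (norm c / l) powr p"
    using assms by (intro powr_convex_combination) auto
  finally show ?thesis using assms by (simp add: s)
qed

lemma norm_add_powr_le_half:
  fixes a c :: "'b::real_normed_vector"
  assumes "1 < p"
  shows "norm (a + c) powr p \<le> 2 powr (p - 1) * (norm a powr p + norm c powr p)"
proof -
  have "(1/2::real) powr (1 - p) = 2 powr (p - 1)"
    by (simp add: powr_divide powr_diff)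
  then show ?thesis
    using norm_add_powr_le[OF assms, of "1/2" a c] by (simp add: distrib_left)
qed

text \<open>Supporting hyperplane of the convex function \<open>norm \<xi> powr p\<close>, whose
  gradient is \<open>p\<close> times \<open>norm \<xi> powr (p - 2) *\<^sub>R \<xi>\<close>.
  Cauchy-Schwarz reduces it to the scalar tangent inequality.\<close>

lemma norm_powr_tangent:
  fixes \<xi> \<eta> :: "'b::real_inner"
  assumes "1 < p"
  shows "norm \<xi> powr p + p * (norm \<xi> powr (p - 2) *\<^sub>R \<xi> \<bullet> (\<eta> - \<xi>)) \<le> norm \<eta> powr p"
proof (cases "\<xi> = 0")
  case False
  have e: "norm \<xi> powr (p - 2) * norm \<xi> = norm \<xi> powr (p - 1)"
    using False powr_add[of "norm \<xi>" "p - 2" 1] by simp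
  have "\<xi> \<bullet> (\<eta> - \<xi>) \<le> norm \<xi> * (norm \<eta> - norm \<xi>)"
    using norm_cauchy_schwarz[of \<xi> \<eta>] by (simp add: inner_diff_right algebra_simps dot_square_norm power2_eq_square)
  then have "norm \<xi> powr (p - 2) * (\<xi> \<bullet> (\<eta> - \<xi>)) \<le> norm \<xi> powr (p - 2) * (norm \<xi> * (norm \<eta> - norm \<xi>))"
    by (intro mult_left_mono) auto
  also have "\<dots> = norm \<xi> powr (p - 1) * (norm \<eta> - norm \<xi>)" using e by simp
  finally have "p * (norm \<xi> powr (p - 2) * (\<xi> \<bullet> (\<eta> - \<xi>))) \<le> p * (norm \<xi> powr (p - 1) * (norm \<eta> - norm \<xi>))"
    using assms by simp
  then show ?thesis
    using powr_tangent[OF assms, of "norm \<eta>" "norm \<xi>"] by simp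
qed simp

text \<open>If \<open>a > \<tau>\<close>, the factor \<open>(a / \<tau>) powr (p - 1)\<close>
  exceeds 1 and may be inserted. The parameter \<open>\<tau>\<close> trades the constant against the
  power.\<close>

lemma le_add_powr:
  fixes a \<tau> p :: real
  assumes "1 < p" "0 \<le> a" "0 < \<tau>"
  shows "a \<le> \<tau> + \<tau> powr (1 - p) * a powr p"
proof (cases "a \<le> \<tau>")
  case False
  have "a = a powr (1 - p) * a powr p" using False assms by (simp flip: powr_add)
  also have "\<dots> \<le> \<tau> powr (1 - p) * a powr p"
    using False assms by (intro mult_right_mono powr_mono2') auto
  finally show ?thesis using assms by simp
qed (use assms in \<open>simp add: add_increasing2\<close>)

section \<open>Uniform convexity\<close>

definition convexity_gap :: "real \<Rightarrow> 'b::real_normed_vector \<Rightarrow> 'b \<Rightarrow> real" where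
  "convexity_gap p \<xi> \<eta> = (norm \<xi> powr p + norm \<eta> powr p) / 2 - norm ((1/2) *\<^sub>R (\<xi> + \<eta>)) powr p"

text \<open>Two sources of strictness: for different norms the strict convexity of
  \<open>t powr p\<close>, for equal norms the parallelogram law, by which the midpoint is strictly
  shorter.\<close>

lemma convexity_gap_pos:
  fixes \<xi> \<eta> :: "'b::real_inner"
  assumes "1 < p" "\<xi> \<noteq> \<eta>"
  shows "convexity_gap p \<xi> \<eta> > 0"
proof -
  define m where "m = (norm \<xi> + norm \<eta>) / 2"
  have h: "norm ((1/2) *\<^sub>R (\<xi> + \<eta>)) \<le> m" using norm_triangle_ineq[of \<xi> \<eta>] by (simp add: m_def)
  show ?thesis
  proof (cases "norm \<xi> = norm \<eta>")
    case False
    then have "m > 0" using norm_ge_zero[of \<xi>] norm_ge_zero[of \<eta>] unfolding m_def by (smt (verit) half_gt_zero)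
    then have "m powr p + p * m powr (p - 1) * (norm \<xi> - m) < norm \<xi> powr p"
      "m powr p + p * m powr (p - 1) * (norm \<eta> - m) < norm \<eta> powr p"
      using False assms by (intro powr_tangent_less; auto simp: m_def)+
    moreover have "p * m powr (p - 1) * (norm \<xi> - m) + p * m powr (p - 1) * (norm \<eta> - m) = 0"
      unfolding m_def by (simp add: field_simps)
    ultimately have "m powr p < (norm \<xi> powr p + norm \<eta> powr p) / 2" by simp
    moreover have "norm ((1/2) *\<^sub>R (\<xi> + \<eta>)) powr p \<le> m powr p"
      using h assms by (intro powr_mono2) auto
    ultimately show ?thesis by (simp add: convexity_gap_def)
  next
    case True
    have "(norm ((1/2) *\<^sub>R (\<xi> + \<eta>)))\<^sup>2 + (norm ((1/2) *\<^sub>R (\<xi> - \<eta>)))\<^sup>2 = (norm \<xi>)\<^sup>2"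
      using True by (simp add: power2_norm_eq_inner inner_add_left inner_add_right inner_diff_left
          inner_diff_right norm_eq field_simps inner_commute)
    moreover have "(norm ((1/2) *\<^sub>R (\<xi> - \<eta>)))\<^sup>2 > 0" using assms by simp
    ultimately have "(norm ((1/2) *\<^sub>R (\<xi> + \<eta>)))\<^sup>2 < (norm \<xi>)\<^sup>2" by linarith
    then have "norm ((1/2) *\<^sub>R (\<xi> + \<eta>)) < norm \<xi>" by (rule power_less_imp_less_base) simp
    then have "norm ((1/2) *\<^sub>R (\<xi> + \<eta>)) powr p < norm \<xi> powr p"
      using assms by (intro powr_less_mono2) auto
    then show ?thesis using True by (simp add: convexity_gap_def)
  qed
qed

lemma convexity_gap_nonneg:
  fixes \<xi> \<eta> :: "'b::real_inner"
  assumes "1 < p" shows "convexity_gap p \<xi> \<eta> \<ge> 0"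
  using convexity_gap_pos[OF assms, of \<xi> \<eta>] by (cases "\<xi> = \<eta>") (auto simp: convexity_gap_def simp flip: scaleR_2)

text \<open>By homogeneity it suffices to consider the compact set where
  \<open>norm \<xi> powr p + norm \<eta> powr p = 1\<close> and \<open>norm (\<xi> - \<eta>) powr p \<ge> \<epsilon>\<close>, on which the gap is
  bounded below.\<close>

lemma uniform_convexity:
  fixes \<epsilon> p :: real
  assumes p: "1 < p" and e: "0 < \<epsilon>"
  obtains C where "C \<ge> 0" "\<And>\<xi> \<eta> :: 'b::euclidean_space.
    norm (\<xi> - \<eta>) powr p \<le> \<epsilon> * (norm \<xi> powr p + norm \<eta> powr p) + C * convexity_gap p \<xi> \<eta>"
proof -
  \<comment> \<open>Pairs at small relative distance are left to the \<open>\<epsilon>\<close> term: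
    for \<open>p < 2\<close> the gap is of second order in \<open>\<xi> - \<eta>\<close> there, too
    small to control \<open>norm (\<xi> - \<eta>) powr p\<close>.\<close>
  define S where "S = {z :: 'b \<times> 'b. norm (fst z) powr p + norm (snd z) powr p = 1} \<inter>
    {z. \<epsilon> \<le> norm (fst z - snd z) powr p}"
  have cp: "continuous_on UNIV (\<lambda>z. norm (g z) powr p)" if "continuous_on UNIV g" for g :: "'b \<times> 'b \<Rightarrow> 'b"
    using p by (intro continuous_on_powr' continuous_on_norm continuous_on_const that) auto
  have cg: "continuous_on UNIV (\<lambda>z :: 'b \<times> 'b. convexity_gap p (fst z) (snd z))"
    unfolding convexity_gap_def
    by (intro continuous_on_diff continuous_on_divide continuous_on_add cp continuous_on_const
        continuous_on_fst continuous_on_snd continuous_on_id continuous_on_scaleR) auto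
  have cl: "closed S" unfolding S_def
    by (intro closed_Int closed_Collect_eq closed_Collect_le continuous_on_diff continuous_on_add cp
        continuous_on_const continuous_on_fst continuous_on_snd continuous_on_id)
  have n1: "norm \<xi> \<le> 1" if "norm \<xi> powr p \<le> 1" for \<xi> :: 'b
  proof (rule ccontr)
    assume "\<not> norm \<xi> \<le> 1"
    then have "1 powr p < norm \<xi> powr p" using p by (intro powr_less_mono2) auto
    then show False using that by simp
  qed
  have bd: "norm (fst z) \<le> 1" "norm (snd z) \<le> 1" if "z \<in> S" for z
    using that by (auto simp: S_def intro!: n1) (metis add.commute le_add_same_cancel1 powr_ge_zero)+
  have "norm z \<le> 2" if "z \<in> S" for z
    using bd[OF that] norm_Pair_le[of "fst z" "snd z"] by simp
  then have "bounded S" unfolding bounded_iff by blast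
  then have comp: "compact S" using cl compact_eq_bounded_closed by blast
  obtain d where d: "d > 0" "\<And>z. z \<in> S \<Longrightarrow> d \<le> convexity_gap p (fst z) (snd z)"
  proof (cases "S = {}")
    case False
    have "continuous_on S (\<lambda>z. convexity_gap p (fst z) (snd z))" using cg continuous_on_subset by blast
    from continuous_attains_inf[OF comp False this] obtain z where z: "z \<in> S"
      "\<And>y. y \<in> S \<Longrightarrow> convexity_gap p (fst z) (snd z) \<le> convexity_gap p (fst y) (snd y)" by blast
    have "fst z \<noteq> snd z" using z(1) e by (auto simp: S_def)
    then show ?thesis using that[of "convexity_gap p (fst z) (snd z)"] convexity_gap_pos[OF p] z by blast
  qed (use that[of 1] in auto)
  \<comment> \<open>On \<open>S\<close> both vectors have norm at most 1, so the left-hand side is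
    at most \<open>2 powr p\<close>, while the gap is at least \<open>d\<close>.\<close>
  define C where "C = 2 powr p / d"
  have key: "norm (\<xi> - \<eta>) powr p \<le> \<epsilon> + C * convexity_gap p \<xi> \<eta>"
    if 1: "norm \<xi> powr p + norm \<eta> powr p = 1" for \<xi> \<eta> :: 'b
  proof (cases "(\<xi>, \<eta>) \<in> S")
    case True
    have "norm (\<xi> - \<eta>) \<le> 2" using bd[OF True] norm_triangle_ineq4[of \<xi> \<eta>] by simp
    then have "norm (\<xi> - \<eta>) powr p \<le> 2 powr p" using p by (intro powr_mono2) auto
    also have "\<dots> \<le> C * convexity_gap p \<xi> \<eta>"
      using d(2)[OF True] d(1) by (simp add: C_def field_simps)
    finally show ?thesis using e by simp
  next
    case False
    then have "norm (\<xi> - \<eta>) powr p < \<epsilon>" using 1 by (simp add: S_def)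
    moreover have "C * convexity_gap p \<xi> \<eta> \<ge> 0"
      using convexity_gap_nonneg[OF p, of \<xi> \<eta>] d by (simp add: C_def)
    ultimately show ?thesis by simp
  qed
  have "norm (\<xi> - \<eta>) powr p \<le> \<epsilon> * (norm \<xi> powr p + norm \<eta> powr p) + C * convexity_gap p \<xi> \<eta>" for \<xi> \<eta> :: 'b
  proof -
    define s where "s = norm \<xi> powr p + norm \<eta> powr p"
    show ?thesis
    proof (cases "s = 0")
      case True
      then have "norm \<xi> powr p = 0 \<and> norm \<eta> powr p = 0"
        unfolding s_def by (subst (asm) add_nonneg_eq_0_iff) auto
      then show ?thesis using p by (simp add: convexity_gap_def)
    next
      case False
      then have s: "s > 0" unfolding s_def by (simp add: order_less_le)
      \<comment> \<open>Then \<open>r powr p = 1 / s\<close>, so scaling by \<open>r\<close>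
        normalizes the pair; both sides are homogeneous of degree \<open>p\<close>.\<close>
      define r where "r = s powr (- (1 / p))"
      have r: "r > 0" using s by (simp add: r_def)
      have rp: "r powr p = 1 / s"
        using s p powr_minus_divide[of s 1] by (simp add: r_def powr_powr)
      have sc: "norm (r *\<^sub>R v) powr p = norm v powr p / s" for v :: 'b
        using r rp by (simp add: powr_mult)
      have "norm (r *\<^sub>R \<xi> - r *\<^sub>R \<eta>) powr p \<le> \<epsilon> + C * convexity_gap p (r *\<^sub>R \<xi>) (r *\<^sub>R \<eta>)"

      proof (rule key)
        show "norm (r *\<^sub>R \<xi>) powr p + norm (r *\<^sub>R \<eta>) powr p = 1"
          unfolding sc add_divide_distrib[symmetric] s_def[symmetric] using s by simp
      qed
      moreover have "convexity_gap p (r *\<^sub>R \<xi>) (r *\<^sub>R \<eta>) = convexity_gap p \<xi> \<eta> / s"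
      proof -
        have e: "(1/2) *\<^sub>R (r *\<^sub>R \<xi> + r *\<^sub>R \<eta>) = r *\<^sub>R ((1/2) *\<^sub>R (\<xi> + \<eta>))" by (simp add: algebra_simps)
        show ?thesis unfolding convexity_gap_def e sc by (simp add: diff_divide_distrib add_divide_distrib)
      qed
      moreover have "r *\<^sub>R \<xi> - r *\<^sub>R \<eta> = r *\<^sub>R (\<xi> - \<eta>)" by (simp add: algebra_simps)
      ultimately have "norm (\<xi> - \<eta>) powr p / s \<le> \<epsilon> + C * (convexity_gap p \<xi> \<eta> / s)"
        by (simp only: sc)
      then have "norm (\<xi> - \<eta>) powr p \<le> (\<epsilon> + C * (convexity_gap p \<xi> \<eta> / s)) * s"
        using s by (simp only: pos_divide_le_eq)
      also have "\<dots> = \<epsilon> * s + C * convexity_gap p \<xi> \<eta>" using s by (simp add: distrib_right)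
      finally show ?thesis by (simp add: s_def)
    qed
  qed
  moreover have "C \<ge> 0" using d by (simp add: C_def)
  ultimately show thesis using that by blast
qed

text \<open>Calibrates \<open>norm_add_powr_le\<close>: the factor of the main term can be any
  prescribed number above 1.\<close>

lemma exists_powr_factor:
  fixes p \<eta> :: real
  assumes "1 < p" "0 < \<eta>"
  obtains l where "0 < l" "l < 1" "(1 - l) powr (1 - p) = 1 + \<eta>"
proof -
  define l where "l = 1 - (1 + \<eta>) powr (- (1 / (p - 1)))"
  have "(1 + \<eta>) powr (- (1 / (p - 1))) < (1 + \<eta>) powr 0"
    using assms by (intro powr_less_mono) auto
  then have "0 < l" "l < 1" using assms by (auto simp: l_def)
  moreover have "(1 - l) powr (1 - p) = 1 + \<eta>"
  proof -
    have "(1 - p) / (p - 1) = -1" using assms by (simp add: field_simps)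
    then show ?thesis using assms by (simp add: l_def powr_powr)
  qed
  ultimately show thesis using that by blast
qed

text \<open>Positive and negative parts give one formula for the derivative that is visibly
  continuous across 0.\<close>

lemma DERIV_abs_powr:
  fixes p :: real
  assumes "1 < p"
  shows "DERIV (\<lambda>t. \<bar>t\<bar> powr p) t :> p * (max t 0 powr (p - 1) - max (- t) 0 powr (p - 1))"
proof (cases t "0::real" rule: linorder_cases)
  case less
  have "DERIV (\<lambda>t. (- t) powr p) t :> - (p * (- t) powr (p - 1))"
    using less by (auto intro!: derivative_eq_intros)
  then have "DERIV (\<lambda>t. \<bar>t\<bar> powr p) t :> - (p * (- t) powr (p - 1))"
    by (rule has_field_derivative_transform_within_open[of _ _ t "{..<0}"]) (use less in auto)
  then show ?thesis using less assms by simp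
next
  case greater
  have "DERIV (\<lambda>t. t powr p) t :> p * t powr (p - 1)"
    using greater by (auto intro!: derivative_eq_intros)
  then have "DERIV (\<lambda>t. \<bar>t\<bar> powr p) t :> p * t powr (p - 1)"
    by (rule has_field_derivative_transform_within_open[of _ _ t "{0<..}"]) (use greater in auto)
  then show ?thesis using greater assms by simp
next
  case equal
  have "((\<lambda>h::real. \<bar>h\<bar> powr (p - 1)) \<longlongrightarrow> \<bar>0\<bar> powr (p - 1)) (at 0)"
    using assms by (intro tendsto_powr' tendsto_rabs tendsto_ident_at tendsto_const) auto
  then have l: "((\<lambda>h::real. \<bar>h\<bar> powr (p - 1)) \<longlongrightarrow> 0) (at 0)" using assms by simp
  have "((\<lambda>h::real. \<bar>h\<bar> powr p / h) \<longlongrightarrow> 0) (at 0)"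
  proof (rule Lim_null_comparison[OF _ l])
    have "norm (\<bar>h\<bar> powr p / h) \<le> \<bar>h\<bar> powr (p - 1)" for h :: real
      by (cases "h = 0") (auto simp: abs_divide powr_diff)
    then show "\<forall>\<^sub>F h::real in at 0. norm (\<bar>h\<bar> powr p / h) \<le> \<bar>h\<bar> powr (p - 1)" by simp
  qed
  then show ?thesis using equal assms by (simp add: DERIV_def)
qed

text \<open>Either \<open>a \<le> \<tau> * b\<close> and the first term dominates, or
  \<open>b < a / \<tau>\<close> and the second one does.\<close>

lemma young_powr:
  fixes a b \<tau> p :: real
  assumes "1 < p" "0 \<le> a" "0 \<le> b" "0 < \<tau>"
  shows "b powr (p - 1) * a \<le> \<tau> * b powr p + \<tau> powr (1 - p) * a powr p"
proof (cases "a \<le> \<tau> * b")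
  case True
  have "b powr (p - 1) * a \<le> b powr (p - 1) * (\<tau> * b)" using True by (intro mult_left_mono) auto
  also have "\<dots> = \<tau> * b powr p"
    using assms by (cases "b = 0") (auto simp: powr_diff)
  finally show ?thesis by (simp add: add_increasing2)
next
  case False
  then have ba: "b \<le> a / \<tau>" "a > 0" using assms by (auto simp: field_simps) (smt (verit) mult_nonneg_nonneg)
  have "b powr (p - 1) * a \<le> (a / \<tau>) powr (p - 1) * a"
    using ba assms by (intro mult_right_mono powr_mono2) auto
  also have "\<dots> = \<tau> powr (1 - p) * a powr p"
    using ba assms by (simp add: powr_divide powr_diff)
  finally show ?thesis using assms by (simp add: add_increasing)
qed

lemma norm_p_flux:
  fixes \<xi> :: "'b::real_normed_vector"
  shows "norm (norm \<xi> powr (p - 2) *\<^sub>R \<xi>) = norm \<xi> powr (p - 1)"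
  using powr_add[of "norm \<xi>" "p - 2" 1] by (cases "\<xi> = 0") auto

text \<open>For \<open>p < 2\<close> the scalar factor blows up at 0, so continuity there is read
  off from the norm of the whole product, which is \<open>norm \<xi> powr (p - 1)\<close>.\<close>

lemma tendsto_p_flux:
  fixes \<xi> :: "'b::real_normed_vector"
  assumes "1 < p" "(X \<longlongrightarrow> \<xi>) F"
  shows "((\<lambda>n. norm (X n) powr (p - 2) *\<^sub>R X n) \<longlongrightarrow> norm \<xi> powr (p - 2) *\<^sub>R \<xi>) F"
proof (cases "\<xi> = 0")
  case True
  have "((\<lambda>n. norm (X n) powr (p - 1)) \<longlongrightarrow> norm \<xi> powr (p - 1)) F"
    using assms by (intro tendsto_powr' tendsto_norm tendsto_const) auto
  then have "((\<lambda>n. norm (norm (X n) powr (p - 2) *\<^sub>R X n)) \<longlongrightarrow> 0) F"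
    using assms True by (simp add: norm_p_flux del: norm_scaleR)
  then show ?thesis using True by (simp add: tendsto_norm_zero_iff del: norm_scaleR)
next
  case False
  then show ?thesis using assms by (intro tendsto_scaleR tendsto_powr tendsto_norm tendsto_const) auto
qed

section \<open>Lebesgue spaces on a bounded open set\<close>

locale p_domain =
  fixes p :: real and \<Omega> :: "'a::euclidean_space set"
  assumes p: "1 < p" and op: "open \<Omega>" and bd: "bounded \<Omega>"
begin

abbreviation M :: "'a measure" where "M \<equiv> lebesgue_on \<Omega>"

lemma finite_measure_domain: "finite_measure M"
  using bd op by (intro finite_measure_lebesgue_on bounded_set_imp_lmeasurable) auto

sublocale finite_measure M by (rule finite_measure_domain)

lemma continuous_imp_measurable_domain [intro]:
  "continuous_on UNIV f \<Longrightarrow> f \<in> borel_measurable M"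
  using op continuous_on_subset by (intro continuous_imp_measurable_on_sets_lebesgue) auto

text \<open>What is kept of a positive continuous function on the compact closure: enough to compare
  weighted and unweighted energies.\<close>

definition weight :: "('a \<Rightarrow> real) \<Rightarrow> bool" where
  "weight \<gamma> \<longleftrightarrow> \<gamma> \<in> borel_measurable M \<and> (\<exists>c0>0. \<exists>c1. \<forall>x\<in>\<Omega>. c0 \<le> \<gamma> x \<and> \<gamma> x \<le> c1)"

definition energy :: "('a \<Rightarrow> real) \<Rightarrow> ('a \<Rightarrow> 'b::euclidean_space) \<Rightarrow> real" where
  "energy \<gamma> G = (LINT x|M. \<gamma> x * norm (G x) powr p)"

text \<open>The \<open>p\<close>-th power of the \<open>L^p\<close> norm, without the root; the
  polymorphic codomain covers functions and gradients alike.\<close>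

abbreviation Np :: "('a \<Rightarrow> 'b::euclidean_space) \<Rightarrow> real" where
  "Np \<equiv> energy (\<lambda>x. 1)"

lemma weight_1 [simp]: "weight (\<lambda>x. 1)"
  by (auto simp: weight_def intro!: exI[of _ 1])

lemma weight_pos: "weight \<gamma> \<Longrightarrow> x \<in> \<Omega> \<Longrightarrow> \<gamma> x > 0"
  by (force simp: weight_def)

lemma LpD: "G \<in> Lp p \<Omega> \<Longrightarrow> G \<in> borel_measurable M"
  "G \<in> Lp p \<Omega> \<Longrightarrow> integrable M (\<lambda>x. norm (G x) powr p)"
  by (auto simp: Lp_def)

lemma energy_integrable:
  assumes "weight \<gamma>" "G \<in> Lp p \<Omega>"
  shows "integrable M (\<lambda>x. \<gamma> x * norm (G x) powr p)"
proof -
  obtain c0 c1 where c: "\<gamma> \<in> borel_measurable M" "c0 > 0" "\<And>x. x \<in> \<Omega> \<Longrightarrow> c0 \<le> \<gamma> x \<and> \<gamma> x \<le> c1"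
    using assms(1) by (auto simp: weight_def)
  note [measurable] = c(1) LpD(1)[OF assms(2)]
  show ?thesis
  proof (rule Bochner_Integration.integrable_bound)
    show "integrable M (\<lambda>x. c1 * norm (G x) powr p)"
      using LpD(2)[OF assms(2)] by (rule integrable_mult_right)
    show "AE x in M. norm (\<gamma> x * norm (G x) powr p) \<le> norm (c1 * norm (G x) powr p)"
      using c by (intro AE_I2) (force simp: abs_mult intro!: mult_right_mono)
  qed measurable
qed

lemma energy_nonneg: "weight \<gamma> \<Longrightarrow> 0 \<le> energy \<gamma> G"
  unfolding energy_def by (intro integral_nonneg_AE AE_I2) (auto simp: less_imp_le weight_pos)

lemma energy_bounds:
  assumes "weight \<gamma>"
  obtains c0 c1 where "c0 > 0" "c1 > 0"
    "\<And>G :: 'a \<Rightarrow> 'b::euclidean_space. G \<in> Lp p \<Omega> \<Longrightarrow> c0 * Np G \<le> energy \<gamma> G"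
    "\<And>G :: 'a \<Rightarrow> 'b::euclidean_space. G \<in> Lp p \<Omega> \<Longrightarrow> energy \<gamma> G \<le> c1 * Np G"
proof -
  obtain c0 c1 where c: "c0 > 0" "\<And>x. x \<in> \<Omega> \<Longrightarrow> c0 \<le> \<gamma> x \<and> \<gamma> x \<le> c1"
    using assms by (auto simp: weight_def)
  have mono: "energy \<gamma> G \<le> energy \<gamma>' G"
    if "integrable M (\<lambda>x. \<gamma> x * norm (G x) powr p)" "integrable M (\<lambda>x. \<gamma>' x * norm (G x) powr p)"
      "\<And>x. x \<in> \<Omega> \<Longrightarrow> \<gamma> x \<le> \<gamma>' x" for \<gamma> \<gamma>' and G :: "'a \<Rightarrow> 'b"
    unfolding energy_def using that by (intro integral_mono mult_right_mono) auto
  show thesis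
  proof (rule that[of c0 "max c1 1"])
    fix G :: "'a \<Rightarrow> 'b" assume G: "G \<in> Lp p \<Omega>"
    have e: "energy (\<lambda>x. c) G = c * Np G" for c by (simp add: energy_def)
    have i: "integrable M (\<lambda>x. c * norm (G x) powr p)" for c
      using LpD(2)[OF G] by (rule integrable_mult_right)
    show "c0 * Np G \<le> energy \<gamma> G" "energy \<gamma> G \<le> max c1 1 * Np G"
      unfolding e[symmetric] using c i[of c0] i[of "max c1 1"] LpD(2)[OF G] energy_integrable[OF assms G]
      by (auto intro!: mono simp: le_max_iff_disj)
  qed (use c in auto)
qed

lemma energy_cong_AE:
  assumes "weight \<gamma>" "G \<in> borel_measurable M" "H \<in> borel_measurable M" "AE x in M. G x = H x"
  shows "energy \<gamma> G = energy \<gamma> H"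
proof -
  have [measurable]: "\<gamma> \<in> borel_measurable M" using assms(1) by (simp add: weight_def)
  note [measurable] = assms(2,3)
  show ?thesis unfolding energy_def using assms(4) by (intro integral_cong_AE) auto
qed

lemma Lp_cong_AE:
  assumes "G \<in> Lp p \<Omega>" "H \<in> borel_measurable M" "AE x in M. G x = H x"
  shows "H \<in> Lp p \<Omega>"
proof -
  note [measurable] = assms(2) LpD(1)[OF assms(1)]
  have "integrable M (\<lambda>x. norm (H x) powr p)"
    using LpD(2)[OF assms(1)] assms(3) by (subst integrable_cong_AE[of _ _ "\<lambda>x. norm (G x) powr p"]) auto
  then show ?thesis using assms(2) by (simp add: Lp_def)
qed

lemma Lp_scale:
  assumes "G \<in> Lp p \<Omega>" shows "(\<lambda>x. c *\<^sub>R G x) \<in> Lp p \<Omega>"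
  using LpD[OF assms] by (simp add: Lp_def powr_mult)

lemma energy_scale: "energy \<gamma> (\<lambda>x. c *\<^sub>R G x) = \<bar>c\<bar> powr p * energy \<gamma> G"
proof -
  have "\<gamma> x * norm (c *\<^sub>R G x) powr p = \<bar>c\<bar> powr p * (\<gamma> x * norm (G x) powr p)" for x
    by (simp add: powr_mult)
  then show ?thesis unfolding energy_def by (simp only: integral_mult_right_zero)
qed

lemma Lp_add:
  assumes "G \<in> Lp p \<Omega>" "H \<in> Lp p \<Omega>"
  shows "(\<lambda>x. G x + H x) \<in> Lp p \<Omega>"
proof -
  note [measurable] = LpD(1)[OF assms(1)] LpD(1)[OF assms(2)]
  have "integrable M (\<lambda>x. norm (G x + H x) powr p)"
  proof (rule Bochner_Integration.integrable_bound)
    show "integrable M (\<lambda>x. 2 powr (p - 1) * (norm (G x) powr p + norm (H x) powr p))"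
      using assms LpD(2) by (intro integrable_mult_right Bochner_Integration.integrable_add) auto
    show "AE x in M. norm (norm (G x + H x) powr p) \<le> norm (2 powr (p - 1) * (norm (G x) powr p + norm (H x) powr p))"
      using norm_add_powr_le_half[OF p] by (intro AE_I2) (auto intro: order.trans[OF _ abs_ge_self])
  qed measurable
  then show ?thesis by (simp add: Lp_def)
qed

lemma Lp_diff: "G \<in> Lp p \<Omega> \<Longrightarrow> H \<in> Lp p \<Omega> \<Longrightarrow> (\<lambda>x. G x - H x) \<in> Lp p \<Omega>"
  using Lp_add[OF _ Lp_scale[of H "-1"], of G] by simp

lemma energy_add_le:
  assumes "weight \<gamma>" "G \<in> Lp p \<Omega>" "H \<in> Lp p \<Omega>" "0 < l" "l < 1"
  shows "energy \<gamma> (\<lambda>x. G x + H x) \<le> (1 - l) powr (1 - p) * energy \<gamma> G + l powr (1 - p) * energy \<gamma> H"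
proof -
  have "energy \<gamma> (\<lambda>x. G x + H x) \<le>
     (LINT x|M. (1 - l) powr (1 - p) * (\<gamma> x * norm (G x) powr p) + l powr (1 - p) * (\<gamma> x * norm (H x) powr p))"
    unfolding energy_def
  proof (rule integral_mono)
    show "integrable M (\<lambda>x. \<gamma> x * norm (G x + H x) powr p)"
      by (intro energy_integrable Lp_add assms)
    show "integrable M (\<lambda>x. (1 - l) powr (1 - p) * (\<gamma> x * norm (G x) powr p) + l powr (1 - p) * (\<gamma> x * norm (H x) powr p))"
      by (intro energy_integrable assms Bochner_Integration.integrable_add integrable_mult_right)
    fix x assume "x \<in> space M"
    then have "\<gamma> x \<ge> 0" using weight_pos[OF assms(1)] by (simp add: less_imp_le)
    from mult_left_mono[OF norm_add_powr_le[OF p assms(4,5), of "G x" "H x"] this]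
    show "\<gamma> x * norm (G x + H x) powr p \<le>
       (1 - l) powr (1 - p) * (\<gamma> x * norm (G x) powr p) + l powr (1 - p) * (\<gamma> x * norm (H x) powr p)"
      by (simp add: algebra_simps)
  qed
  also have "\<dots> = (1 - l) powr (1 - p) * energy \<gamma> G + l powr (1 - p) * energy \<gamma> H"
    unfolding energy_def using energy_integrable assms
    by (subst Bochner_Integration.integral_add) auto
  finally show ?thesis .
qed

lemma energy_add_le_half:
  assumes "weight \<gamma>" "G \<in> Lp p \<Omega>" "H \<in> Lp p \<Omega>"
  shows "energy \<gamma> (\<lambda>x. G x + H x) \<le> 2 powr (p - 1) * (energy \<gamma> G + energy \<gamma> H)"
proof -
  have "(1/2::real) powr (1 - p) = 2 powr (p - 1)"
    by (simp add: powr_divide powr_diff)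
  then show ?thesis
    using energy_add_le[OF assms, of "1/2"] by (simp add: distrib_left)
qed

text \<open>Continuity of the energy, uniform over fields of energy at most \<open>B\<close>: first
  \<open>l\<close> brings the factor of \<open>G\<close> as close to 1 as \<open>B\<close> demands,
  then \<open>\<delta>\<close> pays for the large factor of \<open>H\<close>.\<close>

lemma energy_perturb:
  assumes "weight \<gamma>" "0 \<le> B" "0 < \<epsilon>"
  obtains \<delta> where "\<delta> > 0" "\<And>G H :: 'a \<Rightarrow> 'b::euclidean_space. G \<in> Lp p \<Omega> \<Longrightarrow> H \<in> Lp p \<Omega> \<Longrightarrow>
    energy \<gamma> G \<le> B \<Longrightarrow> Np H \<le> \<delta> \<Longrightarrow> energy \<gamma> (\<lambda>x. G x + H x) \<le> energy \<gamma> G + \<epsilon>"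
proof -
  define \<eta> where "\<eta> = \<epsilon> / (2 * (B + 1))"
  have \<eta>: "\<eta> > 0" "\<eta> * B \<le> \<epsilon> / 2" using assms by (auto simp: \<eta>_def field_simps)
  obtain l where l: "0 < l" "l < 1" "(1 - l) powr (1 - p) = 1 + \<eta>"
    using exists_powr_factor[OF p \<eta>(1)] by blast
  obtain c1 where c1: "c1 > 0" "\<And>G :: 'a \<Rightarrow> 'b. G \<in> Lp p \<Omega> \<Longrightarrow> energy \<gamma> G \<le> c1 * Np G"
    using energy_bounds[OF assms(1)] by metis
  define \<delta> where "\<delta> = \<epsilon> / (2 * (l powr (1 - p) * c1))"
  show thesis
  proof (rule that)
    show "\<delta> > 0" using l c1 assms by (simp add: \<delta>_def)
    fix G H :: "'a \<Rightarrow> 'b" assume GH: "G \<in> Lp p \<Omega>" "H \<in> Lp p \<Omega>" "energy \<gamma> G \<le> B" "Np H \<le> \<delta>"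
    have "l powr (1 - p) * energy \<gamma> H \<le> l powr (1 - p) * (c1 * \<delta>)"
      using c1(2)[OF GH(2)] GH(4) c1(1) by (intro mult_left_mono) (auto intro: order.trans mult_left_mono)
    also have "\<dots> = \<epsilon> / 2" using l c1 by (simp add: \<delta>_def)
    finally have 1: "l powr (1 - p) * energy \<gamma> H \<le> \<epsilon> / 2" .
    have 2: "\<eta> * energy \<gamma> G \<le> \<epsilon> / 2"
      using order.trans[OF mult_left_mono[OF GH(3), of \<eta>] \<eta>(2)] \<eta>(1) by simp
    show "energy \<gamma> (\<lambda>x. G x + H x) \<le> energy \<gamma> G + \<epsilon>"
      using energy_add_le[OF assms(1) GH(1,2) l(1,2)] 1 2 by (simp add: l(3) algebra_simps)
  qed
qed

section \<open>Comparison with \<open>L^1\<close> and completeness\<close>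

lemma Lp_integrable:
  assumes "G \<in> Lp p \<Omega>" shows "integrable M G"
proof (rule Bochner_Integration.integrable_bound)
  show "integrable M (\<lambda>x. 1 + norm (G x) powr p)"
    using LpD(2)[OF assms] by simp
  show "AE x in M. norm (G x) \<le> norm (1 + norm (G x) powr p)"
    using le_add_powr[OF p, of _ 1] by (intro AE_I2) (auto intro: order.trans[OF _ abs_ge_self])
qed (rule LpD[OF assms])

lemma Lp_L1_bound:
  assumes "G \<in> Lp p \<Omega>" "\<tau> > 0"
  shows "(LINT x|M. norm (G x)) \<le> \<tau> * measure M \<Omega> + \<tau> powr (1 - p) * Np G"
proof -
  have "(LINT x|M. norm (G x)) \<le> (LINT x|M. \<tau> + \<tau> powr (1 - p) * norm (G x) powr p)"
    using Lp_integrable[OF assms(1)] LpD(2)[OF assms(1)] le_add_powr[OF p _ assms(2)]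
    by (intro integral_mono) auto
  also have "\<dots> = \<tau> * measure M \<Omega> + \<tau> powr (1 - p) * Np G"
    using LpD(2)[OF assms(1)] by (simp add: energy_def)
  finally show ?thesis .
qed

lemma Lp_tendsto_L1:
  fixes F :: "nat \<Rightarrow> 'a \<Rightarrow> 'b::euclidean_space"
  assumes "\<And>k. F k \<in> Lp p \<Omega>" "(\<lambda>k. Np (F k)) \<longlonglongrightarrow> 0"
  shows "(\<lambda>k. LINT x|M. norm (F k x)) \<longlonglongrightarrow> 0"
proof (rule LIMSEQ_I)
  fix r :: real assume r: "r > 0"
  define \<tau> where "\<tau> = r / (2 * (measure M \<Omega> + 1))"
  have \<tau>: "\<tau> > 0" "\<tau> * measure M \<Omega> \<le> r / 2"
    using r by (auto simp: \<tau>_def field_simps add_pos_nonneg)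
  have "(\<lambda>k. \<tau> powr (1 - p) * Np (F k)) \<longlonglongrightarrow> 0"
    using tendsto_mult_right_zero[OF assms(2)] .
  then obtain N where N: "\<And>k. k \<ge> N \<Longrightarrow> norm (\<tau> powr (1 - p) * Np (F k) - 0) < r / 2"
    using LIMSEQ_D[of _ 0 "r/2"] r by (metis half_gt_zero)
  have "norm ((LINT x|M. norm (F k x)) - 0) < r" if "k \<ge> N" for k
  proof -
    have "0 \<le> (LINT x|M. norm (F k x))" by (intro integral_nonneg_AE) auto
    moreover have "\<tau> powr (1 - p) * Np (F k) < r / 2" using N[OF that] by simp
    ultimately show ?thesis using Lp_L1_bound[OF assms(1)[of k] \<tau>(1)] \<tau>(2) by simp
  qed
  then show "\<exists>no. \<forall>n\<ge>no. norm ((LINT x|M. norm (F n x)) - 0) < r" by blast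
qed

text \<open>The Riesz-Fischer argument for a geometrically fast Cauchy sequence: consecutive
  differences are summable in \<open>L^1\<close>, hence the sequence converges almost everywhere,
  and Fatou's lemma in the second index carries the rate over to the limit.\<close>

lemma Lp_complete:
  fixes G :: "nat \<Rightarrow> 'a \<Rightarrow> 'b::euclidean_space"
  assumes G: "\<And>k. G k \<in> Lp p \<Omega>" and A: "A \<ge> 0"
    and cau: "\<And>k j. k \<le> j \<Longrightarrow> Np (\<lambda>x. G k x - G j x) \<le> A * (1/2 ^ k) powr p"
  obtains L where "L \<in> Lp p \<Omega>" "(\<lambda>k. Np (\<lambda>x. G k x - L x)) \<longlonglongrightarrow> 0"
proof -
  have Gm[measurable]: "G k \<in> borel_measurable M" for k using LpD(1)[OF G] .
  define d where "d k x = norm (G (Suc k) x - G k x)" for k x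
  have dm[measurable]: "d k \<in> borel_measurable M" for k unfolding d_def by measurable
  have Ldiff: "(\<lambda>x. G j x - G k x) \<in> Lp p \<Omega>" for j k using Lp_diff G by blast
  have dn: "0 \<le> d k x" for k x by (simp add: d_def)
  have di: "integrable M (d k)" for k
    unfolding d_def using Lp_integrable[OF Ldiff] by (intro integrable_norm) auto
  define B where "B = measure M \<Omega> + A"
  have dI: "(LINT x|M. d k x) \<le> B * (1/2) ^ k" for k
  proof -
    have n: "Np (\<lambda>x. G (Suc k) x - G k x) = Np (\<lambda>x. G k x - G (Suc k) x)"
      by (simp add: energy_def norm_minus_commute)
    have pw: "(1/2 ^ k) powr (1 - p) * (1/2 ^ k) powr p = (1/2 ^ k :: real)"
      by (simp flip: powr_add)
    \<comment> \<open>With \<open>\<tau> = 1/2 ^ k\<close> both terms of the bound become multiples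
      of \<open>1/2 ^ k\<close>.\<close>
    have "(LINT x|M. d k x) \<le> (1/2 ^ k) * measure M \<Omega> + (1/2 ^ k) powr (1 - p) * Np (\<lambda>x. G (Suc k) x - G k x)"
      unfolding d_def by (rule Lp_L1_bound[OF Ldiff]) simp
    also have "\<dots> \<le> (1/2 ^ k) * measure M \<Omega> + (1/2 ^ k) powr (1 - p) * (A * (1/2 ^ k) powr p)"
      unfolding n by (intro add_left_mono mult_left_mono cau) auto
    also have "\<dots> = (1/2 ^ k) * measure M \<Omega> + A * ((1/2 ^ k) powr (1 - p) * (1/2 ^ k) powr p)" by simp
    also have "\<dots> = B * (1/2) ^ k" unfolding pw by (simp add: B_def algebra_simps power_one_over)
    finally show ?thesis .
  qed
  have B: "B \<ge> 0" using A by (simp add: B_def)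
  have sB: "summable (\<lambda>k. B * (1/2) ^ k)" by (intro summable_mult summable_geometric) auto
  have "(\<integral>\<^sup>+x. (\<Sum>k. ennreal (d k x)) \<partial>M) = (\<Sum>k. \<integral>\<^sup>+x. ennreal (d k x) \<partial>M)"
    by (intro nn_integral_suminf) measurable
  also have "\<dots> \<le> (\<Sum>k. ennreal (B * (1/2) ^ k))"
  proof (rule suminf_le)
    show "(\<integral>\<^sup>+x. ennreal (d k x) \<partial>M) \<le> ennreal (B * (1/2) ^ k)" for k
      using dI[of k] by (subst nn_integral_eq_integral[OF di]) (auto simp: dn intro: ennreal_leI)
  qed auto
  also have "\<dots> < \<infinity>"
    using sB B by (subst suminf_ennreal2) auto
  finally have "(\<integral>\<^sup>+x. (\<Sum>k. ennreal (d k x)) \<partial>M) \<noteq> \<infinity>" by simp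
  then have "AE x in M. (\<Sum>k. ennreal (d k x)) \<noteq> \<infinity>"
    by (intro nn_integral_PInf_AE) measurable
  then have "AE x in M. convergent (\<lambda>k. G k x)"
  proof (rule AE_mp, intro AE_I2 impI)
    fix x assume "(\<Sum>k. ennreal (d k x)) \<noteq> \<infinity>"
    then have "summable (\<lambda>k. d k x)"
      by (intro summable_suminf_not_top) (auto simp: d_def)
    then have "summable (\<lambda>k. G (Suc k) x - G k x)"
      unfolding d_def by (rule summable_norm_cancel)
    then have "convergent (\<lambda>n. G n x - G 0 x)"
      unfolding summable_iff_convergent sum_lessThan_telescope[of "\<lambda>k. G k x"] .
    from convergent_add[OF this convergent_const[of "G 0 x"]]
    show "convergent (\<lambda>k. G k x)" by simp
  qed
  define L where "L x = lim (\<lambda>k. G k x)" for x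
  have Lm[measurable]: "L \<in> borel_measurable M"
    unfolding L_def by (rule borel_measurable_lim_metric) (rule Gm)
  have conv: "AE x in M. (\<lambda>k. G k x) \<longlonglongrightarrow> L x"
    using \<open>AE x in M. convergent (\<lambda>k. G k x)\<close> by eventually_elim (simp add: L_def convergent_LIMSEQ_iff)
  have nb: "(\<integral>\<^sup>+x. ennreal (norm (G k x - L x) powr p) \<partial>M) \<le> ennreal (A * (1/2 ^ k) powr p)" for k
  proof -
    have "(\<integral>\<^sup>+x. ennreal (norm (G k x - L x) powr p) \<partial>M)
        = (\<integral>\<^sup>+x. liminf (\<lambda>j. ennreal (norm (G k x - G j x) powr p)) \<partial>M)"
    proof (rule nn_integral_cong_AE)
      show "AE x in M. ennreal (norm (G k x - L x) powr p) = liminf (\<lambda>j. ennreal (norm (G k x - G j x) powr p))"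
        using conv
      proof eventually_elim
        case (elim x)
        have "(\<lambda>j. norm (G k x - G j x) powr p) \<longlonglongrightarrow> norm (G k x - L x) powr p"
          using p by (intro tendsto_powr' tendsto_intros elim) auto
        then have "(\<lambda>j. ennreal (norm (G k x - G j x) powr p)) \<longlonglongrightarrow> ennreal (norm (G k x - L x) powr p)"
          by (rule tendsto_ennrealI)
        from lim_imp_Liminf[OF trivial_limit_sequentially this] show ?case by (rule sym)
      qed
    qed
    also have "\<dots> \<le> liminf (\<lambda>j. \<integral>\<^sup>+x. ennreal (norm (G k x - G j x) powr p) \<partial>M)"
      by (intro nn_integral_liminf) measurable
    also have "\<dots> \<le> ennreal (A * (1/2 ^ k) powr p)"
    proof (rule Liminf_le)
      show "\<forall>\<^sub>F j in sequentially. (\<integral>\<^sup>+x. ennreal (norm (G k x - G j x) powr p) \<partial>M) \<le> ennreal (A * (1/2 ^ k) powr p)"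
        using eventually_ge_at_top[of k]
      proof eventually_elim
        case (elim j)
        have "(\<integral>\<^sup>+x. ennreal (norm (G k x - G j x) powr p) \<partial>M) = ennreal (Np (\<lambda>x. G k x - G j x))"
          using LpD(2)[OF Ldiff[of k j]] by (simp add: energy_def nn_integral_eq_integral)
        then show ?case using cau[OF elim] by (simp add: ennreal_leI)
      qed
    qed simp
    finally show ?thesis .
  qed
  have LG: "(\<lambda>x. G k x - L x) \<in> Lp p \<Omega>" for k
  proof -
    have "integrable M (\<lambda>x. norm (G k x - L x) powr p)"
      by (rule integrableI_bounded) (use nb[of k] in \<open>auto simp: less_top[symmetric] top_unique intro: order.strict_trans1\<close>)
    then show ?thesis by (simp add: Lp_def)
  qed
  have "(\<lambda>x. G 0 x - (G 0 x - L x)) \<in> Lp p \<Omega>" by (rule Lp_diff[OF G LG])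
  then have "L \<in> Lp p \<Omega>" by simp
  moreover have "(\<lambda>k. Np (\<lambda>x. G k x - L x)) \<longlonglongrightarrow> 0"
  proof (rule tendsto_sandwich[OF _ _ tendsto_const])
    show "\<forall>\<^sub>F k in sequentially. 0 \<le> Np (\<lambda>x. G k x - L x)" by (simp add: energy_nonneg)
    have "ennreal (Np (\<lambda>x. G k x - L x)) \<le> ennreal (A * (1/2 ^ k) powr p)" for k
      using nb[of k] LpD(2)[OF LG[of k]] by (simp add: energy_def nn_integral_eq_integral)
    then show "\<forall>\<^sub>F k in sequentially. Np (\<lambda>x. G k x - L x) \<le> A * (1/2 ^ k) powr p"
      using A by (simp add: ennreal_le_iff)
    have "(\<lambda>k. (1/2) ^ k :: real) \<longlonglongrightarrow> 0" by (intro LIMSEQ_power_zero) auto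
    then have "(\<lambda>k. (1/2 ^ k :: real) powr p) \<longlonglongrightarrow> 0 powr p"
      using p by (intro tendsto_powr') (auto simp: power_one_over)
    then show "(\<lambda>k. A * (1/2 ^ k) powr p) \<longlonglongrightarrow> 0" using p by (auto intro: tendsto_mult_right_zero)
  qed
  ultimately show thesis using that by blast
qed

section \<open>Measurability, the Poincare inequality and limits of weak gradients\<close>

lemma locally_integrable_measurable:
  fixes G :: "'a \<Rightarrow> 'b::euclidean_space"
  assumes "locally_integrable \<Omega> G" shows "G \<in> borel_measurable M"
proof -
  obtain \<kappa> :: "nat \<Rightarrow> 'a \<Rightarrow> real" where \<kappa>: "\<And>k. \<kappa> k \<in> test_functions \<Omega>"
    "\<And>x. x \<in> \<Omega> \<Longrightarrow> (\<lambda>k. \<kappa> k x) \<longlonglongrightarrow> 1"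
    using test_functions_exhaust[OF op] by metis
  show ?thesis
  proof (rule borel_measurable_LIMSEQ_metric)
    show "(\<lambda>x. \<kappa> k x *\<^sub>R G x) \<in> borel_measurable M" for k
      using integrable_test_function_mult(2)[OF op assms \<kappa>(1)] by (rule borel_measurable_integrable)
    show "(\<lambda>k. \<kappa> k x *\<^sub>R G x) \<longlonglongrightarrow> G x" if "x \<in> space M" for x
      using tendsto_scaleR[OF \<kappa>(2) tendsto_const, of x "G x"] that by simp
  qed
qed

lemma integrable_imp_locally_integrable:
  fixes G :: "'a \<Rightarrow> 'b::euclidean_space"
  assumes "integrable M G" shows "locally_integrable \<Omega> G"
  unfolding locally_integrable_def set_integrable_def
proof clarify
  fix K assume K: "compact K" "K \<subseteq> \<Omega>"
  have O: "\<Omega> \<inter> space lebesgue \<in> sets lebesgue" using op by simp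
  have "integrable lebesgue (\<lambda>x. indicator \<Omega> x *\<^sub>R G x)"
    using assms unfolding integrable_restrict_space[OF O] .
  then have "integrable lebesgue (\<lambda>x. indicator K x *\<^sub>R (indicator \<Omega> x *\<^sub>R G x))"
    using K(1) by (rule_tac integrable_mult_indicator) (simp_all add: borel_compact)
  moreover have "(\<lambda>x. indicator K x *\<^sub>R (indicator \<Omega> x *\<^sub>R G x)) = (\<lambda>x. indicator K x *\<^sub>R G x)"
    using K by (auto simp: fun_eq_iff indicator_def)
  ultimately show "integrable lebesgue (\<lambda>x. indicator K x *\<^sub>R G x)" by simp
qed

lemma continuous_imp_Lp:
  fixes G :: "'a \<Rightarrow> 'b::euclidean_space"
  assumes "continuous_on UNIV G" shows "G \<in> Lp p \<Omega>"
proof -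
  have m[measurable]: "G \<in> borel_measurable M" using assms by blast
  have "bounded (G ` closure \<Omega>)"
    using bd continuous_on_subset[OF assms]
    by (intro compact_imp_bounded compact_continuous_image) (auto simp: compact_closure)
  then obtain B where "B > 0" and B: "\<And>x. x \<in> closure \<Omega> \<Longrightarrow> norm (G x) \<le> B"
    unfolding bounded_pos by auto
  have "integrable M (\<lambda>x. norm (G x) powr p)"
  proof (rule integrable_const_bound)
    show "AE x in M. norm (norm (G x) powr p) \<le> B powr p"
      using B closure_subset p by (intro AE_I2) (auto intro!: powr_mono2)
  qed measurable
  then show ?thesis using m by (simp add: Lp_def)
qed

lemma smooth_Lp: "smooth f \<Longrightarrow> f \<in> Lp p \<Omega>" "smooth f \<Longrightarrow> grad f \<in> Lp p \<Omega>"
  using continuous_imp_Lp smooth_continuous_on continuous_on_grad by blast+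

text \<open>The \<open>e\<close>-derivative of
  \<open>(x \<bullet> e) * \<bar>\<psi> x\<bar> powr p\<close> has integral 0 and contains
  \<open>\<bar>\<psi> x\<bar> powr p\<close> as a summand. The other summand is controlled by
  \<open>\<bar>x \<bullet> e\<bar> \<le> R\<close> and Young's inequality. That function is in
  general only \<open>C^1\<close>, which is why \<open>integral_derivative_eq_0\<close> asks for no
  more than a continuous gradient.\<close>

lemma poincare:
  obtains P where "P > 0" "\<And>\<psi>. \<psi> \<in> test_functions \<Omega> \<Longrightarrow> Np \<psi> \<le> P * Np (grad \<psi>)"
proof -
  define e :: 'a where "e = (SOME b. b \<in> Basis)"
  have e: "e \<in> Basis" unfolding e_def by (rule SOME_Basis)
  then have e1: "norm e = 1" by simp
  obtain R where R: "R > 0" "\<And>x. x \<in> \<Omega> \<Longrightarrow> norm x \<le> R" using bd unfolding bounded_pos by auto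
  \<comment> \<open>Makes \<open>R * p * \<tau> = 1 / 2\<close>, so that half of
    \<open>Np \<psi>\<close> can be absorbed.\<close>
  define \<tau> where "\<tau> = 1 / (2 * R * p)"
  have \<tau>: "\<tau> > 0" using R p by (simp add: \<tau>_def)
  show thesis
  proof (rule that[of "2 * R * p * \<tau> powr (1 - p)"])
    show "2 * R * p * \<tau> powr (1 - p) > 0" using R p \<tau> by simp
    fix \<psi> assume t: "\<psi> \<in> test_functions \<Omega>"
    obtain K where K: "smooth \<psi>" "compact K" "K \<subseteq> \<Omega>" "\<And>x. x \<notin> K \<Longrightarrow> \<psi> x = 0" "\<And>x. x \<notin> K \<Longrightarrow> grad \<psi> x = 0"
      using test_functionsE[OF t] by metis
    define q where "q t = p * (max t 0 powr (p - 1) - max (- t) 0 powr (p - 1))" for t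
    have qc: "continuous_on UNIV q" unfolding q_def
      using p by (intro continuous_on_mult continuous_on_const continuous_on_diff continuous_on_powr'
        continuous_on_max continuous_on_minus continuous_on_id) auto
    have qle: "\<bar>q t\<bar> \<le> p * \<bar>t\<bar> powr (p - 1)" for t
      using p by (cases "t \<ge> 0") (auto simp: q_def abs_mult)
    have c1: "continuous_on UNIV \<psi>" "continuous_on UNIV (grad \<psi>)"
      using K(1) smooth_continuous_on continuous_on_grad by auto
    have c2: "continuous_on UNIV (\<lambda>x. q (\<psi> x))" by (rule continuous_on_compose2[OF qc c1(1)]) auto
    have c3: "continuous_on UNIV (\<lambda>x. \<bar>\<psi> x\<bar> powr p)"
      using p c1 by (intro continuous_on_powr' continuous_on_rabs continuous_on_const) auto
    define D where "D x = (x \<bullet> e) *\<^sub>R (q (\<psi> x) *\<^sub>R grad \<psi> x) + (\<bar>\<psi> x\<bar> powr p) *\<^sub>R e" for x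
    have D: "GDERIV (\<lambda>x. (x \<bullet> e) * \<bar>\<psi> x\<bar> powr p) x :> D x" for x
    proof -
      have a: "GDERIV (\<lambda>x. \<bar>\<psi> x\<bar> powr p) x :> q (\<psi> x) *\<^sub>R grad \<psi> x"
        unfolding q_def by (rule GDERIV_DERIV_compose[OF smooth_GDERIV[OF K(1)] DERIV_abs_powr[OF p]])
      have b: "GDERIV (\<lambda>x. x \<bullet> e) x :> e"
        using smooth_GDERIV[OF smooth_inner[of e], of x] by (simp add: grad_inner)
      show ?thesis unfolding D_def by (rule GDERIV_mult[OF b a])
    qed
    have Dc: "continuous_on UNIV D" unfolding D_def
      by (intro continuous_on_add continuous_on_scaleR c2 c1 c3 continuous_on_const continuous_on_inner continuous_on_id)
    have i0: "(LINT x|M. D x \<bullet> e) = 0"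
      by (rule integral_derivative_eq_0[OF op D Dc K(2,3)]) (use K p in \<open>auto simp: D_def\<close>)
    define w where "w x = (x \<bullet> e) * (q (\<psi> x) * (grad \<psi> x \<bullet> e))" for x
    have De: "D x \<bullet> e = w x + \<bar>\<psi> x\<bar> powr p" for x
      using e by (simp add: D_def w_def inner_add_left inner_Basis)
    have i1: "integrable M (\<lambda>x. \<bar>\<psi> x\<bar> powr p)" "integrable M (\<lambda>x. norm (grad \<psi> x) powr p)"
      using LpD(2)[OF smooth_Lp(1)[OF K(1)]] LpD(2)[OF smooth_Lp(2)[OF K(1)]] by auto
    have i2: "integrable M w" unfolding w_def
      by (rule lebesgue_on_compact_support(1)[OF op _ K(2,3)])
         (use K in \<open>auto intro!: continuous_on_mult continuous_on_inner c2 c1 continuous_on_const continuous_on_id\<close>)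
    have "Np \<psi> = - (LINT x|M. w x)"
      using i0 i1 i2 unfolding De by (simp add: energy_def)
    also have "\<dots> = (LINT x|M. - w x)" by simp
    also have "\<dots> \<le> (LINT x|M. R * p * (\<tau> * \<bar>\<psi> x\<bar> powr p + \<tau> powr (1 - p) * norm (grad \<psi> x) powr p))"
    proof (rule integral_mono)
      show "integrable M (\<lambda>x. - w x)" using i2 by simp
      show "integrable M (\<lambda>x. R * p * (\<tau> * \<bar>\<psi> x\<bar> powr p + \<tau> powr (1 - p) * norm (grad \<psi> x) powr p))"
        by (intro integrable_mult_right Bochner_Integration.integrable_add i1)
      fix x assume "x \<in> space M"
      then have xR: "\<bar>x \<bullet> e\<bar> \<le> R" using R(2)[of x] Basis_le_norm[OF e, of x] by simp
      have ge: "\<bar>grad \<psi> x \<bullet> e\<bar> \<le> norm (grad \<psi> x)" using Basis_le_norm[OF e] .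
      have "- w x \<le> \<bar>x \<bullet> e\<bar> * (\<bar>q (\<psi> x)\<bar> * \<bar>grad \<psi> x \<bullet> e\<bar>)"
        unfolding w_def abs_mult[symmetric] by (rule abs_ge_minus_self)
      also have "\<dots> \<le> R * ((p * \<bar>\<psi> x\<bar> powr (p - 1)) * norm (grad \<psi> x))"
        using xR ge qle p R by (intro mult_mono) auto
      also have "\<dots> = R * p * (\<bar>\<psi> x\<bar> powr (p - 1) * norm (grad \<psi> x))" by simp
      also have "\<dots> \<le> R * p * (\<tau> * \<bar>\<psi> x\<bar> powr p + \<tau> powr (1 - p) * norm (grad \<psi> x) powr p)"
        using R p \<tau> by (intro mult_left_mono young_powr) auto
      finally show "- w x \<le> R * p * (\<tau> * \<bar>\<psi> x\<bar> powr p + \<tau> powr (1 - p) * norm (grad \<psi> x) powr p)" .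
    qed
    also have "\<dots> = R * p * (\<tau> * Np \<psi> + \<tau> powr (1 - p) * Np (grad \<psi>))"
      using i1 by (simp add: energy_def)
    also have "\<dots> = Np \<psi> / 2 + R * p * \<tau> powr (1 - p) * Np (grad \<psi>)"
      using R p by (simp add: \<tau>_def field_simps)
    finally show "Np \<psi> \<le> 2 * R * p * \<tau> powr (1 - p) * Np (grad \<psi>)" by simp
  qed
qed

text \<open>Test functions and their gradients are bounded, so convergence in \<open>L^1\<close>,
  which follows on a bounded set, suffices to pass to the limit in the defining identity.\<close>

lemma has_weak_gradient_limit:
  assumes "\<And>k. has_weak_gradient \<Omega> (u k) (G k)" "\<And>k. u k \<in> Lp p \<Omega>" "\<And>k. G k \<in> Lp p \<Omega>"
    and v: "v \<in> Lp p \<Omega>" "H \<in> Lp p \<Omega>"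
    and lim: "(\<lambda>k. Np (\<lambda>x. u k x - v x)) \<longlonglongrightarrow> 0" "(\<lambda>k. Np (\<lambda>x. G k x - H x)) \<longlonglongrightarrow> 0"
  shows "has_weak_gradient \<Omega> v H"
  unfolding has_weak_gradient_def
proof (intro conjI ballI allI impI)
  show "locally_integrable \<Omega> v" "locally_integrable \<Omega> H"
    using v Lp_integrable integrable_imp_locally_integrable by blast+
  fix \<psi> D assume t: "\<psi> \<in> test_functions \<Omega>" and dD: "\<forall>x. GDERIV \<psi> x :> D x"
  then have D: "D = grad \<psi>" by (intro ext) (metis grad_eqI)
  obtain K where K: "smooth \<psi>" "compact K" "\<And>x. x \<notin> K \<Longrightarrow> \<psi> x = 0" "\<And>x. x \<notin> K \<Longrightarrow> grad \<psi> x = 0"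
    using test_functionsE[OF t] by metis
  have c: "continuous_on UNIV \<psi>" "continuous_on UNIV D"
    using K(1) D smooth_continuous_on continuous_on_grad by auto
  obtain B where B: "B \<ge> 0" "\<And>x. norm (\<psi> x) \<le> B" using bounded_compact_support[OF c(1) K(2,3)] by blast
  obtain C where C: "C \<ge> 0" "\<And>x. norm (D x) \<le> C"
    using bounded_compact_support[OF c(2) K(2)] K(4) D by blast
  have pi1: "integrable M (\<lambda>x. w x *\<^sub>R D x)" if "w \<in> Lp p \<Omega>" for w
  proof (rule Bochner_Integration.integrable_bound)
    show "integrable M (\<lambda>x. C * w x)" using Lp_integrable[OF that] by simp
    show "(\<lambda>x. w x *\<^sub>R D x) \<in> borel_measurable M"
      using LpD(1)[OF that] c(2) by (intro borel_measurable_scaleR) auto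
    show "AE x in M. norm (w x *\<^sub>R D x) \<le> norm (C * w x)"
      using C by (intro AE_I2) (simp add: abs_mult mult.commute[of C] mult_left_mono)
  qed
  have pi2: "integrable M (\<lambda>x. \<psi> x *\<^sub>R F x)" if "F \<in> Lp p \<Omega>" for F :: "'a \<Rightarrow> 'a"
  proof (rule Bochner_Integration.integrable_bound)
    show "integrable M (\<lambda>x. B *\<^sub>R F x)" using Lp_integrable[OF that] by simp
    show "(\<lambda>x. \<psi> x *\<^sub>R F x) \<in> borel_measurable M"
      using LpD(1)[OF that] c(1) by (intro borel_measurable_scaleR) auto
    show "AE x in M. norm (\<psi> x *\<^sub>R F x) \<le> norm (B *\<^sub>R F x)"
      using B by (intro AE_I2) (simp add: mult_right_mono)
  qed
  have l1: "(\<lambda>k. LINT x|M. norm (u k x - v x)) \<longlonglongrightarrow> 0"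
    using Lp_diff assms(2) v(1) lim(1) by (intro Lp_tendsto_L1) auto
  have l2: "(\<lambda>k. LINT x|M. norm (G k x - H x)) \<longlonglongrightarrow> 0"
    using Lp_diff assms(3) v(2) lim(2) by (intro Lp_tendsto_L1) auto
  have "(\<lambda>k. (LINT x|M. u k x *\<^sub>R D x) - (LINT x|M. v x *\<^sub>R D x)) \<longlonglongrightarrow> 0"
  proof (rule Lim_null_comparison)
    show "(\<lambda>k. C * (LINT x|M. norm (u k x - v x))) \<longlonglongrightarrow> 0" using l1 by (rule tendsto_mult_right_zero)
    have "norm ((LINT x|M. u k x *\<^sub>R D x) - (LINT x|M. v x *\<^sub>R D x)) \<le> C * (LINT x|M. norm (u k x - v x))" for k
    proof -
      have d: "(\<lambda>x. u k x - v x) \<in> Lp p \<Omega>" using Lp_diff assms(2) v(1) by blast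
      have "(LINT x|M. u k x *\<^sub>R D x) - (LINT x|M. v x *\<^sub>R D x) = (LINT x|M. (u k x - v x) *\<^sub>R D x)"
        using pi1[OF assms(2)[of k]] pi1[OF v(1)] by (simp add: scaleR_diff_left)
      also have "norm \<dots> \<le> (LINT x|M. norm ((u k x - v x) *\<^sub>R D x))" by (rule integral_norm_bound)
      also have "\<dots> \<le> (LINT x|M. C * norm (u k x - v x))"
        using pi1[OF d] Lp_integrable[OF d] C
        by (intro integral_mono integrable_norm integrable_mult_right) (auto simp: mult.commute[of C] intro!: mult_left_mono)
      finally show ?thesis by simp
    qed
    then show "\<forall>\<^sub>F k in sequentially. norm ((LINT x|M. u k x *\<^sub>R D x) - (LINT x|M. v x *\<^sub>R D x)) \<le> C * (LINT x|M. norm (u k x - v x))"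
      by simp
  qed
  then have L1: "(\<lambda>k. (LINT x|M. u k x *\<^sub>R D x)) \<longlonglongrightarrow> (LINT x|M. v x *\<^sub>R D x)" by (simp add: LIM_zero_iff)
  have "(\<lambda>k. (LINT x|M. \<psi> x *\<^sub>R G k x) - (LINT x|M. \<psi> x *\<^sub>R H x)) \<longlonglongrightarrow> 0"
  proof (rule Lim_null_comparison)
    show "(\<lambda>k. B * (LINT x|M. norm (G k x - H x))) \<longlonglongrightarrow> 0" using l2 by (rule tendsto_mult_right_zero)
    have "norm ((LINT x|M. \<psi> x *\<^sub>R G k x) - (LINT x|M. \<psi> x *\<^sub>R H x)) \<le> B * (LINT x|M. norm (G k x - H x))" for k
    proof -
      have d: "(\<lambda>x. G k x - H x) \<in> Lp p \<Omega>" using Lp_diff assms(3) v(2) by blast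
      have "(LINT x|M. \<psi> x *\<^sub>R G k x) - (LINT x|M. \<psi> x *\<^sub>R H x) = (LINT x|M. \<psi> x *\<^sub>R (G k x - H x))"
        using pi2[OF assms(3)[of k]] pi2[OF v(2)] by (simp add: scaleR_diff_right)
      also have "norm \<dots> \<le> (LINT x|M. norm (\<psi> x *\<^sub>R (G k x - H x)))" by (rule integral_norm_bound)
      also have "\<dots> \<le> (LINT x|M. B * norm (G k x - H x))"
        using pi2[OF d] Lp_integrable[OF d] B
        by (intro integral_mono integrable_norm integrable_mult_right) (auto intro!: mult_right_mono)
      finally show ?thesis by simp
    qed
    then show "\<forall>\<^sub>F k in sequentially. norm ((LINT x|M. \<psi> x *\<^sub>R G k x) - (LINT x|M. \<psi> x *\<^sub>R H x)) \<le> B * (LINT x|M. norm (G k x - H x))"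
      by simp
  qed
  then have L2: "(\<lambda>k. (LINT x|M. \<psi> x *\<^sub>R G k x)) \<longlonglongrightarrow> (LINT x|M. \<psi> x *\<^sub>R H x)" by (simp add: LIM_zero_iff)
  have e: "(LINT x|M. u k x *\<^sub>R D x) = - (LINT x|M. \<psi> x *\<^sub>R G k x)" for k
    using assms(1)[of k] t dD unfolding has_weak_gradient_def by blast
  show "(LINT x|M. v x *\<^sub>R D x) = - (LINT x|M. \<psi> x *\<^sub>R H x)"
    using L1 tendsto_minus[OF L2] unfolding e by (rule LIMSEQ_unique)
qed

text \<open>The midpoint of \<open>G\<close> and \<open>H\<close> is admissible and has energy at
  least \<open>m\<close>. So the integrated convexity gap is at most \<open>\<delta>\<close>, and
  uniform convexity turns this into closeness in \<open>L^p\<close>.\<close>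

lemma near_minimizers_close:
  fixes \<gamma> :: "'a \<Rightarrow> real" and K :: "('a \<Rightarrow> 'b::euclidean_space) set"
  assumes w: "weight \<gamma>" and K: "K \<subseteq> Lp p \<Omega>"
    and mid: "\<And>G H. G \<in> K \<Longrightarrow> H \<in> K \<Longrightarrow> (\<lambda>x. (1/2) *\<^sub>R (G x + H x)) \<in> K"
    and m: "0 \<le> m" "\<And>G. G \<in> K \<Longrightarrow> m \<le> energy \<gamma> G" and \<epsilon>: "0 < \<epsilon>"
  obtains \<delta> where "\<delta> > 0" "\<And>G H. G \<in> K \<Longrightarrow> H \<in> K \<Longrightarrow> energy \<gamma> G \<le> m + \<delta> \<Longrightarrow> energy \<gamma> H \<le> m + \<delta>
    \<Longrightarrow> Np (\<lambda>x. G x - H x) \<le> \<epsilon>"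
proof -
  obtain c0 where c0: "c0 > 0" "\<And>G :: 'a \<Rightarrow> 'b. G \<in> Lp p \<Omega> \<Longrightarrow> c0 * Np G \<le> energy \<gamma> G"
    using energy_bounds[OF w] by metis
  \<comment> \<open>\<open>G\<close> and \<open>H\<close> together have energy at most
    \<open>2 * (m + 1)\<close>, so the \<open>\<epsilon>'\<close> term costs
    \<open>c0 * \<epsilon> / 2\<close>; the gap term costs as much.\<close>
  define \<epsilon>' where "\<epsilon>' = c0 * \<epsilon> / (4 * (m + 1))"
  have e': "\<epsilon>' > 0" using c0 \<epsilon> m by (simp add: \<epsilon>'_def)
  obtain C where C: "C \<ge> 0" "\<And>\<xi> \<eta> :: 'b.
    norm (\<xi> - \<eta>) powr p \<le> \<epsilon>' * (norm \<xi> powr p + norm \<eta> powr p) + C * convexity_gap p \<xi> \<eta>"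
    using uniform_convexity[OF p e'] by metis
  define \<delta> where "\<delta> = min 1 (c0 * \<epsilon> / (2 * (C + 1)))"
  have d: "\<delta> > 0" "\<delta> \<le> 1" "C * \<delta> \<le> c0 * \<epsilon> / 2"
  proof -
    show "\<delta> > 0" "\<delta> \<le> 1" using c0 \<epsilon> C by (auto simp: \<delta>_def)
    have "C * \<delta> \<le> (C + 1) * (c0 * \<epsilon> / (2 * (C + 1)))"
      using C c0 \<epsilon> by (intro mult_mono) (auto simp: \<delta>_def)
    also have "\<dots> = c0 * \<epsilon> / 2" using C(1) by (simp add: divide_simps)
    finally show "C * \<delta> \<le> c0 * \<epsilon> / 2" .
  qed
  show thesis
  proof (rule that[OF d(1)])
    fix G H assume G: "G \<in> K" and H: "H \<in> K" and eG: "energy \<gamma> G \<le> m + \<delta>" and eH: "energy \<gamma> H \<le> m + \<delta>"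
    have L: "G \<in> Lp p \<Omega>" "H \<in> Lp p \<Omega>" "(\<lambda>x. (1/2) *\<^sub>R (G x + H x)) \<in> Lp p \<Omega>" using G H mid K by auto
    note ii = energy_integrable[OF w L(1)] energy_integrable[OF w L(2)] energy_integrable[OF w L(3)]
    have "c0 * Np (\<lambda>x. G x - H x) \<le> energy \<gamma> (\<lambda>x. G x - H x)" using c0(2) Lp_diff L by blast
    also have "\<dots> \<le> (LINT x|M. \<epsilon>' * (\<gamma> x * norm (G x) powr p + \<gamma> x * norm (H x) powr p)
        + C * ((\<gamma> x * norm (G x) powr p + \<gamma> x * norm (H x) powr p) / 2 - \<gamma> x * norm ((1/2) *\<^sub>R (G x + H x)) powr p))"
      unfolding energy_def
    proof (rule integral_mono)
      show "integrable M (\<lambda>x. \<gamma> x * norm (G x - H x) powr p)" by (intro energy_integrable w Lp_diff L)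
      show "integrable M (\<lambda>x. \<epsilon>' * (\<gamma> x * norm (G x) powr p + \<gamma> x * norm (H x) powr p)
        + C * ((\<gamma> x * norm (G x) powr p + \<gamma> x * norm (H x) powr p) / 2 - \<gamma> x * norm ((1/2) *\<^sub>R (G x + H x)) powr p))"
        using ii by (intro Bochner_Integration.integrable_add Bochner_Integration.integrable_diff
          integrable_mult_right integrable_divide)
      fix x assume "x \<in> space M"
      then have "\<gamma> x \<ge> 0" using weight_pos[OF w] by (simp add: less_imp_le)
      from mult_left_mono[OF C(2) this, of "G x" "H x"]
      show "\<gamma> x * norm (G x - H x) powr p \<le> \<epsilon>' * (\<gamma> x * norm (G x) powr p + \<gamma> x * norm (H x) powr p)
        + C * ((\<gamma> x * norm (G x) powr p + \<gamma> x * norm (H x) powr p) / 2 - \<gamma> x * norm ((1/2) *\<^sub>R (G x + H x)) powr p)"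
        by (simp add: convexity_gap_def algebra_simps add_divide_distrib)
    qed
    also have "\<dots> = \<epsilon>' * (energy \<gamma> G + energy \<gamma> H)
        + C * ((energy \<gamma> G + energy \<gamma> H) / 2 - energy \<gamma> (\<lambda>x. (1/2) *\<^sub>R (G x + H x)))"
      using ii unfolding energy_def by simp
    also have "\<dots> \<le> \<epsilon>' * (2 * (m + 1)) + C * \<delta>"
    proof (intro add_mono mult_left_mono)
      show "energy \<gamma> G + energy \<gamma> H \<le> 2 * (m + 1)" using eG eH d by simp
      show "(energy \<gamma> G + energy \<gamma> H) / 2 - energy \<gamma> (\<lambda>x. (1/2) *\<^sub>R (G x + H x)) \<le> \<delta>"
      proof -
        have *: "(a + b) / 2 - c \<le> \<delta>" if "a \<le> m + \<delta>" "b \<le> m + \<delta>" "m \<le> c" for a b c :: real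
          using that by (simp add: field_simps)
        show ?thesis by (rule *[OF eG eH m(2)[OF mid[OF G H]]])
      qed
    qed (use e' C(1) in auto)
    also have "\<dots> \<le> c0 * \<epsilon>"
    proof -
      have "\<epsilon>' * (2 * (m + 1)) = c0 * \<epsilon> / 2" using m(1) by (simp add: \<epsilon>'_def divide_simps)
      then show ?thesis using d(3) by simp
    qed
    finally show "Np (\<lambda>x. G x - H x) \<le> \<epsilon>" using c0 by simp
  qed
qed

lemma minimizing_sequence:
  fixes \<gamma> :: "'a \<Rightarrow> real" and K :: "('a \<Rightarrow> 'b::euclidean_space) set"
  assumes w: "weight \<gamma>" and K: "K \<subseteq> Lp p \<Omega>" "K \<noteq> {}"
    and mid: "\<And>G H. G \<in> K \<Longrightarrow> H \<in> K \<Longrightarrow> (\<lambda>x. (1/2) *\<^sub>R (G x + H x)) \<in> K"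
  obtains G m where "\<And>k::nat. G k \<in> K" "\<And>H. H \<in> K \<Longrightarrow> m \<le> energy \<gamma> H" "\<And>k. energy \<gamma> (G k) \<le> m + 1 / 2 ^ k"
    "\<And>k j. k \<le> j \<Longrightarrow> Np (\<lambda>x. G k x - G j x) \<le> (1 / 2 ^ k) powr p"
proof -
  define m where "m = Inf (energy \<gamma> ` K)"
  have bb: "bdd_below (energy \<gamma> ` K)" using energy_nonneg[OF w] by (auto intro!: bdd_belowI[of _ 0])
  have m: "m \<le> energy \<gamma> H" if "H \<in> K" for H unfolding m_def using that bb by (intro cInf_lower) auto
  have m0: "0 \<le> m" unfolding m_def using K energy_nonneg[OF w] by (intro cInf_greatest) auto
  have "\<exists>\<delta>>0. \<forall>G\<in>K. \<forall>H\<in>K. energy \<gamma> G \<le> m + \<delta> \<longrightarrow> energy \<gamma> H \<le> m + \<delta> \<longrightarrow>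
      Np (\<lambda>x. G x - H x) \<le> (1 / 2 ^ k) powr p" for k :: nat
  proof -
    have "0 < (1 / 2 ^ k :: real) powr p" by simp
    show ?thesis
    proof (rule near_minimizers_close[OF w K(1) mid m0 m \<open>0 < (1 / 2 ^ k :: real) powr p\<close>])
      fix \<delta> :: real assume a: "0 < \<delta>" and b: "\<And>G H. G \<in> K \<Longrightarrow> H \<in> K \<Longrightarrow> energy \<gamma> G \<le> m + \<delta> \<Longrightarrow>
        energy \<gamma> H \<le> m + \<delta> \<Longrightarrow> Np (\<lambda>x. G x - H x) \<le> (1 / 2 ^ k) powr p"
      show ?thesis by (intro exI[of _ \<delta>] conjI a ballI impI) (rule b)
    qed
  qed
  then have "\<forall>k::nat. \<exists>\<delta>>0. \<forall>G\<in>K. \<forall>H\<in>K. energy \<gamma> G \<le> m + \<delta> \<longrightarrow> energy \<gamma> H \<le> m + \<delta> \<longrightarrow>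
      Np (\<lambda>x. G x - H x) \<le> (1 / 2 ^ k) powr p" by (rule allI)
  from choice[OF this] obtain \<delta> :: "nat \<Rightarrow> real" where \<delta>': "\<forall>k. \<delta> k > 0 \<and> (\<forall>G\<in>K. \<forall>H\<in>K. energy \<gamma> G \<le> m + \<delta> k \<longrightarrow>
      energy \<gamma> H \<le> m + \<delta> k \<longrightarrow> Np (\<lambda>x. G x - H x) \<le> (1 / 2 ^ k) powr p)" ..
  have \<delta>: "\<delta> k > 0" "G \<in> K \<Longrightarrow> H \<in> K \<Longrightarrow> energy \<gamma> G \<le> m + \<delta> k \<Longrightarrow>
      energy \<gamma> H \<le> m + \<delta> k \<Longrightarrow> Np (\<lambda>x. G x - H x) \<le> (1 / 2 ^ k) powr p" for k G H
    using spec[OF \<delta>', of k] by simp_all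
  \<comment> \<open>The minimum over all tolerances up to \<open>\<delta> k\<close> keeps every
    later \<open>G j\<close> within \<open>\<delta> k\<close> of the infimum as well.\<close>
  define d where "d k = min (1 / 2 ^ k) (Min (\<delta> ` {..k}))" for k :: nat
  have d0: "d k > 0" for k using \<delta>(1) by (auto simp: d_def)
  have dle: "d j \<le> \<delta> k" if "k \<le> j" for k j
    using that by (auto simp: d_def intro!: min.coboundedI2 Min_le)
  have "\<exists>G\<in>K. energy \<gamma> G < m + d k" for k
    using cInf_lessD[of "energy \<gamma> ` K" "m + d k"] K(2) d0[of k] by (auto simp: m_def)
  then obtain G where G: "\<And>k. G k \<in> K" "\<And>k. energy \<gamma> (G k) < m + d k" by metis
  show thesis
  proof (rule that[OF G(1) m])
    show "energy \<gamma> (G k) \<le> m + 1 / 2 ^ k" for k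
      using G(2)[of k] by (simp add: d_def)
    show "Np (\<lambda>x. G k x - G j x) \<le> (1 / 2 ^ k) powr p" if "k \<le> j" for k j
      using G(2)[of k] G(2)[of j] dle[of k k] dle[OF that] by (intro \<delta>(2) G(1)) auto
  qed auto
qed

section \<open>The Dirichlet problem\<close>

abbreviation wg :: "('a \<Rightarrow> real) \<Rightarrow> 'a \<Rightarrow> 'a" where "wg \<equiv> weak_gradient \<Omega>"

text \<open>Membership provides some \<open>p\<close>-integrable weak gradient. The selected one
  agrees with it almost everywhere and is measurable because it is locally integrable.\<close>

lemma W1pD:
  assumes "u \<in> W1p p \<Omega>"
  shows "u \<in> Lp p \<Omega>" "has_weak_gradient \<Omega> u (wg u)" "wg u \<in> Lp p \<Omega>"
proof -
  obtain G where G: "G \<in> Lp p \<Omega>" "has_weak_gradient \<Omega> u G" and u: "u \<in> Lp p \<Omega>"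
    using assms by (auto simp: W1p_def)
  show "u \<in> Lp p \<Omega>" by (fact u)
  show h: "has_weak_gradient \<Omega> u (wg u)" using weak_gradient_AE(1)[OF op G(2)] .
  have "wg u \<in> borel_measurable M"
    using h locally_integrable_measurable unfolding has_weak_gradient_def by blast
  moreover have "AE x in M. G x = wg u x" using weak_gradient_AE(2)[OF op G(2)] by eventually_elim simp
  ultimately show "wg u \<in> Lp p \<Omega>" using Lp_cong_AE[OF G(1)] by blast
qed

lemma W1pI: "u \<in> Lp p \<Omega> \<Longrightarrow> has_weak_gradient \<Omega> u G \<Longrightarrow> G \<in> Lp p \<Omega> \<Longrightarrow> u \<in> W1p p \<Omega>"
  by (auto simp: W1p_def)

lemma W1p_lin:
  assumes "u \<in> W1p p \<Omega>" "v \<in> W1p p \<Omega>"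
  shows "(\<lambda>x. u x + c * v x) \<in> W1p p \<Omega>"
    and "AE x in M. wg (\<lambda>x. u x + c * v x) x = wg u x + c *\<^sub>R wg v x"
proof -
  have h: "has_weak_gradient \<Omega> (\<lambda>x. u x + c * v x) (\<lambda>x. wg u x + c *\<^sub>R wg v x)"
    using has_weak_gradient_lin[OF op W1pD(2)[OF assms(1)] W1pD(2)[OF assms(2)]] .
  then show "AE x in M. wg (\<lambda>x. u x + c * v x) x = wg u x + c *\<^sub>R wg v x"
    using weak_gradient_AE(2)[OF op] by blast
  have "(\<lambda>x. u x + c *\<^sub>R v x) \<in> Lp p \<Omega>" using W1pD(1) assms Lp_add Lp_scale by blast
  moreover have "(\<lambda>x. wg u x + c *\<^sub>R wg v x) \<in> Lp p \<Omega>" using W1pD(3) assms Lp_add Lp_scale by blast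
  ultimately show "(\<lambda>x. u x + c * v x) \<in> W1p p \<Omega>" using W1pI h by auto
qed

lemma W1p_diff:
  assumes "u \<in> W1p p \<Omega>" "v \<in> W1p p \<Omega>"
  shows "(\<lambda>x. u x - v x) \<in> W1p p \<Omega>" "AE x in M. wg (\<lambda>x. u x - v x) x = wg u x - wg v x"
  using W1p_lin[OF assms, of "-1"] by auto

lemma W1p_smooth:
  assumes "smooth f"
  shows "f \<in> W1p p \<Omega>" "AE x in M. wg f x = grad f x"
  using has_weak_gradient_smooth[OF op assms] smooth_Lp[OF assms] W1pI weak_gradient_AE(2)[OF op] by blast+

lemma energy_cong_Lp:
  assumes "weight \<gamma>" "G \<in> Lp p \<Omega>" "H \<in> Lp p \<Omega>" "AE x in M. G x = H x"
  shows "energy \<gamma> G = energy \<gamma> H"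
  using energy_cong_AE[OF assms(1) LpD(1)[OF assms(2)] LpD(1)[OF assms(3)] assms(4)] .

lemma W1p_norm_less_iff:
  assumes "v \<in> W1p p \<Omega>" "\<epsilon> > 0"
  shows "W1p_norm p \<Omega> v < \<epsilon> \<longleftrightarrow> Np v + Np (wg v) < \<epsilon> powr p"
proof -
  define S where "S = Np v + Np (wg v)"
  have S: "S \<ge> 0" by (simp add: S_def energy_nonneg)
  have n: "W1p_norm p \<Omega> v = S powr (1 / p)" by (simp add: W1p_norm_def S_def energy_def)
  have "S powr (1 / p) < \<epsilon> \<longleftrightarrow> S < \<epsilon> powr p"
  proof
    assume "S powr (1 / p) < \<epsilon>"
    then have "(S powr (1 / p)) powr p < \<epsilon> powr p" using p by (intro powr_less_mono2) auto
    then show "S < \<epsilon> powr p" using p S by (simp add: powr_powr)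
  next
    assume "S < \<epsilon> powr p"
    then have "S powr (1 / p) < (\<epsilon> powr p) powr (1 / p)" using p S by (intro powr_less_mono2) auto
    then show "S powr (1 / p) < \<epsilon>" using p assms(2) by (simp add: powr_powr)
  qed
  then show ?thesis by (simp add: n S_def)
qed

text \<open>Sums of \<open>p\<close>-th powers are easier to estimate than the norm with its root,
  which only changes \<open>\<epsilon>\<close> into a power of it; and the gradient of
  \<open>u - \<psi>\<close> splits almost everywhere.\<close>

lemma W1p_0_iff:
  "u \<in> W1p_0 p \<Omega> \<longleftrightarrow> u \<in> W1p p \<Omega> \<and>
    (\<forall>\<epsilon>>0. \<exists>\<psi>\<in>test_functions \<Omega>. Np (\<lambda>x. u x - \<psi> x) + Np (\<lambda>x. wg u x - grad \<psi> x) < \<epsilon>)"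
proof (cases "u \<in> W1p p \<Omega>")
  case True
  have *: "W1p_norm p \<Omega> (\<lambda>x. u x - \<psi> x) < \<epsilon> \<longleftrightarrow>
      Np (\<lambda>x. u x - \<psi> x) + Np (\<lambda>x. wg u x - grad \<psi> x) < \<epsilon> powr p"
    if "\<epsilon> > 0" "\<psi> \<in> test_functions \<Omega>" for \<epsilon> \<psi>
  proof -
    have s: "smooth \<psi>" using that(2) by (rule test_functions_smooth)
    note d = W1p_diff[OF True W1p_smooth(1)[OF s]]
    have "AE x in M. wg (\<lambda>x. u x - \<psi> x) x = wg u x - grad \<psi> x"
      using d(2) W1p_smooth(2)[OF s] by eventually_elim simp
    then have "Np (wg (\<lambda>x. u x - \<psi> x)) = Np (\<lambda>x. wg u x - grad \<psi> x)"
      using Lp_diff[OF W1pD(3)[OF True] smooth_Lp(2)[OF s]] W1pD(3)[OF d(1)]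
      by (intro energy_cong_Lp) auto
    then show ?thesis using W1p_norm_less_iff[OF d(1) that(1)] by simp
  qed
  show ?thesis
  proof
    assume u: "u \<in> W1p_0 p \<Omega>"
    have "\<exists>\<psi>\<in>test_functions \<Omega>. Np (\<lambda>x. u x - \<psi> x) + Np (\<lambda>x. wg u x - grad \<psi> x) < \<epsilon>" if "\<epsilon> > 0" for \<epsilon>
    proof -
      have e: "\<epsilon> powr (1/p) > 0" using that by simp
      obtain \<psi> where t: "\<psi> \<in> test_functions \<Omega>" "W1p_norm p \<Omega> (\<lambda>x. u x - \<psi> x) < \<epsilon> powr (1/p)"
        using u e unfolding W1p_0_def by blast
      have "Np (\<lambda>x. u x - \<psi> x) + Np (\<lambda>x. wg u x - grad \<psi> x) < \<epsilon>"
        using *[OF e t(1)] t(2) p that by (simp add: powr_powr)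
      then show ?thesis using t(1) by blast
    qed
    then show "u \<in> W1p p \<Omega> \<and> (\<forall>\<epsilon>>0. \<exists>\<psi>\<in>test_functions \<Omega>. Np (\<lambda>x. u x - \<psi> x) + Np (\<lambda>x. wg u x - grad \<psi> x) < \<epsilon>)"
      using True by blast
  next
    assume u: "u \<in> W1p p \<Omega> \<and> (\<forall>\<epsilon>>0. \<exists>\<psi>\<in>test_functions \<Omega>. Np (\<lambda>x. u x - \<psi> x) + Np (\<lambda>x. wg u x - grad \<psi> x) < \<epsilon>)"
    have "\<exists>\<psi>\<in>test_functions \<Omega>. W1p_norm p \<Omega> (\<lambda>x. u x - \<psi> x) < \<epsilon>" if e: "\<epsilon> > 0" for \<epsilon>
    proof -
      have "\<epsilon> powr p > 0" using e by simp
      then obtain \<psi> where t: "\<psi> \<in> test_functions \<Omega>" "Np (\<lambda>x. u x - \<psi> x) + Np (\<lambda>x. wg u x - grad \<psi> x) < \<epsilon> powr p"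
        using u by blast
      then show ?thesis using *[OF e t(1)] by blast
    qed
    then show "u \<in> W1p_0 p \<Omega>" using True unfolding W1p_0_def by blast
  qed
next
  case False
  then show ?thesis by (simp add: W1p_0_def)
qed

lemma W1p_0D: "u \<in> W1p_0 p \<Omega> \<Longrightarrow> u \<in> W1p p \<Omega>"
  by (simp add: W1p_0_def)

lemma test_functions_W1p_0:
  assumes "\<psi> \<in> test_functions \<Omega>" shows "\<psi> \<in> W1p_0 p \<Omega>"
proof -
  have s: "smooth \<psi>" using assms by (rule test_functions_smooth)
  have "Np (\<lambda>x. wg \<psi> x - grad \<psi> x) = Np (\<lambda>x. 0::'a)"
  proof (rule energy_cong_Lp)
    show "AE x in M. wg \<psi> x - grad \<psi> x = 0" using W1p_smooth(2)[OF s] by eventually_elim simp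
    show "(\<lambda>x. wg \<psi> x - grad \<psi> x) \<in> Lp p \<Omega>"
      by (rule Lp_diff[OF W1pD(3)[OF W1p_smooth(1)[OF s]] smooth_Lp(2)[OF s]])
  qed (auto intro: continuous_imp_Lp)
  then have "Np (\<lambda>x. \<psi> x - \<psi> x) + Np (\<lambda>x. wg \<psi> x - grad \<psi> x) = 0" using p by (simp add: energy_def)
  then show ?thesis unfolding W1p_0_iff using assms W1p_smooth(1)[OF s] by (metis)
qed

lemma zero_W1p_0 [simp]: "(\<lambda>x. 0) \<in> W1p_0 p \<Omega>"
  by (intro test_functions_W1p_0) simp

lemma W1p_0_lin:
  assumes "u \<in> W1p_0 p \<Omega>" "v \<in> W1p_0 p \<Omega>"
  shows "(\<lambda>x. u x + c * v x) \<in> W1p_0 p \<Omega>"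
  unfolding W1p_0_iff
proof (intro conjI allI impI)
  note u = W1p_0D[OF assms(1)] and v = W1p_0D[OF assms(2)]
  show "(\<lambda>x. u x + c * v x) \<in> W1p p \<Omega>" by (rule W1p_lin[OF u v])
  fix \<epsilon> :: real assume e: "\<epsilon> > 0"
  define Q where "Q = (2::real) powr (p - 1)"
  have Q: "Q > 0" by (simp add: Q_def)
  \<comment> \<open>The summand 1 keeps the later divisor positive when
    \<open>c = 0\<close>.\<close>
  define c' where "c' = \<bar>c\<bar> powr p + 1"
  have c': "c' > 0" "\<bar>c\<bar> powr p \<le> c'" unfolding c'_def by (auto simp: add_nonneg_pos)
  obtain \<psi> where \<psi>: "\<psi> \<in> test_functions \<Omega>" "Np (\<lambda>x. u x - \<psi> x) + Np (\<lambda>x. wg u x - grad \<psi> x) < \<epsilon> / (2 * Q)"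
    using assms(1) e Q unfolding W1p_0_iff by (metis divide_pos_pos mult_pos_pos zero_less_numeral)
  have "\<epsilon> / (2 * Q * c') > 0" using e Q c' by simp
  then obtain \<phi> where \<phi>: "\<phi> \<in> test_functions \<Omega>" "Np (\<lambda>x. v x - \<phi> x) + Np (\<lambda>x. wg v x - grad \<phi> x) < \<epsilon> / (2 * Q * c')"
    using assms(2) unfolding W1p_0_iff by meson
  have s: "smooth \<psi>" "smooth \<phi>" "smooth (\<lambda>x. c * \<phi> x)"
    using \<psi>(1) \<phi>(1) by (auto intro: test_functions_smooth smooth_mult)
  define \<omega> where "\<omega> x = \<psi> x + c * \<phi> x" for x
  have t: "\<omega> \<in> test_functions \<Omega>" unfolding \<omega>_def[abs_def]
    by (intro test_functions_add test_functions_cmult \<psi>(1) \<phi>(1))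
  have g: "grad \<omega> x = grad \<psi> x + c *\<^sub>R grad \<phi> x" for x
    unfolding \<omega>_def[abs_def] using s by (simp add: grad_add grad_mult grad_const)
  have L: "(\<lambda>x. u x - \<psi> x) \<in> Lp p \<Omega>" "(\<lambda>x. v x - \<phi> x) \<in> Lp p \<Omega>"
    "(\<lambda>x. wg u x - grad \<psi> x) \<in> Lp p \<Omega>" "(\<lambda>x. wg v x - grad \<phi> x) \<in> Lp p \<Omega>"
    using W1pD[OF u] W1pD[OF v] smooth_Lp[OF s(1)] smooth_Lp[OF s(2)] by (auto intro: Lp_diff)
  have 1: "Np (\<lambda>x. (u x + c * v x) - \<omega> x) \<le> Q * (Np (\<lambda>x. u x - \<psi> x) + \<bar>c\<bar> powr p * Np (\<lambda>x. v x - \<phi> x))"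
  proof -
    have "(\<lambda>x. (u x + c * v x) - \<omega> x) = (\<lambda>x. (u x - \<psi> x) + c *\<^sub>R (v x - \<phi> x))"
      by (simp add: \<omega>_def algebra_simps fun_eq_iff)
    then show ?thesis
      using energy_add_le_half[OF weight_1 L(1) Lp_scale[OF L(2), of c]] by (simp only: energy_scale Q_def)
  qed
  have 2: "Np (\<lambda>x. wg (\<lambda>x. u x + c * v x) x - grad \<omega> x) \<le> Q * (Np (\<lambda>x. wg u x - grad \<psi> x) + \<bar>c\<bar> powr p * Np (\<lambda>x. wg v x - grad \<phi> x))"
  proof -
    have "Np (\<lambda>x. wg (\<lambda>x. u x + c * v x) x - grad \<omega> x) = Np (\<lambda>x. (wg u x - grad \<psi> x) + c *\<^sub>R (wg v x - grad \<phi> x))"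
    proof (rule energy_cong_Lp)
      show "AE x in M. wg (\<lambda>x. u x + c * v x) x - grad \<omega> x = (wg u x - grad \<psi> x) + c *\<^sub>R (wg v x - grad \<phi> x)"
        using W1p_lin(2)[OF u v, of c] by eventually_elim (simp add: g algebra_simps)
      show "(\<lambda>x. wg (\<lambda>x. u x + c * v x) x - grad \<omega> x) \<in> Lp p \<Omega>"
        by (rule Lp_diff[OF W1pD(3)[OF W1p_lin(1)[OF u v]] smooth_Lp(2)[OF test_functions_smooth[OF t]]])
      show "(\<lambda>x. (wg u x - grad \<psi> x) + c *\<^sub>R (wg v x - grad \<phi> x)) \<in> Lp p \<Omega>"
        by (rule Lp_add[OF L(3) Lp_scale[OF L(4)]])
    qed simp
    then show ?thesis
      using energy_add_le_half[OF weight_1 L(3) Lp_scale[OF L(4), of c]] by (simp only: energy_scale Q_def)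
  qed
  have "Np (\<lambda>x. (u x + c * v x) - \<omega> x) + Np (\<lambda>x. wg (\<lambda>x. u x + c * v x) x - grad \<omega> x)
     \<le> Q * (Np (\<lambda>x. u x - \<psi> x) + Np (\<lambda>x. wg u x - grad \<psi> x)) + Q * (\<bar>c\<bar> powr p * (Np (\<lambda>x. v x - \<phi> x) + Np (\<lambda>x. wg v x - grad \<phi> x)))"
    using 1 2 by (simp add: algebra_simps)
  also have "\<dots> < Q * (\<epsilon> / (2 * Q)) + Q * (c' * (\<epsilon> / (2 * Q * c')))"
  proof (rule add_less_le_mono)
    show "Q * (Np (\<lambda>x. u x - \<psi> x) + Np (\<lambda>x. wg u x - grad \<psi> x)) < Q * (\<epsilon> / (2 * Q))"
      using \<psi>(2) Q by (rule mult_strict_left_mono)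
    show "Q * (\<bar>c\<bar> powr p * (Np (\<lambda>x. v x - \<phi> x) + Np (\<lambda>x. wg v x - grad \<phi> x))) \<le> Q * (c' * (\<epsilon> / (2 * Q * c')))"
      using \<phi>(2) Q c' by (intro mult_left_mono mult_mono) (auto simp: energy_nonneg)
  qed
  also have "\<dots> = \<epsilon>" using Q c' by simp
  finally show "\<exists>\<psi>\<in>test_functions \<Omega>. Np (\<lambda>x. u x + c * v x - \<psi> x) + Np (\<lambda>x. wg (\<lambda>x. u x + c * v x) x - grad \<psi> x) < \<epsilon>"
    using t by blast
qed

lemma W1p_0_diff: "u \<in> W1p_0 p \<Omega> \<Longrightarrow> v \<in> W1p_0 p \<Omega> \<Longrightarrow> (\<lambda>x. u x - v x) \<in> W1p_0 p \<Omega>"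
  using W1p_0_lin[of u v "-1"] by simp

lemma W1p_0_add: "u \<in> W1p_0 p \<Omega> \<Longrightarrow> v \<in> W1p_0 p \<Omega> \<Longrightarrow> (\<lambda>x. u x + v x) \<in> W1p_0 p \<Omega>"
  using W1p_0_lin[of u v 1] by simp

lemma W1p_0_scale: "v \<in> W1p_0 p \<Omega> \<Longrightarrow> (\<lambda>x. c * v x) \<in> W1p_0 p \<Omega>"
  using W1p_0_lin[of "\<lambda>x. 0" v c] by simp

section \<open>Existence of a minimizer\<close>

lemma energy_approx_test_function:
  assumes w: "weight \<gamma>" and G: "G \<in> Lp p \<Omega>" and v: "v \<in> W1p_0 p \<Omega>" and e: "\<epsilon> > 0"
  obtains \<psi> where "\<psi> \<in> test_functions \<Omega>" "energy \<gamma> (\<lambda>x. G x + grad \<psi> x) \<le> energy \<gamma> (\<lambda>x. G x + wg v x) + \<epsilon>"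
proof -
  note v1 = W1p_0D[OF v]
  have L: "(\<lambda>x. G x + wg v x) \<in> Lp p \<Omega>" by (rule Lp_add[OF G W1pD(3)[OF v1]])
  obtain \<delta> where d: "\<delta> > 0" "\<And>G' H :: 'a \<Rightarrow> 'a. G' \<in> Lp p \<Omega> \<Longrightarrow> H \<in> Lp p \<Omega> \<Longrightarrow>
    energy \<gamma> G' \<le> energy \<gamma> (\<lambda>x. G x + wg v x) \<Longrightarrow> Np H \<le> \<delta> \<Longrightarrow> energy \<gamma> (\<lambda>x. G' x + H x) \<le> energy \<gamma> G' + \<epsilon>"
    using energy_perturb[OF w energy_nonneg[OF w] e, where ?'b = 'a] by blast
  obtain \<psi> where t: "\<psi> \<in> test_functions \<Omega>" "Np (\<lambda>x. v x - \<psi> x) + Np (\<lambda>x. wg v x - grad \<psi> x) < \<delta>"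
    using v d(1) unfolding W1p_0_iff by blast
  have "Np (\<lambda>x. grad \<psi> x - wg v x) = Np (\<lambda>x. wg v x - grad \<psi> x)"
    by (simp add: energy_def norm_minus_commute)
  also have "\<dots> \<le> \<delta>" using t(2) energy_nonneg[OF weight_1, of "\<lambda>x. v x - \<psi> x"] by simp
  finally have n: "Np (\<lambda>x. grad \<psi> x - wg v x) \<le> \<delta>" .
  have "(\<lambda>x. grad \<psi> x - wg v x) \<in> Lp p \<Omega>"
    by (rule Lp_diff[OF smooth_Lp(2)[OF test_functions_smooth[OF t(1)]] W1pD(3)[OF v1]])
  from d(2)[OF L this order.refl n] show thesis using that t(1) by (simp add: algebra_simps)
qed

text \<open>The direct method with strong convergence: the fields \<open>wg f + grad \<psi>\<close>
  are closed under midpoints, so a minimizing sequence is Cauchy in \<open>L^p\<close>. The Poincare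
  inequality makes the functions \<open>\<psi> k\<close> Cauchy too, and the limit of the gradients
  is the weak gradient of their limit \<open>v\<close>.\<close>

lemma minimizer_exists:
  assumes w: "weight \<gamma>" and f: "f \<in> W1p p \<Omega>"
  obtains u where "u \<in> W1p p \<Omega>" "(\<lambda>x. u x - f x) \<in> W1p_0 p \<Omega>"
    "\<And>\<phi>. \<phi> \<in> W1p_0 p \<Omega> \<Longrightarrow> energy \<gamma> (wg u) \<le> energy \<gamma> (\<lambda>x. wg u x + wg \<phi> x)"
proof -
  note fL = W1pD(3)[OF f]
  define K where "K = (\<lambda>\<psi> x. wg f x + grad \<psi> x) ` test_functions \<Omega>"
  have K: "K \<subseteq> Lp p \<Omega>"
    unfolding K_def using Lp_add[OF fL smooth_Lp(2)] test_functions_smooth by auto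
  have "(\<lambda>x. wg f x + grad (\<lambda>x. 0) x) \<in> K"
    unfolding K_def by (rule imageI[where f = "\<lambda>\<psi> x. wg f x + grad \<psi> x", OF test_functions_0])
  then have K0: "K \<noteq> {}" by auto
  have mid: "(\<lambda>x. (1/2) *\<^sub>R (G x + H x)) \<in> K" if GH: "G \<in> K" "H \<in> K" for G H
  proof -
    obtain \<psi> \<phi> where t: "\<psi> \<in> test_functions \<Omega>" "\<phi> \<in> test_functions \<Omega>"
      and e: "G = (\<lambda>x. wg f x + grad \<psi> x)" "H = (\<lambda>x. wg f x + grad \<phi> x)" using GH by (auto simp: K_def)
    have s: "smooth \<psi>" "smooth \<phi>" using t test_functions_smooth by auto
    have "(\<lambda>x. (1/2) *\<^sub>R (G x + H x)) = (\<lambda>x. wg f x + grad (\<lambda>x. (1/2) * (\<psi> x + \<phi> x)) x)"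
    proof
      fix x
      have "grad (\<lambda>x. (1/2) * (\<psi> x + \<phi> x)) x = (1/2) *\<^sub>R (grad \<psi> x + grad \<phi> x)"
        by (subst grad_mult) (use s in \<open>auto intro: smooth_add simp: grad_add grad_const\<close>)
      moreover have "(1/2) *\<^sub>R (wg f x + wg f x) = wg f x" by (simp flip: scaleR_2)
      ultimately show "(1/2) *\<^sub>R (G x + H x) = wg f x + grad (\<lambda>x. (1/2) * (\<psi> x + \<phi> x)) x"
        unfolding e by (simp add: algebra_simps)
    qed
    then show ?thesis unfolding K_def using test_functions_cmult[OF test_functions_add[OF t], of "1/2"] by auto
  qed
  obtain G m where G: "\<And>k::nat. G k \<in> K" "\<And>H. H \<in> K \<Longrightarrow> m \<le> energy \<gamma> H" "\<And>k. energy \<gamma> (G k) \<le> m + 1 / 2 ^ k"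
    "\<And>k j. k \<le> j \<Longrightarrow> Np (\<lambda>x. G k x - G j x) \<le> (1 / 2 ^ k) powr p"
  proof (rule minimizing_sequence[OF w K K0 mid])
    fix G m assume "\<And>k::nat. G k \<in> K" "\<And>H. H \<in> K \<Longrightarrow> m \<le> energy \<gamma> H" "\<And>k. energy \<gamma> (G k) \<le> m + 1 / 2 ^ k"
      "\<And>k j. k \<le> j \<Longrightarrow> Np (\<lambda>x. G k x - G j x) \<le> (1 / 2 ^ k) powr p"
    then show thesis by (rule that)
  qed
  have "\<forall>k. \<exists>\<psi>. \<psi> \<in> test_functions \<Omega> \<and> G k = (\<lambda>x. wg f x + grad \<psi> x)" using G(1) by (auto simp: K_def)
  then obtain \<psi> where t: "\<And>k. \<psi> k \<in> test_functions \<Omega>" "\<And>k. G k = (\<lambda>x. wg f x + grad (\<psi> k) x)" by metis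
  have s: "smooth (\<psi> k)" for k using t(1) test_functions_smooth by blast
  have gc: "Np (\<lambda>x. grad (\<psi> k) x - grad (\<psi> j) x) \<le> 1 * (1 / 2 ^ k) powr p" if "k \<le> j" for k j
    using G(4)[OF that] by (simp add: t(2))
  obtain W where W: "W \<in> Lp p \<Omega>" "(\<lambda>k. Np (\<lambda>x. grad (\<psi> k) x - W x)) \<longlonglongrightarrow> 0"
    using Lp_complete[of "\<lambda>k. grad (\<psi> k)" 1] smooth_Lp(2)[OF s] gc by auto
  obtain P where P: "P > 0" "\<And>\<psi>. \<psi> \<in> test_functions \<Omega> \<Longrightarrow> Np \<psi> \<le> P * Np (grad \<psi>)" using poincare by metis
  have pc: "Np (\<lambda>x. \<psi> k x - \<psi> j x) \<le> P * (1 / 2 ^ k) powr p" if "k \<le> j" for k j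
  proof -
    have "Np (\<lambda>x. \<psi> k x - \<psi> j x) \<le> P * Np (grad (\<lambda>x. \<psi> k x - \<psi> j x))"
      by (rule P(2)[OF test_functions_diff[OF t(1) t(1)]])
    also have "grad (\<lambda>x. \<psi> k x - \<psi> j x) = (\<lambda>x. grad (\<psi> k) x - grad (\<psi> j) x)"
      using grad_diff[OF s s] by auto
    also have "P * Np (\<lambda>x. grad (\<psi> k) x - grad (\<psi> j) x) \<le> P * (1 / 2 ^ k) powr p"
      using gc[OF that] P(1) by simp
    finally show ?thesis .
  qed
  obtain v where v: "v \<in> Lp p \<Omega>" "(\<lambda>k. Np (\<lambda>x. \<psi> k x - v x)) \<longlonglongrightarrow> 0"
    using Lp_complete[of "\<psi>" P] smooth_Lp(1)[OF s] pc P(1) by auto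
  have hv: "has_weak_gradient \<Omega> v W"
    by (rule has_weak_gradient_limit[OF has_weak_gradient_smooth[OF op s] smooth_Lp(1)[OF s] smooth_Lp(2)[OF s] v(1) W(1) v(2) W(2)])
  have v1: "v \<in> W1p p \<Omega>" using W1pI[OF v(1) hv W(1)] .
  have vW: "AE x in M. wg v x = W x" using weak_gradient_AE(2)[OF op hv] .
  have v0: "v \<in> W1p_0 p \<Omega>"
    unfolding W1p_0_iff
  proof (intro conjI v1 allI impI)
    fix \<epsilon> :: real assume "\<epsilon> > 0"
    moreover have "(\<lambda>k. Np (\<lambda>x. \<psi> k x - v x) + Np (\<lambda>x. grad (\<psi> k) x - W x)) \<longlonglongrightarrow> 0"
      using tendsto_add[OF v(2) W(2)] by simp
    ultimately have "\<forall>\<^sub>F k in sequentially. Np (\<lambda>x. \<psi> k x - v x) + Np (\<lambda>x. grad (\<psi> k) x - W x) < \<epsilon>"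
      by (rule order_tendstoD(2)[rotated])
    then obtain k where k: "Np (\<lambda>x. \<psi> k x - v x) + Np (\<lambda>x. grad (\<psi> k) x - W x) < \<epsilon>"
      by (meson eventually_sequentially order.refl)
    have "Np (\<lambda>x. wg v x - grad (\<psi> k) x) = Np (\<lambda>x. W x - grad (\<psi> k) x)"
    proof (rule energy_cong_Lp)
      show "AE x in M. wg v x - grad (\<psi> k) x = W x - grad (\<psi> k) x" using vW by eventually_elim simp
    qed (auto intro!: Lp_diff W1pD v1 W smooth_Lp s)
    also have "\<dots> = Np (\<lambda>x. grad (\<psi> k) x - W x)" by (simp add: energy_def norm_minus_commute)
    finally have 1: "Np (\<lambda>x. wg v x - grad (\<psi> k) x) = Np (\<lambda>x. grad (\<psi> k) x - W x)" .
    have "Np (\<lambda>x. v x - \<psi> k x) = Np (\<lambda>x. \<psi> k x - v x)" by (simp add: energy_def abs_minus_commute)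
    then show "\<exists>\<psi>\<in>test_functions \<Omega>. Np (\<lambda>x. v x - \<psi> x) + Np (\<lambda>x. wg v x - grad \<psi> x) < \<epsilon>"
      using k 1 t(1)[of k] by (intro bexI[of _ "\<psi> k"]) auto
  qed
  define u where "u x = f x + v x" for x
  have u1: "u \<in> W1p p \<Omega>" and uf: "AE x in M. wg u x = wg f x + wg v x"
    using W1p_lin[OF f v1, of 1] by (auto simp: u_def[abs_def])
  \<comment> \<open>The fields \<open>G k\<close> converge strongly, so
    \<open>energy_perturb\<close> bounds the energy of the limit by every number above
    \<open>m\<close>.\<close>
  have em: "energy \<gamma> (wg u) \<le> m"
  proof (rule field_le_epsilon)
    fix e :: real assume e: "e > 0"
    have m0: "0 \<le> m + 1" using G(3)[of 0] energy_nonneg[OF w, of "G 0"] by simp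
    obtain \<delta> where d: "\<delta> > 0" "\<And>G' H :: 'a \<Rightarrow> 'a. G' \<in> Lp p \<Omega> \<Longrightarrow> H \<in> Lp p \<Omega> \<Longrightarrow>
      energy \<gamma> G' \<le> m + 1 \<Longrightarrow> Np H \<le> \<delta> \<Longrightarrow> energy \<gamma> (\<lambda>x. G' x + H x) \<le> energy \<gamma> G' + e / 2"
      using energy_perturb[OF w m0 half_gt_zero[OF e], where ?'b = 'a] by blast
    have "\<forall>\<^sub>F k in sequentially. Np (\<lambda>x. grad (\<psi> k) x - W x) < \<delta>"
      using W(2) d(1) by (rule order_tendstoD(2))
    moreover have "(\<lambda>k. (1/2)^k :: real) \<longlonglongrightarrow> 0" by (intro LIMSEQ_power_zero) auto
    then have "\<forall>\<^sub>F k in sequentially. (1/2) ^ k < e / 2" using e by (intro order_tendstoD(2)) auto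
    ultimately have "\<forall>\<^sub>F k in sequentially. Np (\<lambda>x. grad (\<psi> k) x - W x) < \<delta> \<and> (1/2) ^ k < e / 2"
      by eventually_elim simp
    from eventually_happens'[OF sequentially_bot this]
    obtain k where k: "Np (\<lambda>x. grad (\<psi> k) x - W x) < \<delta>" "(1/2) ^ k < e / 2" by blast
    have "energy \<gamma> (wg u) = energy \<gamma> (\<lambda>x. G k x + (W x - grad (\<psi> k) x))"
    proof (rule energy_cong_Lp[OF w])
      show "AE x in M. wg u x = G k x + (W x - grad (\<psi> k) x)"
        using uf vW by eventually_elim (simp add: t(2))
      show "(\<lambda>x. G k x + (W x - grad (\<psi> k) x)) \<in> Lp p \<Omega>"
        using G(1) K by (auto intro!: Lp_add Lp_diff W smooth_Lp s)
    qed (rule W1pD[OF u1])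
    also have "\<dots> \<le> energy \<gamma> (G k) + e / 2"
    proof (rule d(2))
      show "G k \<in> Lp p \<Omega>" using G(1) K by auto
      show "(\<lambda>x. W x - grad (\<psi> k) x) \<in> Lp p \<Omega>" by (auto intro!: Lp_diff W smooth_Lp s)
      have "(1 / 2 ^ k :: real) \<le> 1" by simp
      then show "energy \<gamma> (G k) \<le> m + 1" using G(3)[of k] by linarith
      have "Np (\<lambda>x. W x - grad (\<psi> k) x) = Np (\<lambda>x. grad (\<psi> k) x - W x)" by (simp add: energy_def norm_minus_commute)
      then show "Np (\<lambda>x. W x - grad (\<psi> k) x) \<le> \<delta>" using k by simp
    qed
    also have "\<dots> \<le> m + e" using G(3)[of k] k(2) by (simp add: power_one_over)
    finally show "energy \<gamma> (wg u) \<le> m + e" .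
  qed
  show thesis
  proof (rule that[OF u1])
    show "(\<lambda>x. u x - f x) \<in> W1p_0 p \<Omega>" using v0 by (simp add: u_def)
    fix \<phi> assume \<phi>: "\<phi> \<in> W1p_0 p \<Omega>"
    have 0: "(\<lambda>x. v x + \<phi> x) \<in> W1p_0 p \<Omega>" by (rule W1p_0_add[OF v0 \<phi>])
    have ae: "AE x in M. wg (\<lambda>x. v x + \<phi> x) x = wg v x + wg \<phi> x"
      using W1p_lin(2)[OF v1 W1p_0D[OF \<phi>], of 1] by simp
    have "energy \<gamma> (\<lambda>x. wg f x + wg (\<lambda>x. v x + \<phi> x) x) = energy \<gamma> (\<lambda>x. wg u x + wg \<phi> x)"
    proof (rule energy_cong_Lp[OF w])
      show "AE x in M. wg f x + wg (\<lambda>x. v x + \<phi> x) x = wg u x + wg \<phi> x"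
        using ae uf by eventually_elim simp
    qed (auto intro!: Lp_add W1pD f W1p_0D \<phi> u1 0)
    \<comment> \<open>So far \<open>m\<close> bounds only competitors built from test functions;
      density extends the bound to \<open>W1p_0\<close>.\<close>
    moreover have "m \<le> energy \<gamma> (\<lambda>x. wg f x + wg (\<lambda>x. v x + \<phi> x) x)"
    proof (rule field_le_epsilon)
      fix e :: real assume "e > 0"
      then obtain \<psi> where "\<psi> \<in> test_functions \<Omega>"
        "energy \<gamma> (\<lambda>x. wg f x + grad \<psi> x) \<le> energy \<gamma> (\<lambda>x. wg f x + wg (\<lambda>x. v x + \<phi> x) x) + e"
        using energy_approx_test_function[OF w fL 0] by metis
      then show "m \<le> energy \<gamma> (\<lambda>x. wg f x + wg (\<lambda>x. v x + \<phi> x) x) + e"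
        using G(2)[of "\<lambda>x. wg f x + grad \<psi> x"] by (force simp: K_def)
    qed
    ultimately show "energy \<gamma> (wg u) \<le> energy \<gamma> (\<lambda>x. wg u x + wg \<phi> x)" using em by simp
  qed
qed

section \<open>The Euler-Lagrange equation and the minimal energy\<close>

lemma p_flux_bound:
  fixes \<xi> \<eta> a b :: "'b::real_inner"
  assumes "norm \<xi> \<le> norm a + norm b" "norm \<eta> \<le> norm a + norm b"
  shows "\<bar>(norm \<xi> powr (p - 2) *\<^sub>R \<xi>) \<bullet> \<eta>\<bar> \<le> 2 powr (p - 1) * (norm a powr p + norm b powr p)"
proof -
  define s where "s = norm a + norm b"
  have s: "s \<ge> 0" by (simp add: s_def)
  have "\<bar>(norm \<xi> powr (p - 2) *\<^sub>R \<xi>) \<bullet> \<eta>\<bar> \<le> norm \<xi> powr (p - 1) * norm \<eta>"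
    using Cauchy_Schwarz_ineq2[of "norm \<xi> powr (p - 2) *\<^sub>R \<xi>" \<eta>] by (simp only: norm_p_flux)
  also have "\<dots> \<le> s powr (p - 1) * s"
    using assms p s unfolding s_def by (intro mult_mono powr_mono2) auto
  also have "\<dots> = norm (norm a + norm b) powr p"
    using powr_add[of s "p - 1" 1] s p by (cases "s = 0") (auto simp: s_def)
  also have "\<dots> \<le> 2 powr (p - 1) * (norm a powr p + norm b powr p)"
    using norm_add_powr_le_half[OF p, of "norm a" "norm b"] by simp
  finally show ?thesis .
qed

lemma p_flux_integrable:
  fixes X Y A B :: "'a \<Rightarrow> 'b::euclidean_space"
  assumes w: "weight \<gamma>" and "X \<in> borel_measurable M" "Y \<in> borel_measurable M" and AB: "A \<in> Lp p \<Omega>" "B \<in> Lp p \<Omega>"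
    and le: "\<And>x. norm (X x) \<le> norm (A x) + norm (B x)" "\<And>x. norm (Y x) \<le> norm (A x) + norm (B x)"
  shows "integrable M (\<lambda>x. \<gamma> x * ((norm (X x) powr (p - 2) *\<^sub>R X x) \<bullet> Y x))"
proof -
  note [measurable] = assms(2,3)
  have [measurable]: "\<gamma> \<in> borel_measurable M" using w by (simp add: weight_def)
  show ?thesis
  proof (rule Bochner_Integration.integrable_bound)
    show "integrable M (\<lambda>x. 2 powr (p - 1) * (\<gamma> x * norm (A x) powr p + \<gamma> x * norm (B x) powr p))"
      by (intro integrable_mult_right Bochner_Integration.integrable_add energy_integrable w AB)
    show "AE x in M. norm (\<gamma> x * ((norm (X x) powr (p - 2) *\<^sub>R X x) \<bullet> Y x))
       \<le> norm (2 powr (p - 1) * (\<gamma> x * norm (A x) powr p + \<gamma> x * norm (B x) powr p))"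
    proof (rule AE_I2)
      fix x assume "x \<in> space M"
      then have g: "\<gamma> x \<ge> 0" using weight_pos[OF w] by (simp add: less_imp_le)
      have "norm (\<gamma> x * ((norm (X x) powr (p - 2) *\<^sub>R X x) \<bullet> Y x)) = \<gamma> x * \<bar>(norm (X x) powr (p - 2) *\<^sub>R X x) \<bullet> Y x\<bar>"
        using g by (simp add: abs_mult)
      also have "\<dots> \<le> \<gamma> x * (2 powr (p - 1) * (norm (A x) powr p + norm (B x) powr p))"
        by (intro mult_left_mono p_flux_bound le g)
      also have "\<dots> = 2 powr (p - 1) * (\<gamma> x * norm (A x) powr p + \<gamma> x * norm (B x) powr p)" by (simp add: algebra_simps)
      finally show "norm (\<gamma> x * ((norm (X x) powr (p - 2) *\<^sub>R X x) \<bullet> Y x))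
       \<le> norm (2 powr (p - 1) * (\<gamma> x * norm (A x) powr p + \<gamma> x * norm (B x) powr p))" by simp
    qed
  qed measurable
qed

text \<open>\<open>p_energy_form\<close> on vector fields instead of functions, so that a field may
  be replaced by one equal to it almost everywhere.\<close>

definition form :: "('a \<Rightarrow> real) \<Rightarrow> ('a \<Rightarrow> 'a) \<Rightarrow> ('a \<Rightarrow> 'a) \<Rightarrow> real" where
  "form \<gamma> G H = (LINT x|M. \<gamma> x * ((norm (G x) powr (p - 2) *\<^sub>R G x) \<bullet> H x))"

lemma form_integrable:
  assumes "weight \<gamma>" "G \<in> Lp p \<Omega>" "H \<in> Lp p \<Omega>"
  shows "integrable M (\<lambda>x. \<gamma> x * ((norm (G x) powr (p - 2) *\<^sub>R G x) \<bullet> H x))"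
  using assms LpD(1) by (intro p_flux_integrable[of _ _ _ G H]) auto

lemma form_cong:
  assumes "weight \<gamma>" "G \<in> Lp p \<Omega>" "H \<in> Lp p \<Omega>" "H' \<in> Lp p \<Omega>" "AE x in M. H x = H' x"
  shows "form \<gamma> G H = form \<gamma> G H'"
  unfolding form_def
  using form_integrable[OF assms(1-3)] form_integrable[OF assms(1,2,4)] assms(5)
  by (intro integral_cong_AE) auto

lemma form_diff:
  assumes "weight \<gamma>" "G \<in> Lp p \<Omega>" "H \<in> Lp p \<Omega>" "H' \<in> Lp p \<Omega>"
  shows "form \<gamma> G (\<lambda>x. H x - H' x) = form \<gamma> G H - form \<gamma> G H'"
  unfolding form_def using form_integrable[OF assms(1-3)] form_integrable[OF assms(1,2,4)]
  by (subst Bochner_Integration.integral_diff[symmetric]) (auto simp: inner_diff_right right_diff_distrib)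

lemma form_minus: "form \<gamma> G (\<lambda>x. - H x) = - form \<gamma> G H"
  unfolding form_def by (simp add: inner_minus_right)

lemma form_scale: "form \<gamma> G (\<lambda>x. c *\<^sub>R H x) = c * form \<gamma> G H"
proof -
  have "(\<lambda>x. \<gamma> x * ((norm (G x) powr (p - 2) *\<^sub>R G x) \<bullet> (c *\<^sub>R H x))) =
    (\<lambda>x. c * (\<gamma> x * ((norm (G x) powr (p - 2) *\<^sub>R G x) \<bullet> H x)))" by (simp add: fun_eq_iff)
  then show ?thesis unfolding form_def by (simp only: integral_mult_right_zero)
qed

lemma form_self:
  fixes G :: "'a \<Rightarrow> 'a"
  shows "form \<gamma> G G = energy \<gamma> G"
proof -
  have "(norm (G x) powr (p - 2) *\<^sub>R G x) \<bullet> G x = norm (G x) powr p" for x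
    using powr_add[of "norm (G x)" "p - 2" 2] by (cases "G x = 0") (auto simp: dot_square_norm)
  then show ?thesis by (simp add: form_def energy_def)
qed

text \<open>The pointwise supporting hyperplane, integrated. It serves both directions: the equation
  is derived from minimality, and minimality from the equation.\<close>

lemma energy_tangent:
  assumes w: "weight \<gamma>" and L: "G \<in> Lp p \<Omega>" "H \<in> Lp p \<Omega>"
  shows "energy \<gamma> G + p * form \<gamma> G (\<lambda>x. H x - G x) \<le> energy \<gamma> H"
proof -
  note i = energy_integrable[OF w L(1)] energy_integrable[OF w L(2)] form_integrable[OF w L(1) Lp_diff[OF L(2,1)]]
  have "energy \<gamma> G + p * form \<gamma> G (\<lambda>x. H x - G x) =
    (LINT x|M. \<gamma> x * norm (G x) powr p + p * (\<gamma> x * ((norm (G x) powr (p - 2) *\<^sub>R G x) \<bullet> (H x - G x))))"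
    unfolding energy_def form_def
    by (subst Bochner_Integration.integral_add[OF i(1) integrable_mult_right[OF i(3)]]) (simp only: integral_mult_right_zero)
  also have "\<dots> \<le> energy \<gamma> H"
    unfolding energy_def
  proof (rule integral_mono)
    show "integrable M (\<lambda>x. \<gamma> x * norm (G x) powr p + p * (\<gamma> x * ((norm (G x) powr (p - 2) *\<^sub>R G x) \<bullet> (H x - G x))))"
      using i by (intro Bochner_Integration.integrable_add integrable_mult_right)
    fix x assume "x \<in> space M"
    then have g: "\<gamma> x \<ge> 0" using weight_pos[OF w] by (simp add: less_imp_le)
    from mult_left_mono[OF norm_powr_tangent[OF p, of "G x" "H x"] g]
    show "\<gamma> x * norm (G x) powr p + p * (\<gamma> x * ((norm (G x) powr (p - 2) *\<^sub>R G x) \<bullet> (H x - G x))) \<le> \<gamma> x * norm (H x) powr p"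
      by (simp add: algebra_simps)
  qed (rule i)
  finally show ?thesis .
qed

text \<open>Instead of differentiating the energy, the supporting hyperplane at
  \<open>G + t *\<^sub>R H\<close> is compared with the minimality of \<open>G\<close>. This gives
  the sign of the form there, and dominated convergence lets \<open>t\<close> tend to 0.\<close>

lemma form_nonneg_of_minimal:
  assumes w: "weight \<gamma>" and L: "G \<in> Lp p \<Omega>" "H \<in> Lp p \<Omega>"
    and min: "\<And>t. t > 0 \<Longrightarrow> energy \<gamma> G \<le> energy \<gamma> (\<lambda>x. G x + t *\<^sub>R H x)"
  shows "0 \<le> form \<gamma> G H"
proof -
  define t where "t n = inverse (real (Suc n))" for n
  have t: "t n > 0" "t n \<le> 1" for n by (auto simp: t_def divide_simps)
  have t0: "t \<longlonglongrightarrow> 0" unfolding t_def by (rule LIMSEQ_inverse_real_of_nat)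
  define X where "X n x = G x + t n *\<^sub>R H x" for n x
  have XL: "X n \<in> Lp p \<Omega>" for n unfolding X_def[abs_def] by (intro Lp_add Lp_scale L)
  have [measurable]: "\<gamma> \<in> borel_measurable M" using w by (simp add: weight_def)
  note [measurable] = LpD(1)[OF XL] LpD(1)[OF L(1)] LpD(1)[OF L(2)]
  have nX: "norm (X n x) \<le> norm (G x) + norm (H x)" for n x
  proof -
    have "norm (t n *\<^sub>R H x) \<le> norm (H x)" using t[of n] by (simp add: mult_left_le_one_le)
    then show ?thesis unfolding X_def using norm_triangle_ineq[of "G x" "t n *\<^sub>R H x"] by linarith
  qed
  have pos: "0 \<le> form \<gamma> (X n) H" for n
  proof -
    have e: "(\<lambda>x. G x - X n x) = (\<lambda>x. (- t n) *\<^sub>R H x)" by (simp add: X_def fun_eq_iff)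
    have "energy \<gamma> (X n) + p * ((- t n) * form \<gamma> (X n) H) \<le> energy \<gamma> G"
      using energy_tangent[OF w XL[of n] L(1)] unfolding e form_scale .
    also have "energy \<gamma> G \<le> energy \<gamma> (X n)" unfolding X_def[abs_def] by (rule min[OF t(1)])
    finally have "0 \<le> (p * t n) * form \<gamma> (X n) H" by (simp add: algebra_simps)
    moreover have "0 < p * t n" using p t(1)[of n] by simp
    ultimately show ?thesis using mult_pos_neg[of "p * t n" "form \<gamma> (X n) H"] by linarith
  qed
  have "(\<lambda>n. form \<gamma> (X n) H) \<longlonglongrightarrow> form \<gamma> G H"
    unfolding form_def
  proof (rule integral_dominated_convergence)
    show "integrable M (\<lambda>x. 2 powr (p - 1) * (\<gamma> x * norm (G x) powr p + \<gamma> x * norm (H x) powr p))"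
      by (intro integrable_mult_right Bochner_Integration.integrable_add energy_integrable w L)
    show "AE x in M. (\<lambda>n. \<gamma> x * ((norm (X n x) powr (p - 2) *\<^sub>R X n x) \<bullet> H x)) \<longlonglongrightarrow>
      \<gamma> x * ((norm (G x) powr (p - 2) *\<^sub>R G x) \<bullet> H x)"
    proof (intro AE_I2 tendsto_mult tendsto_inner tendsto_p_flux p tendsto_const)
      fix x
      have "(\<lambda>n. G x + t n *\<^sub>R H x) \<longlonglongrightarrow> G x + 0 *\<^sub>R H x" by (intro tendsto_intros t0)
      then show "(\<lambda>n. X n x) \<longlonglongrightarrow> G x" by (simp add: X_def)
    qed
    show "AE x in M. norm (\<gamma> x * ((norm (X n x) powr (p - 2) *\<^sub>R X n x) \<bullet> H x))
       \<le> 2 powr (p - 1) * (\<gamma> x * norm (G x) powr p + \<gamma> x * norm (H x) powr p)" for n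
    proof (rule AE_I2)
      fix x assume "x \<in> space M"
      then have g: "\<gamma> x \<ge> 0" using weight_pos[OF w] by (simp add: less_imp_le)
      have "norm (\<gamma> x * ((norm (X n x) powr (p - 2) *\<^sub>R X n x) \<bullet> H x)) = \<gamma> x * \<bar>(norm (X n x) powr (p - 2) *\<^sub>R X n x) \<bullet> H x\<bar>"
        using g by (simp add: abs_mult)
      also have "\<dots> \<le> \<gamma> x * (2 powr (p - 1) * (norm (G x) powr p + norm (H x) powr p))"
        by (intro mult_left_mono p_flux_bound nX g) auto
      finally show "norm (\<gamma> x * ((norm (X n x) powr (p - 2) *\<^sub>R X n x) \<bullet> H x))
       \<le> 2 powr (p - 1) * (\<gamma> x * norm (G x) powr p + \<gamma> x * norm (H x) powr p)" by (simp add: algebra_simps)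
    qed
  qed measurable
  then show ?thesis by (rule LIMSEQ_le_const) (use pos in auto)
qed

lemma p_energy_form_eq: "p_energy_form p \<Omega> \<gamma> u g = form \<gamma> (wg u) (wg g)"
  by (simp add: p_energy_form_def form_def)

lemma weak_solution_exists:
  assumes w: "weight \<gamma>" and f: "f \<in> W1p p \<Omega>"
  obtains u where "weak_solution p \<Omega> \<gamma> f u"
proof -
  obtain u where u: "u \<in> W1p p \<Omega>" "(\<lambda>x. u x - f x) \<in> W1p_0 p \<Omega>"
    "\<And>\<phi>. \<phi> \<in> W1p_0 p \<Omega> \<Longrightarrow> energy \<gamma> (wg u) \<le> energy \<gamma> (\<lambda>x. wg u x + wg \<phi> x)"
    using minimizer_exists[OF w f] by blast
  note G = W1pD(3)[OF u(1)]
  have pos: "0 \<le> form \<gamma> (wg u) (wg \<phi>)" if \<phi>: "\<phi> \<in> W1p_0 p \<Omega>" for \<phi>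
  proof (rule form_nonneg_of_minimal[OF w G W1pD(3)[OF W1p_0D[OF \<phi>]]])
    fix t :: real assume "t > 0"
    have s: "(\<lambda>x. t * \<phi> x) \<in> W1p_0 p \<Omega>" by (rule W1p_0_scale[OF \<phi>])
    have ae: "AE x in M. wg (\<lambda>x. t * \<phi> x) x = t *\<^sub>R wg \<phi> x"
    proof -
      have "AE x in M. wg (\<lambda>x. 0) x = (0::'a)" using W1p_smooth(2)[of "\<lambda>x. 0"] by (simp add: grad_const)
      moreover have "AE x in M. wg (\<lambda>x. 0 + t * \<phi> x) x = wg (\<lambda>x. 0) x + t *\<^sub>R wg \<phi> x"
        by (rule W1p_lin(2)[OF W1p_0D[OF zero_W1p_0] W1p_0D[OF \<phi>]])
      ultimately show ?thesis by eventually_elim simp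
    qed
    have "energy \<gamma> (wg u) \<le> energy \<gamma> (\<lambda>x. wg u x + wg (\<lambda>x. t * \<phi> x) x)" by (rule u(3)[OF s])
    also have "\<dots> = energy \<gamma> (\<lambda>x. wg u x + t *\<^sub>R wg \<phi> x)"
    proof (rule energy_cong_Lp[OF w])
      show "AE x in M. wg u x + wg (\<lambda>x. t * \<phi> x) x = wg u x + t *\<^sub>R wg \<phi> x" using ae by eventually_elim simp
    qed (auto intro!: Lp_add Lp_scale G W1pD W1p_0D \<phi> s)
    finally show "energy \<gamma> (wg u) \<le> energy \<gamma> (\<lambda>x. wg u x + t *\<^sub>R wg \<phi> x)" .
  qed
  have "form \<gamma> (wg u) (wg \<phi>) = 0" if \<phi>: "\<phi> \<in> W1p_0 p \<Omega>" for \<phi>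
  proof -
    \<comment> \<open>Testing with \<open>- \<phi>\<close> as well turns the inequality into an
      equation.\<close>
    have m: "(\<lambda>x. 0 - \<phi> x) \<in> W1p_0 p \<Omega>" by (rule W1p_0_diff[OF zero_W1p_0 \<phi>])
    have ae: "AE x in M. wg (\<lambda>x. 0 - \<phi> x) x = - wg \<phi> x"
    proof -
      have "AE x in M. wg (\<lambda>x. 0) x = (0::'a)" using W1p_smooth(2)[of "\<lambda>x. 0"] by (simp add: grad_const)
      moreover have "AE x in M. wg (\<lambda>x. 0 - \<phi> x) x = wg (\<lambda>x. 0) x - wg \<phi> x"
        by (rule W1p_diff(2)[OF W1p_0D[OF zero_W1p_0] W1p_0D[OF \<phi>]])
      ultimately show ?thesis by eventually_elim simp
    qed
    have "(\<lambda>x. - wg \<phi> x) \<in> Lp p \<Omega>" using Lp_scale[OF W1pD(3)[OF W1p_0D[OF \<phi>]], of "-1"] by simp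
    then have "form \<gamma> (wg u) (wg (\<lambda>x. 0 - \<phi> x)) = - form \<gamma> (wg u) (wg \<phi>)"
      using form_cong[OF w G W1pD(3)[OF W1p_0D[OF m]] _ ae] by (simp add: form_minus)
    then show ?thesis using pos[OF \<phi>] pos[OF m] by simp
  qed
  then have "weak_solution p \<Omega> \<gamma> f u" using u by (simp add: weak_solution_def p_energy_form_eq)
  then show thesis by (rule that)
qed

text \<open>The infimum over smooth competitors, as a relation. Once
  \<open>dirichlet_min_DN_map\<close> is proved, weak gradients disappear from the argument.\<close>

definition dirichlet_min :: "('a \<Rightarrow> real) \<Rightarrow> ('a \<Rightarrow> real) \<Rightarrow> real \<Rightarrow> bool" where
  "dirichlet_min \<gamma> f m \<longleftrightarrow>
     (\<forall>\<psi>\<in>test_functions \<Omega>. m \<le> energy \<gamma> (\<lambda>x. grad f x + grad \<psi> x)) \<and>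
     (\<forall>\<epsilon>>0. \<exists>\<psi>\<in>test_functions \<Omega>. energy \<gamma> (\<lambda>x. grad f x + grad \<psi> x) \<le> m + \<epsilon>)"

text \<open>Testing the equation with \<open>u - g\<close> turns the value of the map into the
  energy of \<open>u\<close>. By convexity a weak solution has least energy, and by density test
  functions approach it. The representative \<open>g\<close> picked from the class differs from
  \<open>f\<close> by an element of \<open>W1p_0\<close>, so the competitors are those of
  \<open>f\<close>.\<close>

lemma dirichlet_min_DN_map:
  assumes w: "weight \<gamma>" and s: "smooth f"
  defines "F \<equiv> trace_rel p \<Omega> `` {f}"
  shows "dirichlet_min \<gamma> f (DN_map p \<Omega> \<gamma> F F)"
proof -
  note f = W1p_smooth(1)[OF s]
  have "(f, f) \<in> trace_rel p \<Omega>" using f by (simp add: trace_rel_def)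
  then have fF: "f \<in> F" by (simp add: F_def)
  have FT: "F \<in> trace_space p \<Omega>" unfolding F_def trace_space_def using f by (rule quotientI)
  define g where "g = (SOME f. f \<in> F)"
  have "g \<in> F" unfolding g_def by (rule someI[of "\<lambda>f. f \<in> F", OF fF])
  then have g: "g \<in> W1p p \<Omega>" "(\<lambda>x. f x - g x) \<in> W1p_0 p \<Omega>" by (auto simp: F_def trace_rel_def)
  define u where "u = dirichlet_solution p \<Omega> \<gamma> g"
  have "\<exists>u. weak_solution p \<Omega> \<gamma> g u" using weak_solution_exists[OF w g(1)] by blast
  then have "weak_solution p \<Omega> \<gamma> g u" unfolding u_def dirichlet_solution_def by (rule someI_ex)
  then have u: "u \<in> W1p p \<Omega>" "(\<lambda>x. u x - g x) \<in> W1p_0 p \<Omega>" "\<And>\<phi>. \<phi> \<in> W1p_0 p \<Omega> \<Longrightarrow> form \<gamma> (wg u) (wg \<phi>) = 0"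
    by (auto simp: weak_solution_def p_energy_form_eq)
  note G = W1pD(3)[OF u(1)]
  have "DN_map p \<Omega> \<gamma> F F = form \<gamma> (wg u) (wg g)"
    using FT by (simp add: DN_map_def p_energy_form_eq u_def g_def)
  also have "\<dots> = energy \<gamma> (wg u)"
  proof -
    have "0 = form \<gamma> (wg u) (wg (\<lambda>x. u x - g x))" using u(3)[OF u(2)] by simp
    also have "\<dots> = form \<gamma> (wg u) (\<lambda>x. wg u x - wg g x)"
      using W1p_diff[OF u(1) g(1)] by (intro form_cong w G Lp_diff W1pD(3) g(1)) auto
    also have "\<dots> = form \<gamma> (wg u) (wg u) - form \<gamma> (wg u) (wg g)" by (intro form_diff w G W1pD(3) g(1))
    finally show ?thesis by (simp add: form_self)
  qed
  finally have DN: "DN_map p \<Omega> \<gamma> F F = energy \<gamma> (wg u)" .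
  have uf: "(\<lambda>x. u x - f x) \<in> W1p_0 p \<Omega>"
    using W1p_0_diff[OF u(2) g(2)] by simp
  have eqf: "energy \<gamma> (\<lambda>x. wg f x + grad \<psi> x) = energy \<gamma> (\<lambda>x. grad f x + grad \<psi> x)"
    if "\<psi> \<in> test_functions \<Omega>" for \<psi>
  proof (rule energy_cong_Lp[OF w])
    show "AE x in M. wg f x + grad \<psi> x = grad f x + grad \<psi> x" using W1p_smooth(2)[OF s] by eventually_elim simp
  qed (use test_functions_smooth[OF that] in \<open>auto intro!: Lp_add smooth_Lp s W1pD f\<close>)
  show ?thesis unfolding dirichlet_min_def DN
  proof (intro conjI ballI allI impI)
    fix \<psi> assume t: "\<psi> \<in> test_functions \<Omega>"
    note ts = test_functions_smooth[OF t]
    have \<phi>: "(\<lambda>x. \<psi> x - (u x - f x)) \<in> W1p_0 p \<Omega>" by (rule W1p_0_diff[OF test_functions_W1p_0[OF t] uf])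
    have L: "(\<lambda>x. grad f x + grad \<psi> x) \<in> Lp p \<Omega>" by (intro Lp_add smooth_Lp s ts)
    have ae: "AE x in M. wg (\<lambda>x. \<psi> x - (u x - f x)) x = (grad f x + grad \<psi> x) - wg u x"
      using W1p_diff(2)[OF W1p_smooth(1)[OF ts] W1p_0D[OF uf]] W1p_diff(2)[OF u(1) f] W1p_smooth(2)[OF ts] W1p_smooth(2)[OF s]
      by eventually_elim simp
    have "form \<gamma> (wg u) (\<lambda>x. (grad f x + grad \<psi> x) - wg u x) = form \<gamma> (wg u) (wg (\<lambda>x. \<psi> x - (u x - f x)))"
      using ae by (intro form_cong[symmetric] w G W1pD(3) W1p_0D \<phi> Lp_diff L) auto
    then have "form \<gamma> (wg u) (\<lambda>x. (grad f x + grad \<psi> x) - wg u x) = 0" using u(3)[OF \<phi>] by simp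
    then show "energy \<gamma> (wg u) \<le> energy \<gamma> (\<lambda>x. grad f x + grad \<psi> x)"
      using energy_tangent[OF w G L] by simp
  next
    fix \<epsilon> :: real assume "\<epsilon> > 0"
    then obtain \<psi> where t: "\<psi> \<in> test_functions \<Omega>"
      "energy \<gamma> (\<lambda>x. wg f x + grad \<psi> x) \<le> energy \<gamma> (\<lambda>x. wg f x + wg (\<lambda>x. u x - f x) x) + \<epsilon>"
      using energy_approx_test_function[OF w W1pD(3)[OF f] uf] by metis
    have "energy \<gamma> (\<lambda>x. wg f x + wg (\<lambda>x. u x - f x) x) = energy \<gamma> (wg u)"
    proof (rule energy_cong_Lp[OF w])
      show "AE x in M. wg f x + wg (\<lambda>x. u x - f x) x = wg u x"
        using W1p_diff(2)[OF u(1) f] by eventually_elim simp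
    qed (auto intro!: Lp_add W1pD f W1p_0D uf u(1))
    then show "\<exists>\<psi>\<in>test_functions \<Omega>. energy \<gamma> (\<lambda>x. grad f x + grad \<psi> x) \<le> energy \<gamma> (wg u) + \<epsilon>"
      using t eqf[OF t(1)] by (intro bexI[of _ \<psi>]) auto
  qed
qed

section \<open>Truncation and oscillation\<close>

lemma energy_mono:
  assumes "weight \<gamma>" "weight \<gamma>'" "G \<in> Lp p \<Omega>" "H \<in> Lp p \<Omega>"
    and "\<And>x. x \<in> \<Omega> \<Longrightarrow> \<gamma> x * norm (G x) powr p \<le> \<gamma>' x * norm (H x) powr p"
  shows "energy \<gamma> G \<le> energy \<gamma>' H"
  unfolding energy_def using assms by (intro integral_mono energy_integrable) auto

lemma energy_mono_norm:
  assumes "weight \<gamma>" "G \<in> Lp p \<Omega>" "H \<in> Lp p \<Omega>" "\<And>x. x \<in> \<Omega> \<Longrightarrow> norm (G x) \<le> norm (H x)"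
  shows "energy \<gamma> G \<le> energy \<gamma> H"
  using assms p weight_pos[OF assms(1)]
  by (intro energy_mono mult_left_mono powr_mono2) (auto simp: less_imp_le)

text \<open>Minimizers for \<open>\<gamma>1\<close> are truncated and cut off by \<open>\<eta>\<close>, and the result is used as a
  competitor for \<open>\<gamma>2\<close>. The factor \<open>1 / (1 + d)\<close> gained on the support of \<open>\<eta>\<close> beats the
  factor \<open>1 + d/2\<close> lost by the cut-off, so the common minimum is bounded independently of
  the boundary datum.\<close>

lemma bounded_extensions:
  assumes w1: "weight \<gamma>1" and w2: "weight \<gamma>2" and d: "d > 0"
    and \<eta>: "smooth \<eta>" "\<And>x. \<bar>\<eta> x\<bar> \<le> 1" "\<And>x. x \<notin> K \<Longrightarrow> \<eta> x = 0" "\<And>x. x \<notin> K \<Longrightarrow> grad \<eta> x = 0"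
    and ratio: "\<And>x. x \<in> \<Omega> \<Longrightarrow> x \<in> K \<Longrightarrow> (1 + d) * \<gamma>2 x \<le> \<gamma>1 x"
  obtains C where "\<And>f m. smooth f \<Longrightarrow> (\<And>x. \<bar>f x\<bar> \<le> 1) \<Longrightarrow> (\<And>x. \<eta> x * f x = f x) \<Longrightarrow>
    dirichlet_min \<gamma>1 f m \<Longrightarrow> dirichlet_min \<gamma>2 f m \<Longrightarrow>
    \<exists>v. smooth v \<and> (\<lambda>x. v x - f x) \<in> test_functions \<Omega> \<and> (\<forall>x. \<bar>v x\<bar> \<le> 3) \<and> Np (grad v) \<le> C"
proof -
  obtain T T' :: "real \<Rightarrow> real" where T: "smooth T" "\<And>t. DERIV T t :> T' t"
    "\<And>t. \<bar>T' t\<bar> \<le> 1" "\<And>t. \<bar>t\<bar> \<le> 1 \<Longrightarrow> T t = t" "\<And>t. \<bar>T t\<bar> \<le> 3"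
    using smooth_truncation_exists by metis
  obtain l where l: "0 < l" "l < 1" "(1 - l) powr (1 - p) = 1 + d / 2"
    using exists_powr_factor[OF p, of "d / 2"] d by auto
  obtain c0 where c0: "c0 > 0" "\<And>G :: 'a \<Rightarrow> 'a. G \<in> Lp p \<Omega> \<Longrightarrow> c0 * Np G \<le> energy \<gamma>1 G"
    using energy_bounds[OF w1] by metis
  have g\<eta>: "grad \<eta> \<in> Lp p \<Omega>" by (rule smooth_Lp(2)[OF \<eta>(1)])
  \<comment> \<open>Cost of the cut-off: since the truncation bounds \<open>v\<close> by 3, the
    energy of \<open>v x *\<^sub>R grad \<eta> x\<close> has a bound independent of
    \<open>f\<close>.\<close>
  define C0 where "C0 = l powr (1 - p) * energy \<gamma>1 (\<lambda>x. 3 *\<^sub>R grad \<eta> x)"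
  \<comment> \<open>Solves \<open>(1 + d) * m \<le> (1 + d / 2) * (m + 1) + C0\<close> for
    \<open>m\<close>.\<close>
  define C1 where "C1 = (2 / d) * (1 + d / 2 + C0)"
  have main: "\<exists>v. smooth v \<and> (\<lambda>x. v x - f x) \<in> test_functions \<Omega> \<and> (\<forall>x. \<bar>v x\<bar> \<le> 3) \<and> Np (grad v) \<le> (C1 + 1) / c0"
    if f: "smooth f" "\<And>x. \<bar>f x\<bar> \<le> 1" "\<And>x. \<eta> x * f x = f x"
      and m1: "dirichlet_min \<gamma>1 f m" and m2: "dirichlet_min \<gamma>2 f m" for f m
  proof -
    obtain \<psi> where \<psi>: "\<psi> \<in> test_functions \<Omega>" "energy \<gamma>1 (\<lambda>x. grad f x + grad \<psi> x) \<le> m + 1"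
      using m1 unfolding dirichlet_min_def by (metis zero_less_one)
    obtain L where L: "smooth \<psi>" "compact L" "L \<subseteq> \<Omega>" "\<And>x. x \<notin> L \<Longrightarrow> \<psi> x = 0"
      using test_functionsE[OF \<psi>(1)] by metis
    define u where "u x = f x + \<psi> x" for x
    have us: "smooth u" unfolding u_def[abs_def] by (intro smooth_add f L)
    have "grad u = (\<lambda>x. grad f x + grad \<psi> x)"
      unfolding u_def[abs_def] using grad_add[OF f(1) L(1)] by auto
    then have eu: "energy \<gamma>1 (grad u) \<le> m + 1" using \<psi>(2) by simp
    define v where "v x = T (u x)" for x
    have vs: "smooth v" unfolding v_def[abs_def] by (rule smooth_compose[OF T(1) us])
    have gv: "grad v x = T' (u x) *\<^sub>R grad u x" for x
      unfolding v_def[abs_def] by (rule grad_compose[OF T(2) us])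
    have ngv: "norm (grad v x) \<le> norm (grad u x)" for x
      using T(3)[of "u x"] by (simp add: gv mult_left_le_one_le)
    have v3: "\<bar>v x\<bar> \<le> 3" for x by (simp add: v_def T)
    \<comment> \<open>Outside \<open>L\<close> the near-minimizer equals \<open>f\<close>, whose
      values lie where \<open>T\<close> is the identity; truncation preserves the boundary
      values.\<close>
    have v0: "v x = f x" if "x \<notin> L" for x using that f(2)[of x] T(4) L(4) by (simp add: v_def u_def)
    have vt: "(\<lambda>x. v x - f x) \<in> test_functions \<Omega>"
      by (rule test_functionsI[OF smooth_diff[OF vs f(1)] L(2,3)]) (simp add: v0)
    define z where "z x = \<eta> x * v x" for x
    have zs: "smooth z" unfolding z_def[abs_def] by (intro smooth_mult \<eta> vs)
    have gz: "grad z x = \<eta> x *\<^sub>R grad v x + v x *\<^sub>R grad \<eta> x" for x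
      unfolding z_def[abs_def] by (rule grad_mult[OF \<eta>(1) vs])
    \<comment> \<open>By \<open>\<eta> * f = f\<close> the cut-off preserves the boundary values
      too.\<close>
    have zt: "(\<lambda>x. z x - f x) \<in> test_functions \<Omega>"
      by (rule test_functionsI[OF smooth_diff[OF zs f(1)] L(2,3)]) (simp add: z_def v0 f(3))
    have ev: "energy \<gamma>1 (grad v) \<le> m + 1"
      using energy_mono_norm[OF w1 smooth_Lp(2)[OF vs] smooth_Lp(2)[OF us] ngv] eu by simp
    have La: "(\<lambda>x. \<eta> x *\<^sub>R grad v x) \<in> Lp p \<Omega>" "(\<lambda>x. v x *\<^sub>R grad \<eta> x) \<in> Lp p \<Omega>"
      by (intro continuous_imp_Lp continuous_on_scaleR smooth_continuous_on continuous_on_grad \<eta> vs)+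
    have ea: "energy \<gamma>1 (\<lambda>x. \<eta> x *\<^sub>R grad v x) \<le> energy \<gamma>1 (grad v)"
      using \<eta>(2) by (intro energy_mono_norm w1 La smooth_Lp vs) (simp add: mult_left_le_one_le)
    have eb: "energy \<gamma>1 (\<lambda>x. v x *\<^sub>R grad \<eta> x) \<le> energy \<gamma>1 (\<lambda>x. 3 *\<^sub>R grad \<eta> x)"
      using v3 by (intro energy_mono_norm w1 La Lp_scale g\<eta>) (simp add: mult_right_mono)
    have "energy \<gamma>1 (grad z) \<le> (1 + d / 2) * energy \<gamma>1 (\<lambda>x. \<eta> x *\<^sub>R grad v x) + l powr (1 - p) * energy \<gamma>1 (\<lambda>x. v x *\<^sub>R grad \<eta> x)"
      using energy_add_le[OF w1 La l(1,2)] unfolding l(3) gz[symmetric] .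
    also have "\<dots> \<le> (1 + d / 2) * (m + 1) + C0"
      unfolding C0_def using ea eb ev d by (intro add_mono mult_left_mono) auto
    finally have ez: "energy \<gamma>1 (grad z) \<le> (1 + d / 2) * (m + 1) + C0" .
    \<comment> \<open>Putting \<open>1 + d\<close> inside the norm as
      \<open>(1 + d) powr (1 / p)\<close> makes the ratio of the coefficients a pointwise
      comparison; off \<open>K\<close> the gradient of \<open>z\<close> is 0.\<close>
    have "energy \<gamma>2 (\<lambda>x. (1 + d) powr (1 / p) *\<^sub>R grad z x) \<le> energy \<gamma>1 (grad z)"
    proof (rule energy_mono[OF w2 w1 Lp_scale[OF smooth_Lp(2)[OF zs]] smooth_Lp(2)[OF zs]])
      fix x assume x: "x \<in> \<Omega>"
      have e: "norm ((1 + d) powr (1 / p) *\<^sub>R grad z x) powr p = (1 + d) * norm (grad z x) powr p"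
        using p d by (simp add: powr_mult powr_powr)
      show "\<gamma>2 x * norm ((1 + d) powr (1 / p) *\<^sub>R grad z x) powr p \<le> \<gamma>1 x * norm (grad z x) powr p"
      proof (cases "x \<in> K")
        case True
        show ?thesis unfolding e
          using mult_right_mono[OF ratio[OF x True], of "norm (grad z x) powr p"] by (simp add: mult.assoc mult.left_commute)
      next
        case False
        then show ?thesis using \<eta> p by (simp add: gz)
      qed
    qed
    then have "(1 + d) * energy \<gamma>2 (grad z) \<le> energy \<gamma>1 (grad z)"
      unfolding energy_scale using p d by (simp add: powr_powr)
    moreover have "m \<le> energy \<gamma>2 (grad z)"
    proof -
      have "grad f x + grad (\<lambda>x. z x - f x) x = grad z x" for x using grad_diff[OF zs f(1)] by simp
      then show ?thesis using m2 zt unfolding dirichlet_min_def by fastforce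
    qed
    then have "(1 + d) * m \<le> (1 + d) * energy \<gamma>2 (grad z)"
      using d by (intro mult_left_mono) auto
    ultimately have "(1 + d) * m \<le> (1 + d / 2) * (m + 1) + C0"
      using ez by (meson order.trans)
    then have "m \<le> C1" using d by (simp add: C1_def field_simps)
    then have "c0 * Np (grad v) \<le> C1 + 1" using c0(2)[OF smooth_Lp(2)[OF vs]] ev by simp
    then have "Np (grad v) \<le> (C1 + 1) / c0" using c0(1) by (simp add: field_simps)
    then show ?thesis using vs vt v3 by blast
  qed
  show thesis by (rule that) (rule main)
qed

section \<open>Oscillating boundary data\<close>

lemma continuous_integrable:
  fixes F :: "'a \<Rightarrow> 'b::euclidean_space"
  shows "continuous_on UNIV F \<Longrightarrow> integrable M F"
  using Lp_integrable[OF continuous_imp_Lp] by blast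

lemma abs_integral_le:
  fixes F G :: "'a \<Rightarrow> real"
  assumes "continuous_on UNIV F" "continuous_on UNIV G" "\<And>x. x \<in> \<Omega> \<Longrightarrow> \<bar>F x\<bar> \<le> G x"
  shows "\<bar>LINT x|M. F x\<bar> \<le> (LINT x|M. G x)"
proof -
  have "\<bar>LINT x|M. F x\<bar> \<le> (LINT x|M. \<bar>F x\<bar>)" using integral_norm_bound[of M F] by simp
  also have "\<dots> \<le> (LINT x|M. G x)"
    using assms by (intro integral_mono continuous_integrable continuous_on_rabs) auto
  finally show ?thesis .
qed

text \<open>Integration by parts in the direction \<open>t\<close> of the oscillation gains a factor \<open>1 / N\<close>.\<close>

lemma oscillating_integral_bound:
  assumes q: "q \<in> test_functions \<Omega>" and t: "norm t = 1"
  obtains B where "\<And>v N \<theta>. smooth v \<Longrightarrow> (\<And>x. \<bar>v x\<bar> \<le> 3) \<Longrightarrow> Np (grad v) \<le> C \<Longrightarrow> N > 0 \<Longrightarrow>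
    \<bar>LINT x|M. q x * v x * sin (N * (x \<bullet> t) + \<theta>)\<bar> \<le> B / N"
proof -
  obtain K where K: "smooth q" "compact K" "K \<subseteq> \<Omega>" "\<And>x. x \<notin> K \<Longrightarrow> q x = 0" "\<And>x. x \<notin> K \<Longrightarrow> grad q x = 0"
    using test_functionsE[OF q] by metis
  note cq = smooth_continuous_on[OF K(1)] continuous_on_grad[OF K(1)]
  obtain Q1 where Q1: "Q1 \<ge> 0" "\<And>x. norm (q x) \<le> Q1" using bounded_compact_support[OF cq(1) K(2,4)] by blast
  obtain Q2 where Q2: "Q2 \<ge> 0" "\<And>x. norm (grad q x) \<le> Q2" using bounded_compact_support[OF cq(2) K(2,5)] by blast
  \<comment> \<open>The derivative falls either on \<open>v\<close>, with \<open>q\<close> bounded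
    by \<open>Q1\<close>, or on \<open>q\<close>, with \<open>v\<close> bounded by 3; the
    \<open>L^1\<close> norm of \<open>grad v\<close> is at most
    \<open>measure M \<Omega> + C\<close>.\<close>
  define B where "B = Q1 * (measure M \<Omega> + C) + 3 * Q2 * measure M \<Omega>"
  show thesis
  proof (rule that)
    fix v :: "'a \<Rightarrow> real" and N \<theta> :: real
    assume v: "smooth v" "\<And>x. \<bar>v x\<bar> \<le> 3" "Np (grad v) \<le> C" and N: "N > 0"
    note cv = smooth_continuous_on[OF v(1)] continuous_on_grad[OF v(1)]
    define c where "c x = cos (N * (x \<bullet> t) + \<theta>)" for x :: 'a
    define s where "s x = sin (N * (x \<bullet> t) + \<theta>)" for x :: 'a
    have ls: "smooth (\<lambda>x. N * (x \<bullet> t) + \<theta>)" by (intro smooth_add smooth_mult) auto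
    have lg: "grad (\<lambda>x. N * (x \<bullet> t) + \<theta>) x = N *\<^sub>R t" for x
      by (simp add: grad_add grad_mult grad_inner grad_const smooth_mult)
    have cs: "smooth c" "smooth s" unfolding c_def[abs_def] s_def[abs_def]
      using ls by (auto intro: smooth_compose smooth_sin_cos)
    have gc: "grad c x \<bullet> t = - N * s x" for x
    proof -
      have "grad c x = (- s x) *\<^sub>R (N *\<^sub>R t)"
        unfolding c_def[abs_def] s_def lg[of x, symmetric] by (rule grad_compose[OF DERIV_cos ls])
      then show ?thesis using t by (simp add: dot_square_norm)
    qed
    define F where "F x = q x * v x" for x
    have Fs: "smooth F" unfolding F_def[abs_def] by (intro smooth_mult K v)
    have gF: "grad F x \<bullet> t = q x * (grad v x \<bullet> t) + v x * (grad q x \<bullet> t)" for x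
      unfolding F_def[abs_def] by (simp add: grad_mult[OF K(1) v(1)] inner_add_left)
    have "0 = (LINT x|M. grad (\<lambda>x. F x * c x) x \<bullet> t)"
      unfolding F_def
      by (rule integral_grad_test_function[OF op, symmetric]) (intro test_functions_mult q v cs)
    also have "\<dots> = (LINT x|M. c x * (grad F x \<bullet> t) - N * (F x * s x))"
      by (simp add: grad_mult[OF Fs cs(1)] inner_add_left gc algebra_simps)
    also have "\<dots> = (LINT x|M. c x * (grad F x \<bullet> t)) - N * (LINT x|M. F x * s x)"
    proof -
      have "integrable M (\<lambda>x. c x * (grad F x \<bullet> t))" "integrable M (\<lambda>x. N * (F x * s x))"
        by (intro continuous_integrable smooth_continuous_on smooth_mult cs smooth_grad Fs smooth_const)+
      then show ?thesis by simp
    qed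
    finally have e: "N * (LINT x|M. F x * s x) = (LINT x|M. c x * (grad F x \<bullet> t))" by simp
    have "\<bar>LINT x|M. c x * (grad F x \<bullet> t)\<bar> \<le> (LINT x|M. Q1 * norm (grad v x) + 3 * Q2)"
    proof (rule abs_integral_le)
      show "continuous_on UNIV (\<lambda>x. c x * (grad F x \<bullet> t))"
        by (intro smooth_continuous_on smooth_mult cs smooth_grad Fs)
      show "continuous_on UNIV (\<lambda>x. Q1 * norm (grad v x) + 3 * Q2)"
        by (intro continuous_intros cv)
      fix x
      have a: "\<bar>grad w x \<bullet> t\<bar> \<le> norm (grad w x)" for w
        using Cauchy_Schwarz_ineq2[of "grad w x" t] t by simp
      have "\<bar>c x * (grad F x \<bullet> t)\<bar> \<le> 1 * \<bar>grad F x \<bullet> t\<bar>"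
        unfolding abs_mult by (intro mult_right_mono) (auto simp: c_def)
      also have "\<dots> \<le> \<bar>q x\<bar> * \<bar>grad v x \<bullet> t\<bar> + \<bar>v x\<bar> * \<bar>grad q x \<bullet> t\<bar>"
        unfolding gF abs_mult[symmetric] by simp
      also have "\<dots> \<le> Q1 * norm (grad v x) + 3 * Q2"
        using Q1 Q2 v(2) a order.trans[OF a Q2(2)] by (intro add_mono mult_mono) auto
      finally show "\<bar>c x * (grad F x \<bullet> t)\<bar> \<le> Q1 * norm (grad v x) + 3 * Q2" .
    qed
    also have "\<dots> = Q1 * (LINT x|M. norm (grad v x)) + 3 * Q2 * measure M \<Omega>"
    proof -
      have "integrable M (\<lambda>x. norm (grad v x))" by (intro continuous_integrable continuous_on_norm cv)
      then show ?thesis by simp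
    qed
    also have "\<dots> \<le> B"
    proof -
      have "(LINT x|M. norm (grad v x)) \<le> measure M \<Omega> + C"
        using Lp_L1_bound[OF smooth_Lp(2)[OF v(1)], of 1] v(3) by simp
      then show ?thesis unfolding B_def using Q1(1) by (simp add: mult_left_mono)
    qed
    finally have "N * \<bar>LINT x|M. F x * s x\<bar> \<le> B"
      unfolding e[symmetric] using N by (simp add: abs_mult)
    then show "\<bar>LINT x|M. q x * v x * sin (N * (x \<bullet> t) + \<theta>)\<bar> \<le> B / N"
      using N by (simp add: F_def s_def field_simps)
  qed
qed

text \<open>If \<open>v\<close> extends the boundary values of \<open>f = z * sin (N * (x \<bullet> t) + \<theta>)\<close>, then the integral
  of \<open>grad (f\<^sup>2) \<bullet> e\<close> equals that of \<open>grad (v * f * (1 - \<kappa>)) \<bullet> e\<close> for a cut-off \<open>\<kappa>\<close>. Since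
  \<open>t\<close> is orthogonal to \<open>e\<close>, the only derivative of \<open>f\<close> occurring here does not fall on the
  oscillating factor.\<close>

lemma oscillation_limit:
  assumes z: "smooth z" "\<And>x. 0 \<le> z x" "\<And>x. z x \<le> 1"
    and t: "norm t = 1" "t \<bullet> e = 0" "norm e = 1"
    and ext: "\<And>N :: nat. \<exists>v. smooth v \<and> (\<lambda>x. v x - z x * sin (real N * (x \<bullet> t) + \<theta>)) \<in> test_functions \<Omega> \<and>
      (\<forall>x. \<bar>v x\<bar> \<le> 3) \<and> Np (grad v) \<le> C"
  shows "(\<lambda>N. LINT x|M. 2 * z x * (grad z x \<bullet> e) * (sin (real N * (x \<bullet> t) + \<theta>))\<^sup>2) \<longlonglongrightarrow> 0"
proof (rule LIMSEQ_I)
  fix r :: real assume r: "r > 0"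
  obtain v0 :: "'a \<Rightarrow> real" where "Np (grad v0) \<le> C" using ext[of 0] by blast
  then have C: "C \<ge> 0" using energy_nonneg[OF weight_1, of "grad v0"] by simp
  have "continuous_on (closure \<Omega>) (\<lambda>x. grad z x \<bullet> e)" by (intro smooth_continuous_on smooth_grad z)
  then have "bounded ((\<lambda>x. grad z x \<bullet> e) ` closure \<Omega>)"
    using bd by (intro compact_imp_bounded compact_continuous_image) (auto simp: compact_closure)
  then obtain Z where Z: "Z > 0" "\<And>x. x \<in> closure \<Omega> \<Longrightarrow> \<bar>grad z x \<bullet> e\<bar> \<le> Z"
    unfolding bounded_pos by auto
  \<comment> \<open>The order of choices is \<open>\<sigma>\<close>, \<open>\<kappa>\<close>,
    \<open>N\<close>. A large \<open>\<sigma>\<close> makes \<open>\<sigma> powr (1 - p) * C\<close>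
    small; the large factor \<open>\<sigma> + 3 * Z\<close> is then beaten by the small integral of
    \<open>1 - \<kappa>\<close>, and the large gradient of \<open>\<kappa>\<close> by
    \<open>N\<close>.\<close>
  define a where "a = (4 * (C + 1)) / r"
  have a: "a > 0" using C r by (simp add: a_def)
  define \<sigma> where "\<sigma> = a powr (1 / (p - 1))"
  have \<sigma>: "\<sigma> > 0" using a by (simp add: \<sigma>_def)
  have \<sigma>p: "\<sigma> powr (1 - p) * C \<le> r / 4"
  proof -
    have "(1 / (p - 1)) * (1 - p) = -1" using p by (simp add: field_simps)
    then have e: "\<sigma> powr (1 - p) = 1 / a" using a by (simp add: \<sigma>_def powr_powr powr_minus_divide)
    show ?thesis unfolding e a_def using C r by (simp add: field_simps)
  qed
  obtain \<kappa>s :: "nat \<Rightarrow> 'a \<Rightarrow> real" where \<kappa>s: "\<And>k. \<kappa>s k \<in> test_functions \<Omega>"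
    "\<And>k x. 0 \<le> \<kappa>s k x" "\<And>k x. \<kappa>s k x \<le> 1" "\<And>x. x \<in> \<Omega> \<Longrightarrow> (\<lambda>k. \<kappa>s k x) \<longlonglongrightarrow> 1"
    using test_functions_exhaust[OF op] by metis
  have "(\<lambda>k. LINT x|M. 1 - \<kappa>s k x) \<longlonglongrightarrow> (LINT x|M. 0)"
  proof (rule integral_dominated_convergence)
    show "integrable M (\<lambda>x. 1 :: real)" by simp
    show "(\<lambda>x. 1 - \<kappa>s k x) \<in> borel_measurable M" for k
      by (intro continuous_imp_measurable_domain continuous_on_diff continuous_on_const smooth_continuous_on
          test_functions_smooth[OF \<kappa>s(1)])
    show "AE x in M. (\<lambda>k. 1 - \<kappa>s k x) \<longlonglongrightarrow> 0"
    proof (rule AE_I2)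
      fix x assume "x \<in> space M"
      then show "(\<lambda>k. 1 - \<kappa>s k x) \<longlonglongrightarrow> 0" using tendsto_diff[OF tendsto_const \<kappa>s(4), of x 1] by simp
    qed
    show "AE x in M. norm (1 - \<kappa>s k x) \<le> 1" for k using \<kappa>s(2,3) by (auto intro!: AE_I2)
  qed simp
  then have "(\<lambda>k. (\<sigma> + 3 * Z) * (LINT x|M. 1 - \<kappa>s k x)) \<longlonglongrightarrow> 0" by (auto intro: tendsto_mult_right_zero)
  then have "\<forall>\<^sub>F k in sequentially. (\<sigma> + 3 * Z) * (LINT x|M. 1 - \<kappa>s k x) < r / 4"
    using r by (intro order_tendstoD(2)) auto
  from eventually_happens'[OF sequentially_bot this]
  obtain k where k: "(\<sigma> + 3 * Z) * (LINT x|M. 1 - \<kappa>s k x) < r / 4" by blast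
  define \<kappa> where "\<kappa> = \<kappa>s k"
  have \<kappa>: "\<kappa> \<in> test_functions \<Omega>" "\<And>x. 0 \<le> \<kappa> x" "\<And>x. \<kappa> x \<le> 1" using \<kappa>s by (auto simp: \<kappa>_def)
  obtain K where K: "smooth \<kappa>" "compact K" "K \<subseteq> \<Omega>" "\<And>x. x \<notin> K \<Longrightarrow> grad \<kappa> x = 0"
    using test_functionsE[OF \<kappa>(1)] by metis
  \<comment> \<open>Collects the term where the derivative falls on \<open>\<kappa>\<close>; its
    compact support in \<open>\<Omega>\<close> is what \<open>oscillating_integral_bound\<close>
    requires.\<close>
  define q where "q x = z x * (grad \<kappa> x \<bullet> e)" for x
  have "(\<lambda>x. grad \<kappa> x \<bullet> e) \<in> test_functions \<Omega>"
    by (rule test_functionsI[OF smooth_grad[OF K(1)] K(2,3)]) (simp add: K(4))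
  then have q: "q \<in> test_functions \<Omega>" unfolding q_def[abs_def] by (rule test_functions_mult(2)[OF _ z(1)])
  obtain B where B: "\<And>v N \<theta>. smooth v \<Longrightarrow> (\<And>x. \<bar>v x\<bar> \<le> 3) \<Longrightarrow> Np (grad v) \<le> C \<Longrightarrow> N > 0 \<Longrightarrow>
    \<bar>LINT x|M. q x * v x * sin (N * (x \<bullet> t) + \<theta>)\<bar> \<le> B / N"
    using oscillating_integral_bound[OF q t(1), of C] by blast
  obtain N0 :: nat where N0: "4 * \<bar>B\<bar> / r < real N0" using reals_Archimedean2 by blast
  have "norm ((LINT x|M. 2 * z x * (grad z x \<bullet> e) * (sin (real N * (x \<bullet> t) + \<theta>))\<^sup>2) - 0) < r" if N: "N \<ge> Suc N0" for N
  proof -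
    have N': "real N > 0" "4 * \<bar>B\<bar> / r < real N" using N N0 by linarith+
    have BN: "B / real N \<le> r / 4"
    proof -
      have "4 * \<bar>B\<bar> < real N * r" using N'(2) r by (simp add: field_simps)
      then have "4 * B \<le> real N * r" by linarith
      then show ?thesis using N'(1) by (simp add: field_simps)
    qed
    obtain v where v: "smooth v" "(\<lambda>x. v x - z x * sin (real N * (x \<bullet> t) + \<theta>)) \<in> test_functions \<Omega>"
      "\<And>x. \<bar>v x\<bar> \<le> 3" "Np (grad v) \<le> C" using ext[of N] by blast
    define s where "s x = sin (real N * (x \<bullet> t) + \<theta>)" for x :: 'a
    define f where "f x = z x * s x" for x
    have ls: "smooth (\<lambda>x. real N * (x \<bullet> t) + \<theta>)" by (intro smooth_add smooth_mult) auto
    have lg: "grad (\<lambda>x. real N * (x \<bullet> t) + \<theta>) x = real N *\<^sub>R t" for x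
      by (simp add: grad_add grad_mult grad_inner grad_const smooth_mult)
    have ss: "smooth s" unfolding s_def[abs_def] using ls by (auto intro: smooth_compose smooth_sin_cos)
    have gs: "grad s x \<bullet> e = 0" for x
    proof -
      have "grad s x = cos (real N * (x \<bullet> t) + \<theta>) *\<^sub>R (real N *\<^sub>R t)"
        unfolding s_def[abs_def] lg[of x, symmetric] by (rule grad_compose[OF DERIV_sin ls])
      then show ?thesis using t(2) by simp
    qed
    have fs: "smooth f" unfolding f_def[abs_def] by (intro smooth_mult z ss)
    have gf: "grad f x \<bullet> e = s x * (grad z x \<bullet> e)" for x
      unfolding f_def[abs_def] by (simp add: grad_mult[OF z(1) ss] inner_add_left gs)
    have f1: "\<bar>f x\<bar> \<le> 1" for x
      unfolding f_def s_def abs_mult using z(2,3)[of x] by (intro mult_le_one) auto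
    have s1: "\<bar>s x\<bar> \<le> 1" for x by (simp add: s_def)
    define w where "w x = 1 - \<kappa> x" for x
    have ws: "smooth w" unfolding w_def[abs_def] by (intro smooth_diff smooth_const K)
    have gw: "grad w x = - grad \<kappa> x" for x
      unfolding w_def[abs_def] by (simp add: grad_diff K grad_const)
    have w01: "0 \<le> w x" "w x \<le> 1" for x using \<kappa>(2,3)[of x] by (auto simp: w_def)
    \<comment> \<open>The decomposition is \<open>f x * f x = T2 x + R x - T1 x\<close>.
      \<open>T1\<close> has compact support because \<open>v\<close> extends the boundary values of
      \<open>f\<close>, \<open>T2\<close> because of \<open>\<kappa>\<close>; only the boundary
      layer \<open>R\<close> contributes to the integral.\<close>
    define T1 where "T1 x = (v x - f x) * f x" for x
    define T2 where "T2 x = \<kappa> x * (v x * f x)" for x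
    define R where "R x = (v x * f x) * w x" for x
    have T1: "T1 \<in> test_functions \<Omega>" unfolding T1_def[abs_def]
      by (rule test_functions_mult(1)[OF _ fs]) (use v(2) in \<open>simp add: f_def s_def\<close>)
    have T2: "T2 \<in> test_functions \<Omega>" unfolding T2_def[abs_def]
      by (rule test_functions_mult(1)[OF \<kappa>(1)]) (intro smooth_mult v fs)
    have T: "smooth T1" "smooth T2" using T1 T2 test_functions_smooth by auto
    have vfs: "smooth (\<lambda>x. v x * f x)" by (intro smooth_mult v fs)
    have Rs: "smooth R" unfolding R_def[abs_def] by (intro smooth_mult vfs ws)
    have ff: "grad (\<lambda>x. f x * f x) x = (grad T2 x + grad R x) - grad T1 x" for x
    proof -
      have "(\<lambda>x. f x * f x) = (\<lambda>x. (T2 x + R x) - T1 x)"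
        by (simp add: T1_def T2_def R_def w_def algebra_simps fun_eq_iff)
      then show ?thesis using T Rs by (simp add: grad_diff grad_add smooth_add)
    qed
    have gff: "grad (\<lambda>x. f x * f x) x \<bullet> e = 2 * z x * (grad z x \<bullet> e) * (s x * s x)" for x
      unfolding grad_mult[OF fs fs] inner_add_left inner_scaleR_left gf unfolding f_def by simp
    have gR: "grad R x \<bullet> e = w x * (f x * (grad v x \<bullet> e) + v x * (s x * (grad z x \<bullet> e))) - q x * v x * s x" for x
      unfolding R_def[abs_def] grad_mult[OF vfs ws] grad_mult[OF v(1) fs] inner_add_left inner_scaleR_left gf gw
        inner_minus_left
      unfolding q_def f_def by (simp add: algebra_simps)
    have gi: "integrable M (\<lambda>x. grad g x \<bullet> e)" if "smooth g" for g
      using that by (intro continuous_integrable smooth_continuous_on smooth_grad)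
    have "(LINT x|M. 2 * z x * (grad z x \<bullet> e) * (sin (real N * (x \<bullet> t) + \<theta>))\<^sup>2) = (LINT x|M. grad (\<lambda>x. f x * f x) x \<bullet> e)"
      unfolding gff s_def by (simp add: power2_eq_square mult_ac)
    also have "\<dots> = (LINT x|M. grad T2 x \<bullet> e) + (LINT x|M. grad R x \<bullet> e) - (LINT x|M. grad T1 x \<bullet> e)"
      unfolding ff inner_diff_left inner_add_left using gi[OF T(1)] gi[OF T(2)] gi[OF Rs] by simp
    also have "\<dots> = (LINT x|M. grad R x \<bullet> e)"
      using integral_grad_test_function[OF op T1] integral_grad_test_function[OF op T2] by simp
    also have "\<dots> = (LINT x|M. w x * (f x * (grad v x \<bullet> e) + v x * (s x * (grad z x \<bullet> e))) - q x * v x * s x)"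
      unfolding gR ..
    also have "\<dots> = (LINT x|M. w x * (f x * (grad v x \<bullet> e) + v x * (s x * (grad z x \<bullet> e)))) - (LINT x|M. q x * v x * s x)"
      by (intro Bochner_Integration.integral_diff continuous_integrable smooth_continuous_on smooth_mult smooth_add
          ws fs ss v smooth_grad z test_functions_smooth[OF q])
    finally have I: "(LINT x|M. 2 * z x * (grad z x \<bullet> e) * (sin (real N * (x \<bullet> t) + \<theta>))\<^sup>2) =
      (LINT x|M. w x * (f x * (grad v x \<bullet> e) + v x * (s x * (grad z x \<bullet> e)))) - (LINT x|M. q x * v x * s x)" .
    have "\<bar>LINT x|M. w x * (f x * (grad v x \<bullet> e) + v x * (s x * (grad z x \<bullet> e)))\<bar>
      \<le> (LINT x|M. (\<sigma> + 3 * Z) * w x + \<sigma> powr (1 - p) * norm (grad v x) powr p)"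
    proof (rule abs_integral_le)
      show "continuous_on UNIV (\<lambda>x. w x * (f x * (grad v x \<bullet> e) + v x * (s x * (grad z x \<bullet> e))))"
        by (intro smooth_continuous_on smooth_mult smooth_add ws fs ss v smooth_grad z)
      show "continuous_on UNIV (\<lambda>x. (\<sigma> + 3 * Z) * w x + \<sigma> powr (1 - p) * norm (grad v x) powr p)"
        using p by (intro continuous_on_add continuous_on_mult continuous_on_const continuous_on_powr'
            continuous_on_norm continuous_on_grad v smooth_continuous_on ws) auto
      fix x assume x: "x \<in> \<Omega>"
      then have zx: "\<bar>grad z x \<bullet> e\<bar> \<le> Z" using Z(2) closure_subset by blast
      have "\<bar>grad v x \<bullet> e\<bar> \<le> norm (grad v x)" using Cauchy_Schwarz_ineq2[of "grad v x" e] t(3) by simp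
      also have "\<dots> \<le> \<sigma> + \<sigma> powr (1 - p) * norm (grad v x) powr p" by (rule le_add_powr[OF p _ \<sigma>]) simp
      finally have vx: "\<bar>grad v x \<bullet> e\<bar> \<le> \<sigma> + \<sigma> powr (1 - p) * norm (grad v x) powr p" .
      have A: "\<bar>f x * (grad v x \<bullet> e)\<bar> \<le> 1 * (\<sigma> + \<sigma> powr (1 - p) * norm (grad v x) powr p)"
        unfolding abs_mult by (intro mult_mono f1 vx) auto
      have "\<bar>v x * (s x * (grad z x \<bullet> e))\<bar> \<le> 3 * (1 * Z)"
        unfolding abs_mult by (intro mult_mono v s1 zx) auto
      then have "\<bar>f x * (grad v x \<bullet> e) + v x * (s x * (grad z x \<bullet> e))\<bar> \<le> (\<sigma> + 3 * Z) + \<sigma> powr (1 - p) * norm (grad v x) powr p"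
        using A abs_triangle_ineq[of "f x * (grad v x \<bullet> e)" "v x * (s x * (grad z x \<bullet> e))"] by simp
      then have "w x * \<bar>f x * (grad v x \<bullet> e) + v x * (s x * (grad z x \<bullet> e))\<bar> \<le>
         w x * ((\<sigma> + 3 * Z) + \<sigma> powr (1 - p) * norm (grad v x) powr p)"
        using w01 by (intro mult_left_mono) auto
      also have "\<dots> \<le> (\<sigma> + 3 * Z) * w x + 1 * (\<sigma> powr (1 - p) * norm (grad v x) powr p)"
        using mult_right_mono[OF w01(2)[of x], of "\<sigma> powr (1 - p) * norm (grad v x) powr p"] by (simp add: algebra_simps)
      finally show "\<bar>w x * (f x * (grad v x \<bullet> e) + v x * (s x * (grad z x \<bullet> e)))\<bar>
        \<le> (\<sigma> + 3 * Z) * w x + \<sigma> powr (1 - p) * norm (grad v x) powr p"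
        using w01(1)[of x] by (simp add: abs_mult)
    qed
    also have "\<dots> = (\<sigma> + 3 * Z) * (LINT x|M. w x) + \<sigma> powr (1 - p) * Np (grad v)"
    proof -
      have "integrable M w" "integrable M (\<lambda>x. norm (grad v x) powr p)"
        using continuous_integrable[OF smooth_continuous_on[OF ws]] LpD(2)[OF smooth_Lp(2)[OF v(1)]] by auto
      then show ?thesis by (simp add: energy_def)
    qed
    also have "\<dots> \<le> r / 4 + r / 4"
    proof (rule add_mono)
      show "(\<sigma> + 3 * Z) * (LINT x|M. w x) \<le> r / 4" using k by (simp add: w_def \<kappa>_def)
      show "\<sigma> powr (1 - p) * Np (grad v) \<le> r / 4"
        using mult_left_mono[OF v(4), of "\<sigma> powr (1 - p)"] \<sigma>p by simp
    qed
    finally have 1: "\<bar>LINT x|M. w x * (f x * (grad v x \<bullet> e) + v x * (s x * (grad z x \<bullet> e)))\<bar> \<le> r / 4 + r / 4" .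
    have 2: "\<bar>LINT x|M. q x * v x * s x\<bar> \<le> r / 4"
      using B[OF v(1,3,4) N'(1), of \<theta>] BN unfolding s_def by linarith
    show ?thesis unfolding I using 1 2 r by (simp only: real_norm_def)
  qed
  then show "\<exists>no. \<forall>n\<ge>no. norm ((LINT x|M. 2 * z x * (grad z x \<bullet> e) * (sin (real n * (x \<bullet> t) + \<theta>))\<^sup>2) - 0) < r"
    by blast
qed

lemma integral_grad_square_eq_0:
  assumes z: "smooth z" "\<And>x. 0 \<le> z x" "\<And>x. z x \<le> 1"
    and t: "norm t = 1" "t \<bullet> e = 0" "norm e = 1"
    and ext: "\<And>(N :: nat) \<theta>. \<exists>v. smooth v \<and> (\<lambda>x. v x - z x * sin (real N * (x \<bullet> t) + \<theta>)) \<in> test_functions \<Omega> \<and>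
      (\<forall>x. \<bar>v x\<bar> \<le> 3) \<and> Np (grad v) \<le> C"
  shows "(LINT x|M. z x * (grad z x \<bullet> e)) = 0"
proof -
  define I where "I N \<theta> = (LINT x|M. 2 * z x * (grad z x \<bullet> e) * (sin (real N * (x \<bullet> t) + \<theta>))\<^sup>2)" for N :: nat and \<theta>
  have "(\<lambda>N. I N 0 + I N (pi / 2)) \<longlonglongrightarrow> 0 + 0"
    unfolding I_def by (intro tendsto_add oscillation_limit[OF z t ext])
  \<comment> \<open>The sum is the same for every \<open>N\<close>, so its limit 0 is its
    value.\<close>
  moreover have "I N 0 + I N (pi / 2) = 2 * (LINT x|M. z x * (grad z x \<bullet> e))" for N
  proof -
    have i: "integrable M (\<lambda>x. 2 * z x * (grad z x \<bullet> e) * (sin (real N * (x \<bullet> t) + \<theta>))\<^sup>2)" for \<theta>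
      by (intro continuous_integrable continuous_intros smooth_continuous_on[OF z(1)] continuous_on_grad[OF z(1)])
    have "I N 0 + I N (pi / 2) = (LINT x|M. 2 * z x * (grad z x \<bullet> e) * (sin (real N * (x \<bullet> t) + 0))\<^sup>2
      + 2 * z x * (grad z x \<bullet> e) * (sin (real N * (x \<bullet> t) + pi / 2))\<^sup>2)"
      unfolding I_def by (rule Bochner_Integration.integral_add[OF i i, symmetric])
    also have "\<dots> = (LINT x|M. 2 * (z x * (grad z x \<bullet> e)))"
    proof (rule Bochner_Integration.integral_cong[OF refl])
      fix x
      have "(sin (real N * (x \<bullet> t) + 0))\<^sup>2 + (sin (real N * (x \<bullet> t) + pi / 2))\<^sup>2 = 1"
        by (simp add: sin_add)
      then show "2 * z x * (grad z x \<bullet> e) * (sin (real N * (x \<bullet> t) + 0))\<^sup>2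
        + 2 * z x * (grad z x \<bullet> e) * (sin (real N * (x \<bullet> t) + pi / 2))\<^sup>2 = 2 * (z x * (grad z x \<bullet> e))"
        unfolding distrib_left[symmetric] by simp
    qed
    finally show ?thesis by simp
  qed
  ultimately show ?thesis by (simp add: LIMSEQ_const_iff)
qed

section \<open>Boundary determination\<close>

lemma weight_continuous:
  assumes "continuous_on (closure \<Omega>) \<gamma>" "\<And>x. x \<in> closure \<Omega> \<Longrightarrow> \<gamma> x > 0"
  shows "weight \<gamma>"
proof (cases "\<Omega> = {}")
  case True
  have "\<gamma> \<in> borel_measurable M"
    using True by (intro continuous_imp_measurable_on_sets_lebesgue) auto
  moreover have "\<exists>c0>0. \<exists>c1. \<forall>x\<in>\<Omega>. c0 \<le> \<gamma> x \<and> \<gamma> x \<le> c1"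
    using True by (auto intro: exI[of _ 1])
  ultimately show ?thesis unfolding weight_def by (rule conjI)
next
  case False
  have c: "compact (closure \<Omega>)" using bd by (simp add: compact_closure)
  have ne: "closure \<Omega> \<noteq> {}" using False by simp
  obtain a where a: "a \<in> closure \<Omega>" "\<And>x. x \<in> closure \<Omega> \<Longrightarrow> \<gamma> a \<le> \<gamma> x"
    using continuous_attains_inf[OF c ne assms(1)] by blast
  obtain b where b: "b \<in> closure \<Omega>" "\<And>x. x \<in> closure \<Omega> \<Longrightarrow> \<gamma> x \<le> \<gamma> b"
    using continuous_attains_sup[OF c ne assms(1)] by blast
  have "\<gamma> \<in> borel_measurable M"
    using op continuous_on_subset[OF assms(1) closure_subset]
    by (intro continuous_imp_measurable_on_sets_lebesgue) auto
  moreover have "\<gamma> a \<le> \<gamma> x \<and> \<gamma> x \<le> \<gamma> b" if "x \<in> \<Omega>" for x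
    using a(2) b(2) that closure_subset by blast
  ultimately show ?thesis using assms(2)[OF a(1)] by (auto simp: weight_def)
qed

text \<open>The function \<open>z\<close> is supported in the ellipsoid \<open>q \<le> 1\<close>, which is centred at
  \<open>x0 - b *\<^sub>R e\<close> below the graph and so thin in the directions orthogonal to \<open>e\<close> that
  \<open>z\<close> decreases in the direction \<open>e\<close> on all of \<open>\<Omega>\<close>.\<close>

lemma boundary_bump_exists:
  assumes x0: "x0 \<in> frontier \<Omega>" and C1: "C1_boundary \<Omega>" and \<rho>0: "\<rho>0 > 0"
  obtains z e \<rho> where "smooth z" "\<And>x. 0 \<le> z x" "\<And>x. z x \<le> 1" "norm e = 1" "0 < \<rho>" "\<rho> \<le> \<rho>0"
    "\<And>x. z x \<noteq> 0 \<Longrightarrow> norm (x - x0) \<le> \<rho> / 2" "(LINT x|M. z x * (grad z x \<bullet> e)) < 0"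
proof -
  obtain r e h where r: "r > 0" and e: "norm e = 1" and h: "Ck 1 h"
    and \<Omega>h: "\<Omega> \<inter> ball x0 r = {y \<in> ball x0 r. h (y - (y \<bullet> e) *\<^sub>R e) < y \<bullet> e}"
    using C1 x0 unfolding C1_boundary_def by blast
  have ee: "e \<bullet> e = 1" using e by (simp add: dot_square_norm)
  define \<rho> where "\<rho> = min \<rho>0 r"
  have \<rho>: "0 < \<rho>" "\<rho> \<le> \<rho>0" "\<rho> \<le> r" using r \<rho>0 by (auto simp: \<rho>_def)
  \<comment> \<open>On the ellipsoid \<open>\<bar>P x\<bar> < 3 * b = \<rho> / 3\<close>; with an
    orthogonal part below \<open>\<rho> / 3\<close> as well, it stays within distance
    \<open>\<rho> / 2\<close> of \<open>x0\<close>.\<close>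
  define b where "b = \<rho> / 9"
  have b: "b > 0" using \<rho> by (simp add: b_def)
  define x0' where "x0' = x0 - (x0 \<bullet> e) *\<^sub>R e"
  \<comment> \<open>An open set does not contain its boundary points, so \<open>x0\<close> does not
    lie above the graph.\<close>
  have "x0 \<notin> \<Omega>" "x0 \<in> closure \<Omega>" using x0 op by (auto simp: frontier_def interior_open)
  then have hx0: "h x0' \<ge> x0 \<bullet> e"
    using \<Omega>h r unfolding x0'_def by (metis (mono_tags, lifting) Int_iff centre_in_ball linorder_not_le mem_Collect_eq)
  have "Ck 0 h" using h Ck_SucD[of 0 h] by simp
  then have "isCont h x0'" by (simp add: continuous_on_eq_continuous_at)
  then obtain s where s: "s > 0" "\<And>y. dist y x0' < s \<Longrightarrow> dist (h y) (h x0') < b"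
    using b unfolding continuous_at_eps_delta by blast
  \<comment> \<open>On the ellipsoid the first summand bounds the orthogonal part by
    \<open>\<rho> / 3\<close>, the second one by \<open>s\<close>, a distance over which
    \<open>h\<close> varies by less than \<open>b\<close>.\<close>
  define A where "A = 9 / \<rho>\<^sup>2 + 1 / s\<^sup>2"
  have A: "A > 0" using \<rho> s by (simp add: A_def add_pos_pos)
  define P where "P x = (x - x0) \<bullet> e" for x
  \<comment> \<open>The difference in the first term is the squared orthogonal part of
    \<open>x - x0\<close>; the semi-axis along \<open>e\<close> is \<open>2 * b\<close>.\<close>
  define q where "q x = A * ((x - x0) \<bullet> (x - x0) - P x ^ 2) + (P x + b) ^ 2 * (1 / (4 * b\<^sup>2))" for x
  define z where "z x = flat 0 (1 - q x)" for x
  have perp: "(x - x0) \<bullet> (x - x0) - P x ^ 2 = (norm ((x - x0) - P x *\<^sub>R e))\<^sup>2" for x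
  proof -
    have "w \<bullet> w - (w \<bullet> e)\<^sup>2 = (norm (w - (w \<bullet> e) *\<^sub>R e))\<^sup>2" for w
      unfolding power2_norm_eq_inner
      by (simp add: inner_diff_left inner_diff_right ee inner_commute[of e w] power2_eq_square)
    then show ?thesis unfolding P_def .
  qed
  have Ps: "smooth P" unfolding P_def[abs_def] by (simp add: inner_diff_left smooth_diff)
  have gP: "grad P x = e" for x
    unfolding P_def[abs_def] by (simp add: inner_diff_left grad_diff grad_inner grad_const)
  have ns: "smooth (\<lambda>x. (x - x0) \<bullet> (x - x0))"
  proof -
    have "(\<lambda>x. (x - x0) \<bullet> (x - x0)) = (\<lambda>x. \<Sum>i\<in>Basis. (x \<bullet> i - x0 \<bullet> i) * (x \<bullet> i - x0 \<bullet> i))"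
      by (subst euclidean_inner) (simp add: inner_diff_left)
    then show ?thesis by (auto intro!: smooth_sum smooth_mult smooth_diff)
  qed
  have gn: "grad (\<lambda>x. (x - x0) \<bullet> (x - x0)) x = 2 *\<^sub>R (x - x0)" for x
    by (rule grad_eqI) (auto simp: gderiv_def inner_commute intro!: derivative_eq_intros)
  have qs: "smooth q" unfolding q_def[abs_def]
    by (intro smooth_add smooth_mult smooth_diff smooth_power smooth_const ns Ps)
  have gq: "grad q x \<bullet> e = (P x + b) / (2 * b\<^sup>2)" for x
  proof -
    define B where "B = 1 / (4 * b\<^sup>2)"
    have "GDERIV q x :> A *\<^sub>R (2 *\<^sub>R (x - x0) - (2 * P x) *\<^sub>R e) + (2 * (P x + b) * B) *\<^sub>R e"
    proof -
      have "((\<lambda>x. A * ((x - x0) \<bullet> (x - x0) - ((x - x0) \<bullet> e) ^ 2) + ((x - x0) \<bullet> e + b) ^ 2 * B) has_derivative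
        (\<lambda>v. A * (2 * (v \<bullet> (x - x0)) - 2 * ((x - x0) \<bullet> e) * (v \<bullet> e)) + 2 * ((x - x0) \<bullet> e + b) * (v \<bullet> e) * B)) (at x)"
        by (auto intro!: derivative_eq_intros simp: inner_commute algebra_simps)
      from this[folded P_def]
      have "(q has_derivative (\<lambda>v. A * (2 * (v \<bullet> (x - x0)) - 2 * P x * (v \<bullet> e)) + 2 * (P x + b) * (v \<bullet> e) * B)) (at x)"
        unfolding q_def[abs_def] B_def[symmetric] .
      then show ?thesis unfolding gderiv_def
        by (rule has_derivative_eq_rhs) (simp add: fun_eq_iff inner_diff_right inner_add_right algebra_simps)
    qed
    then have "grad q x = A *\<^sub>R (2 *\<^sub>R (x - x0) - (2 * P x) *\<^sub>R e) + (2 * (P x + b) * B) *\<^sub>R e"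
      by (rule grad_eqI)
    then have "grad q x \<bullet> e = A * (2 * P x - 2 * P x) + 2 * (P x + b) * B"
      by (simp add: inner_add_left inner_diff_left ee P_def)
    then show ?thesis using b by (simp add: B_def field_simps)
  qed
  have zs: "smooth z" unfolding z_def[abs_def] by (intro smooth_compose[OF smooth_flat] smooth_diff smooth_const qs)
  have gz: "grad z x \<bullet> e = - flat 2 (1 - q x) * ((P x + b) / (2 * b\<^sup>2))" for x
  proof -
    have "grad z x = flat 2 (1 - q x) *\<^sub>R grad (\<lambda>x. 1 - q x) x"
      unfolding z_def[abs_def] using DERIV_flat[of 0 "1 - q x"]
      by (intro grad_compose smooth_diff smooth_const qs) (simp add: numeral_2_eq_2)
    then show ?thesis by (simp add: grad_diff[OF smooth_const qs] grad_const gq)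
  qed
  have q1: "\<bar>P x\<bar> < 3 * b \<and> norm ((x - x0) - P x *\<^sub>R e) < s \<and> norm (x - x0) \<le> \<rho> / 2" if "q x < 1" for x
  proof -
    define n where "n = norm ((x - x0) - P x *\<^sub>R e)"
    have qx: "q x = A * n\<^sup>2 + (P x + b)\<^sup>2 * (1 / (4 * b\<^sup>2))" by (simp add: q_def perp n_def)
    have "(P x + b)\<^sup>2 * (1 / (4 * b\<^sup>2)) < 1"
      using that A qx by (smt (verit) mult_nonneg_nonneg zero_le_power2)
    then have "(P x + b)\<^sup>2 < (2 * b)\<^sup>2" using b by (simp add: field_simps)
    then have "\<bar>P x + b\<bar>\<^sup>2 < (2 * b)\<^sup>2" by simp
    then have "\<bar>P x + b\<bar> < 2 * b" by (rule power2_less_imp_less) (use b in simp)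
    then have P3: "\<bar>P x\<bar> < 3 * b" using b by linarith
    have An: "A * n\<^sup>2 < 1"
      using that b qx by (smt (verit) divide_nonneg_nonneg mult_nonneg_nonneg zero_le_power2)
    have "1 / s\<^sup>2 * n\<^sup>2 \<le> A * n\<^sup>2" "9 / \<rho>\<^sup>2 * n\<^sup>2 \<le> A * n\<^sup>2"
      unfolding A_def by (intro mult_right_mono; simp)+
    then have n1: "1 / s\<^sup>2 * n\<^sup>2 < 1" and n2: "9 / \<rho>\<^sup>2 * n\<^sup>2 < 1" using An by linarith+
    have "n\<^sup>2 < s\<^sup>2" using n1 s by (simp add: field_simps)
    then have "n < s" using s by (simp add: power2_less_imp_less)
    have "9 * n\<^sup>2 < \<rho>\<^sup>2" using n2 \<rho> by (simp add: field_simps)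
    moreover have "(P x)\<^sup>2 \<le> (3 * b)\<^sup>2" using P3 b by (subst abs_le_square_iff[symmetric]) auto
    then have "9 * (P x)\<^sup>2 \<le> \<rho>\<^sup>2" by (simp add: b_def power_mult_distrib power_divide)
    moreover have "(norm (x - x0))\<^sup>2 = n\<^sup>2 + (P x)\<^sup>2"
      using perp[of x] by (simp add: n_def power2_norm_eq_inner)
    moreover have "0 \<le> \<rho>\<^sup>2" by simp
    ultimately have "4 * (norm (x - x0))\<^sup>2 \<le> \<rho>\<^sup>2"
      by linarith
    then have "(norm (x - x0))\<^sup>2 \<le> (\<rho> / 2)\<^sup>2" by (simp add: power_divide)
    then have "norm (x - x0) \<le> \<rho> / 2"
      by (rule power2_le_imp_le) (use \<rho> in simp)
    then show ?thesis using P3 \<open>n < s\<close> by (simp add: n_def)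
  qed
  \<comment> \<open>Over the ellipsoid the graph stays above the height
    \<open>x0 \<bullet> e - b\<close> of its centre, so \<open>\<Omega>\<close> meets only the upper
    half, where \<open>q\<close> increases along \<open>e\<close>.\<close>
  have Pb: "P x + b > 0" if x: "x \<in> \<Omega>" and qx: "q x < 1" for x
  proof -
    note q = q1[OF qx]
    have "x \<in> ball x0 r" using q \<rho> by (simp add: dist_norm norm_minus_commute)
    then have hx: "h (x - (x \<bullet> e) *\<^sub>R e) < x \<bullet> e" using \<Omega>h x by blast
    have xx: "(x - (x \<bullet> e) *\<^sub>R e) - x0' = (x - x0) - P x *\<^sub>R e"
      by (simp add: x0'_def P_def inner_diff_left algebra_simps)
    have "dist (x - (x \<bullet> e) *\<^sub>R e) x0' < s" unfolding dist_norm xx using q by simp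
    then have "dist (h (x - (x \<bullet> e) *\<^sub>R e)) (h x0') < b" by (rule s(2))
    then show ?thesis using hx hx0 by (simp add: P_def inner_diff_left dist_real_def)
  qed
  have nonpos: "0 \<le> - (z x * (grad z x \<bullet> e))" if "x \<in> \<Omega>" for x
  proof (cases "q x < 1")
    case True
    then show ?thesis using Pb[OF that] b by (simp add: gz z_def flat_nonneg)
  next
    case False
    then show ?thesis by (simp add: z_def flat_eq_0)
  qed
  have pos: "z x * (grad z x \<bullet> e) \<noteq> 0" if "x \<in> \<Omega>" "q x < 1" for x
    using Pb[OF that] b that(2) flat_pos[of "1 - q x" 0] flat_pos[of "1 - q x" 2] by (simp add: gz z_def)
  define U where "U = \<Omega> \<inter> {x. q x < 1}"
  have "open {x. q x < 1}"
    using smooth_continuous_on[OF qs] by (intro open_Collect_less continuous_on_const)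
  then have oU: "open U" using op by (auto simp: U_def)
  \<comment> \<open>The open ellipsoid contains the boundary point \<open>x0\<close>, hence meets
    \<open>\<Omega>\<close> in a nonempty open set, on which the integrand does not vanish.\<close>
  have "q x0 = 1 / 4" using b by (simp add: q_def P_def)
  then have "x0 \<in> {x. q x < 1}" by simp
  then have "U \<noteq> {}"
    using \<open>open {x. q x < 1}\<close> \<open>x0 \<in> closure \<Omega>\<close> open_Int_closure_eq_empty[of "{x. q x < 1}" \<Omega>] unfolding U_def by blast
  have int: "integrable M (\<lambda>x. - (z x * (grad z x \<bullet> e)))"
    by (intro continuous_integrable smooth_continuous_on smooth_minus smooth_mult smooth_grad zs)
  have "(LINT x|M. - (z x * (grad z x \<bullet> e))) \<noteq> 0"
  proof
    assume "(LINT x|M. - (z x * (grad z x \<bullet> e))) = 0"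
    moreover have "AE x in M. 0 \<le> - (z x * (grad z x \<bullet> e))" using nonpos by (intro AE_I2) simp
    ultimately have "AE x in M. - (z x * (grad z x \<bullet> e)) = 0"
      using integral_nonneg_eq_0_iff_AE[OF int] by blast
    then have "AE x in lebesgue. x \<in> \<Omega> \<longrightarrow> - (z x * (grad z x \<bullet> e)) = 0"
      using op by (subst (asm) AE_restrict_space_iff) auto
    then have "AE x in lebesgue. x \<notin> U"
      by eventually_elim (use pos in \<open>auto simp: U_def\<close>)
    then have "negligible U"
      using oU unfolding negligible_iff_null_sets by (subst AE_iff_null_sets) auto
    then show False using open_not_negligible[OF oU] \<open>U \<noteq> {}\<close> by blast
  qed
  moreover have "0 \<le> (LINT x|M. - (z x * (grad z x \<bullet> e)))"
    using nonpos by (intro integral_nonneg_AE AE_I2) simp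
  ultimately have "(LINT x|M. z x * (grad z x \<bullet> e)) < 0" by simp
  moreover have "norm (x - x0) \<le> \<rho> / 2" if "z x \<noteq> 0" for x
    using that q1[of x] by (cases "q x < 1") (auto simp: z_def flat_eq_0)
  ultimately show thesis
    using that[OF zs _ _ e \<rho>(1,2)] by (auto simp: z_def flat_nonneg flat_0_le_1)
qed

lemma cutoff_exists:
  fixes x0 :: 'a
  assumes \<rho>: "\<rho> > 0"
  obtains \<eta> where "smooth \<eta>" "\<And>x. \<bar>\<eta> x\<bar> \<le> 1" "\<And>x. norm (x - x0) \<le> \<rho> / 2 \<Longrightarrow> \<eta> x = 1"
    "\<And>x. x \<notin> cball x0 \<rho> \<Longrightarrow> \<eta> x = 0" "\<And>x. x \<notin> cball x0 \<rho> \<Longrightarrow> grad \<eta> x = 0"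
proof -
  obtain S :: "real \<Rightarrow> real" where S: "smooth S" "\<And>t. 0 \<le> S t" "\<And>t. S t \<le> 1"
    "\<And>t. t \<le> 1 \<Longrightarrow> S t = 1" "\<And>t. t \<ge> 2 \<Longrightarrow> S t = 0"
    using smooth_step_exists by blast
  \<comment> \<open>The squared norm is smooth, unlike the norm. The scale gives \<open>n\<close>
    the value 1 at distance \<open>\<rho> / 2\<close> and 4 at distance \<open>\<rho>\<close>, past
    the threshold 2 of \<open>S\<close>.\<close>
  define n where "n x = (4 / \<rho>\<^sup>2) * (\<Sum>i\<in>Basis. (x \<bullet> i - x0 \<bullet> i) * (x \<bullet> i - x0 \<bullet> i))" for x
  have n: "n x = (4 / \<rho>\<^sup>2) * (norm (x - x0))\<^sup>2" for x
    unfolding n_def power2_norm_eq_inner by (subst euclidean_inner[of "x - x0"]) (simp add: inner_diff_left)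
  have ns: "smooth n" unfolding n_def[abs_def]
    by (intro smooth_mult smooth_const smooth_sum smooth_diff smooth_inner)
  define \<eta> where "\<eta> x = S (n x)" for x
  have out: "\<eta> x = 0" if "x \<notin> cball x0 \<rho>" for x
  proof -
    have "\<rho> < norm (x - x0)" using that by (simp add: dist_norm norm_minus_commute)
    then have "\<rho>\<^sup>2 \<le> (norm (x - x0))\<^sup>2" using \<rho> by (intro power_mono) auto
    then have "2 * \<rho>\<^sup>2 \<le> 4 * (norm (x - x0))\<^sup>2"
      using zero_le_power2[of "norm (x - x0)"] by linarith
    moreover have "n x = 4 * (norm (x - x0))\<^sup>2 / \<rho>\<^sup>2" by (simp add: n)
    ultimately have "n x \<ge> 2" using \<rho> by (simp only: pos_le_divide_eq zero_less_power)
    then show ?thesis by (simp add: \<eta>_def S)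
  qed
  show thesis
  proof (rule that[OF _ _ _ out])
    show "smooth \<eta>" unfolding \<eta>_def[abs_def] by (rule smooth_compose[OF S(1) ns])
    show "\<bar>\<eta> x\<bar> \<le> 1" for x using S(2,3) by (simp add: \<eta>_def)
    show "\<eta> x = 1" if "norm (x - x0) \<le> \<rho> / 2" for x
    proof -
      have "(norm (x - x0))\<^sup>2 \<le> (\<rho> / 2)\<^sup>2" using that by (intro power_mono) auto
      then have "n x \<le> 1" using \<rho> by (simp add: n field_simps)
      then show ?thesis by (simp add: \<eta>_def S)
    qed
    have "{x. \<eta> x \<noteq> 0} \<subseteq> cball x0 \<rho>" using out by blast
    then have "closure {x. \<eta> x \<noteq> 0} \<subseteq> cball x0 \<rho>" by (intro closure_minimal) auto
    then show "grad \<eta> x = 0" if "x \<notin> cball x0 \<rho>" for x using that by (intro grad_eq_0) auto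
  qed
qed

section \<open>Comparison of the coefficients at a boundary point\<close>

lemma DN_map_boundary_le:
  assumes dim: "2 \<le> DIM('a)" and C1: "C1_boundary \<Omega>"
    and c1: "continuous_on (closure \<Omega>) \<gamma>1" and pos1: "\<And>x. x \<in> closure \<Omega> \<Longrightarrow> \<gamma>1 x > 0"
    and c2: "continuous_on (closure \<Omega>) \<gamma>2" and pos2: "\<And>x. x \<in> closure \<Omega> \<Longrightarrow> \<gamma>2 x > 0"
    and DN: "DN_map p \<Omega> \<gamma>1 = DN_map p \<Omega> \<gamma>2" and x0: "x0 \<in> frontier \<Omega>"
  shows "\<gamma>1 x0 \<le> \<gamma>2 x0"
proof (rule ccontr)
  assume "\<not> \<gamma>1 x0 \<le> \<gamma>2 x0"
  then have gt: "\<gamma>2 x0 < \<gamma>1 x0" by simp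
  note w1 = weight_continuous[OF c1 pos1] and w2 = weight_continuous[OF c2 pos2]
  have x0c: "x0 \<in> closure \<Omega>" using x0 by (simp add: frontier_def)
  \<comment> \<open>Half of the relative excess: \<open>(1 + d) * \<gamma>2 x0\<close> is the mean
    of the two values, so the strict inequality persists near \<open>x0\<close>.\<close>
  define d where "d = (\<gamma>1 x0 / \<gamma>2 x0 - 1) / 2"
  have d: "d > 0" using gt pos2[OF x0c] by (simp add: d_def field_simps)
  have "0 < \<gamma>1 x0 - (1 + d) * \<gamma>2 x0" using gt pos2[OF x0c] by (simp add: d_def field_simps)
  moreover have "continuous_on (closure \<Omega>) (\<lambda>x. \<gamma>1 x - (1 + d) * \<gamma>2 x)" by (intro continuous_intros c1 c2)
  ultimately obtain r where r: "r > 0" "\<And>x. x \<in> closure \<Omega> \<Longrightarrow> dist x x0 < r \<Longrightarrow>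
      dist (\<gamma>1 x - (1 + d) * \<gamma>2 x) (\<gamma>1 x0 - (1 + d) * \<gamma>2 x0) < \<gamma>1 x0 - (1 + d) * \<gamma>2 x0"
    using x0c unfolding continuous_on_iff by metis
  obtain z e \<rho> where z: "smooth z" "\<And>x. 0 \<le> z x" "\<And>x. z x \<le> 1" and e: "norm e = 1" and \<rho>: "0 < \<rho>" "\<rho> \<le> r / 2"
    and supp: "\<And>x. z x \<noteq> 0 \<Longrightarrow> norm (x - x0) \<le> \<rho> / 2" and neg: "(LINT x|M. z x * (grad z x \<bullet> e)) < 0"
    by (rule boundary_bump_exists[OF x0 C1 half_gt_zero[OF r(1)]]) blast
  obtain \<eta> where \<eta>: "smooth \<eta>" "\<And>x. \<bar>\<eta> x\<bar> \<le> 1" "\<And>x. norm (x - x0) \<le> \<rho> / 2 \<Longrightarrow> \<eta> x = 1"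
    "\<And>x. x \<notin> cball x0 \<rho> \<Longrightarrow> \<eta> x = 0" "\<And>x. x \<notin> cball x0 \<rho> \<Longrightarrow> grad \<eta> x = 0"
    using cutoff_exists[OF \<rho>(1), of x0] by blast
  have ratio: "(1 + d) * \<gamma>2 x \<le> \<gamma>1 x" if "x \<in> \<Omega>" "x \<in> cball x0 \<rho>" for x
  proof -
    have "x \<in> closure \<Omega>" using that(1) closure_subset by blast
    moreover have "dist x x0 < r" using that(2) \<rho> r(1) by (simp add: dist_commute)
    ultimately show ?thesis using r(2)[of x] by (simp add: dist_real_def abs_less_iff)
  qed
  obtain C where C: "\<And>f m. smooth f \<Longrightarrow> (\<And>x. \<bar>f x\<bar> \<le> 1) \<Longrightarrow> (\<And>x. \<eta> x * f x = f x) \<Longrightarrow>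
    dirichlet_min \<gamma>1 f m \<Longrightarrow> dirichlet_min \<gamma>2 f m \<Longrightarrow>
    \<exists>v. smooth v \<and> (\<lambda>x. v x - f x) \<in> test_functions \<Omega> \<and> (\<forall>x. \<bar>v x\<bar> \<le> 3) \<and> Np (grad v) \<le> C"
    using bounded_extensions[OF w1 w2 d \<eta>(1,2,4,5) ratio] by blast
  \<comment> \<open>In dimension at least 2 there is a direction orthogonal to \<open>e\<close> for
    the oscillation.\<close>
  obtain y where y: "y \<noteq> 0" "orthogonal e y" using orthogonal_to_vector_exists[OF dim] by blast
  define t where "t = y /\<^sub>R norm y"
  have t: "norm t = 1" "t \<bullet> e = 0" using y by (auto simp: t_def orthogonal_def inner_commute)
  have "\<exists>v. smooth v \<and> (\<lambda>x. v x - z x * sin (real N * (x \<bullet> t) + \<theta>)) \<in> test_functions \<Omega> \<and>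
      (\<forall>x. \<bar>v x\<bar> \<le> 3) \<and> Np (grad v) \<le> C" for N :: nat and \<theta>
  proof -
    define f where "f x = z x * sin (real N * (x \<bullet> t) + \<theta>)" for x
    have fs: "smooth f" unfolding f_def[abs_def]
      by (intro smooth_mult z smooth_compose[OF smooth_sin_cos(1)] smooth_add smooth_inner smooth_const)
    have f1: "\<bar>f x\<bar> \<le> 1" for x
      unfolding f_def abs_mult using z(2,3)[of x] by (intro mult_le_one) auto
    have \<eta>f: "\<eta> x * f x = f x" for x using supp[of x] \<eta>(3)[of x] by (cases "z x = 0") (auto simp: f_def)
    \<comment> \<open>Equality of the maps gives both coefficients the same \<open>m\<close>, the
      diagonal value at the class of \<open>f\<close>.\<close>
    show ?thesis
      using C[OF fs f1 \<eta>f dirichlet_min_DN_map[OF w1 fs]] dirichlet_min_DN_map[OF w2 fs]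
      unfolding DN f_def by blast
  qed
  then have "(LINT x|M. z x * (grad z x \<bullet> e)) = 0"
    by (rule integral_grad_square_eq_0[OF z t e])
  then show False using neg by simp
qed

end

theorem theorem1p1:
  fixes p :: real and \<Omega> :: "(real ^ 'n) set" and \<gamma>1 \<gamma>2 :: "real ^ 'n \<Rightarrow> real"
  assumes "1 < p"
    and "CARD('n) \<ge> 2"
    and "open \<Omega>" and "bounded \<Omega>" and "C1_boundary \<Omega>"
    and "continuous_on (closure \<Omega>) \<gamma>1" and "\<forall>x\<in>closure \<Omega>. \<gamma>1 x > 0"
    and "continuous_on (closure \<Omega>) \<gamma>2" and "\<forall>x\<in>closure \<Omega>. \<gamma>2 x > 0"
    and "DN_map p \<Omega> \<gamma>1 = DN_map p \<Omega> \<gamma>2"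
  shows "\<forall>x\<in>frontier \<Omega>. \<gamma>1 x = \<gamma>2 x"
proof
  fix x assume x: "x \<in> frontier \<Omega>"
  interpret p_domain p \<Omega> using assms by unfold_locales
  have "2 \<le> DIM(real ^ 'n)" using assms(2) by simp
  note le = DN_map_boundary_le[OF this assms(5)]
  \<comment> \<open>The comparison is one-sided, but the hypotheses are symmetric in the two
    coefficients.\<close>
  show "\<gamma>1 x = \<gamma>2 x"
    using le[of \<gamma>1 \<gamma>2 x] le[of \<gamma>2 \<gamma>1 x] assms x by (intro antisym) auto
qed

end
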